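(* Let $d\ge1$, $\Omega=[0,1]^d$, $L>0$ and $0<m<1$. For any $p,p',q\ge1$ and $s\ge0$, $$\inf_{\tilde\mu}\ \sup_{f\in\mathcal B^{s}_{p',q}(L;m)}\mathbb E\,W_p(f,\tilde\mu)\ \gtrsim\ \begin{cases} n^{-\frac{1+s}{d+2s}} & d\ge 2,\\ n^{-1/2} & d=1,\end{cases}$$ where the infimum is taken over all estimators $\tilde\mu$ based on $n$ observations (i.i.d. with density $f$).
   Context: $a\gtrsim b$ means $a\ge c\,b$ for a positive constant $c$ not depending on $n$ (it may depend on the dimension $d$, on the wavelet system below, and on the fixed parameters); $a\lesssim b$ means $b\gtrsim a$, and $a\asymp b$ means both hold. $W_p$ denotes the $p$-Wasserstein distance: $W_p^p(\mu,\nu)=\inf_\pi\int\|x-y\|^p\,d\pi(x,y)$ over couplings $\pi$ of $\mu$ and $\nu$, with $\|\cdot\|$ the Euclidean norm; a density is identified with the measure having that density. $\mathbb E$ is expectation over $X_1,\dots,X_n$ i.i.d. with density $f$. Wavelet system. Fix sets $\Phi$ and $\Psi_j$ ($j\ge0$) of functions in $L_2(\Omega)$, of regularity $r>\max\{s,1\}$, such that: (i) $\Phi\cup\bigcup_{j\ge0}\Psi_j$ is an orthonormal basis of $L_2(\Omega)$; (ii) all these functions lie in $C^r(\Omega)$, and polynomials of degree at most $r$ on $\Omega$ lie in $\mathrm{span}(\Phi)$; (iii) each $\psi\in\Psi_j$ has the form $\psi(x)=\prod_{i=1}^d\psi_i(x_i)$ with univariate $\psi_i$; (iv) for each $\psi\in\Psi_j$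 there is a rectangle $I_\psi\subseteq\Omega$ with $\mathrm{supp}(\psi)\subseteq I_\psi$, $\mathrm{diam}(I_\psi)\lesssim 2^{-j}$, and $\|\sum_{\psi\in\Psi_j}\mathbf 1\{x\in I_\psi\}\|_{L_\infty}\lesssim1$; (v) $\|\psi\|_{L_t(\Omega)}\asymp2^{dj(\frac12-\frac1t)}$ for all $\psi\in\Psi_j$ and all exponents $t\ge 1$; (vi) $\|\nabla u\|_{L_t(\Omega)}\lesssim 2^j\|u\|_{L_t(\Omega)}$ for $u\in\mathrm{span}(\Phi\cup\bigcup_{0\le k<j}\Psi_k)$. As consequences, $|\Phi|\lesssim1$ and $|\Psi_j|\lesssim2^{dj}$. Besov norm. For a function $f$ put $\alpha=(\int f\phi)_{\phi\in\Phi}$ and $\beta_j=(\int f\psi)_{\psi\in\Psi_j}$, and $$\|f\|_{\mathcal B^s_{p,q}}=\|\alpha\|_{\ell_p}+\Big\|\big(2^{js}2^{dj(\frac12-\frac1p)}\|\beta_j\|_{\ell_p}\big)_{j\ge0}\Big\|_{\ell_q}.$$ Classes. For $L,m>0$, $\mathcal B^s_{p,q}(L)=\{f\in L_p(\Omega):\|f\|_{\mathcal B^s_{p,q}}\le L,\ \int_\Omega f=1,\ f\ge0\}$ and $\mathcal B^s_{p,q}(L;m)=\mathcal B^s_{p,q}(L)\cap\{f: f\ge m\}$.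
   Formalization: Adds the assumption that some f in the class B^s_{p',q}(L;m) has Besov norm strictly below L; for arbitrary L>0 the claim fails (for p'=2 the class is empty if L<1, and is only f=1, with risk 0, if L=1). *)

theory Defs
  imports "HOL-Probability.Probability"
begin

section \<open>Norms with extended exponents\<close>

definition ennreal_powr :: "ennreal \<Rightarrow> real \<Rightarrow> ennreal" where
  "ennreal_powr x a = (if x = \<infinity> then \<infinity> else ennreal (enn2real x powr a))"

text \<open>The exponent \<open>t\<close> ranges over \<open>[1, \<infinity>]\<close>. The argument is the pointwise absolute value, as
  an extended nonnegative function. Over \<^const>\<open>count_space\<close> this is the \<open>\<ell>\<^sub>t\<close> norm.\<close>

definition Lnorm :: "ennreal \<Rightarrow> 'a measure \<Rightarrow> ('a \<Rightarrow> ennreal) \<Rightarrow> ennreal" where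
  "Lnorm t M g =
     (if t = \<infinity> then esssup M g
      else ennreal_powr (\<integral>\<^sup>+x. ennreal_powr (g x) (enn2real t) \<partial>M) (1 / enn2real t))"

text \<open>The real number \<open>1/t\<close>, with \<open>1/\<infinity> = 0\<close>.\<close>

definition inv_exponent :: "ennreal \<Rightarrow> real" where
  "inv_exponent t = enn2real (inverse t)"

section \<open>Functions on the unit cube\<close>

text \<open>Functions on \<open>\<Omega> = [0,1]\<^sup>d\<close> are total functions on \<open>real ^ 'd\<close>; only their values on
  \<open>unit_cube\<close> are ever used.\<close>

definition unit_cube :: "(real ^ 'd) set" where
  "unit_cube = cbox 0 1"

abbreviation leb_cube :: "(real ^ 'd) measure" where
  "leb_cube \<equiv> restrict_space lborel unit_cube"

definition Lnorm_cube :: "ennreal \<Rightarrow> (real ^ 'd \<Rightarrow> 'b::real_normed_vector) \<Rightarrow> ennreal" where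
  "Lnorm_cube t f = Lnorm t leb_cube (\<lambda>x. ennreal (norm (f x)))"

definition Lspace_cube :: "ennreal \<Rightarrow> (real ^ 'd \<Rightarrow> real) set" where
  "Lspace_cube t = {f \<in> borel_measurable leb_cube. Lnorm_cube t f < \<infinity>}"

definition inner_cube :: "(real ^ 'd \<Rightarrow> real) \<Rightarrow> (real ^ 'd \<Rightarrow> real) \<Rightarrow> real" where
  "inner_cube f g = (\<integral>x. f x * g x \<partial>leb_cube)"

text \<open>Membership in the linear span of \<open>F\<close>, as functions on the cube.\<close>

definition span_cube :: "(real ^ 'd \<Rightarrow> real) set \<Rightarrow> (real ^ 'd \<Rightarrow> real) set" where
  "span_cube F = {u. \<exists>S c. finite S \<and> S \<subseteq> F \<and> (\<forall>x\<in>unit_cube. u x = (\<Sum>\<phi>\<in>S. c \<phi> * \<phi> x))}"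

definition orthonormal_basis_cube :: "(real ^ 'd \<Rightarrow> real) set \<Rightarrow> bool" where
  "orthonormal_basis_cube F \<longleftrightarrow>
     F \<subseteq> Lspace_cube 2 \<and>
     (\<forall>f\<in>F. \<forall>g\<in>F. inner_cube f g = (if f = g then 1 else 0)) \<and>
     (\<forall>f\<in>Lspace_cube 2. \<forall>\<epsilon>>0. \<exists>u\<in>span_cube F. Lnorm_cube 2 (\<lambda>x. f x - u x) < ennreal \<epsilon>)"

text \<open>\<open>C\<^sup>k\<close> with \<open>k\<close>-th order partial derivatives that are Hoelder of exponent \<open>\<gamma>\<close>. Derivatives are
  taken within \<open>S\<close>, hence one-sided at the boundary. On a compact set, \<open>\<gamma> = 0\<close> imposes nothing
  beyond continuity.\<close>

primrec holder_on :: "real \<Rightarrow> nat \<Rightarrow> (real ^ 'd) set \<Rightarrow> (real ^ 'd \<Rightarrow> real) \<Rightarrow> bool" where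
  "holder_on \<gamma> 0 S f \<longleftrightarrow>
     continuous_on S f \<and> (\<exists>B. \<forall>x\<in>S. \<forall>y\<in>S. \<bar>f x - f y\<bar> \<le> B * dist x y powr \<gamma>)"
| "holder_on \<gamma> (Suc k) S f \<longleftrightarrow>
     (\<exists>g :: 'd \<Rightarrow> real ^ 'd \<Rightarrow> real.
        (\<forall>x\<in>S. (f has_derivative (\<lambda>h. \<Sum>i\<in>UNIV. g i x * h $ i)) (at x within S)) \<and>
        (\<forall>i. holder_on \<gamma> k S (g i)))"

definition Cr_cube :: "real \<Rightarrow> (real ^ 'd \<Rightarrow> real) set" where
  "Cr_cube r = {f. holder_on (frac r) (nat \<lfloor>r\<rfloor>) unit_cube f}"

definition gradient_cube :: "(real ^ 'd \<Rightarrow> real) \<Rightarrow> real ^ 'd \<Rightarrow> real ^ 'd" where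
  "gradient_cube u x = (\<chi> i. frechet_derivative u (at x within unit_cube) (axis i 1))"

section \<open>Wavelet systems\<close>

locale wavelet_system =
  fixes r :: real
    and \<Phi> :: "(real ^ 'd \<Rightarrow> real) set"
    and \<Psi> :: "nat \<Rightarrow> (real ^ 'd \<Rightarrow> real) set"
  assumes basis: "orthonormal_basis_cube (\<Phi> \<union> (\<Union>j. \<Psi> j))"
    and regular: "\<Phi> \<union> (\<Union>j. \<Psi> j) \<subseteq> Cr_cube r"
    \<comment> \<open>monomials of total degree at most \<open>r\<close>; by linearity, all polynomials\<close>
    and polynomials: "\<And>a :: 'd \<Rightarrow> nat. real (\<Sum>i\<in>UNIV. a i) \<le> r \<Longrightarrow>
          (\<lambda>x. \<Prod>i\<in>UNIV. (x $ i) ^ a i) \<in> span_cube \<Phi>"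
    and product: "\<And>j \<psi>. \<psi> \<in> \<Psi> j \<Longrightarrow>
          \<exists>g :: 'd \<Rightarrow> real \<Rightarrow> real. \<forall>x\<in>unit_cube. \<psi> x = (\<Prod>i\<in>UNIV. g i (x $ i))"
    and localized: "\<exists>(I :: nat \<Rightarrow> (real ^ 'd \<Rightarrow> real) \<Rightarrow> (real ^ 'd) set) (C :: real). \<forall>j.
          (\<forall>\<psi>\<in>\<Psi> j. (\<exists>a b. I j \<psi> = cbox a b) \<and> I j \<psi> \<subseteq> unit_cube \<and>
             closure {x\<in>unit_cube. \<psi> x \<noteq> 0} \<subseteq> I j \<psi> \<and> diameter (I j \<psi>) \<le> C * 2 powr (- real j)) \<and>
          (AE x in leb_cube. finite {\<psi>\<in>\<Psi> j. x \<in> I j \<psi>} \<and> real (card {\<psi>\<in>\<Psi> j. x \<in> I j \<psi>}) \<le> C)"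
    and norms: "\<And>t. 1 \<le> t \<Longrightarrow> \<exists>c>0. \<exists>C. \<forall>j. \<forall>\<psi>\<in>\<Psi> j.
          ennreal (c * 2 powr (real (CARD('d) * j) * (1 / 2 - inv_exponent t))) \<le> Lnorm_cube t \<psi> \<and>
          Lnorm_cube t \<psi> \<le> ennreal (C * 2 powr (real (CARD('d) * j) * (1 / 2 - inv_exponent t)))"
    and bernstein: "\<And>t. 1 \<le> t \<Longrightarrow> \<exists>C. \<forall>j. \<forall>u\<in>span_cube (\<Phi> \<union> (\<Union>k<j. \<Psi> k)).
          Lnorm_cube t (gradient_cube u) \<le> ennreal (C * 2 powr real j) * Lnorm_cube t u"

section \<open>Besov classes\<close>

definition besov_norm ::
    "(real ^ 'd \<Rightarrow> real) set \<Rightarrow> (nat \<Rightarrow> (real ^ 'd \<Rightarrow> real) set) \<Rightarrow>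
     real \<Rightarrow> ennreal \<Rightarrow> ennreal \<Rightarrow> (real ^ 'd \<Rightarrow> real) \<Rightarrow> ennreal" where
  "besov_norm \<Phi> \<Psi> s p q f =
     Lnorm p (count_space \<Phi>) (\<lambda>\<phi>. ennreal \<bar>inner_cube f \<phi>\<bar>) +
     Lnorm q (count_space UNIV) (\<lambda>j.
       ennreal (2 powr (real j * s) * 2 powr (real (CARD('d) * j) * (1 / 2 - inv_exponent p))) *
       Lnorm p (count_space (\<Psi> j)) (\<lambda>\<psi>. ennreal \<bar>inner_cube f \<psi>\<bar>))"

definition besov_densities ::
    "(real ^ 'd \<Rightarrow> real) set \<Rightarrow> (nat \<Rightarrow> (real ^ 'd \<Rightarrow> real) set) \<Rightarrow>
     real \<Rightarrow> ennreal \<Rightarrow> ennreal \<Rightarrow> real \<Rightarrow> (real ^ 'd \<Rightarrow> real) set" where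
  "besov_densities \<Phi> \<Psi> s p q L =
     {f \<in> Lspace_cube p. besov_norm \<Phi> \<Psi> s p q f \<le> ennreal L \<and>
        (\<integral>x. f x \<partial>leb_cube) = 1 \<and> (AE x in leb_cube. 0 \<le> f x)}"

definition besov_densities_ge ::
    "(real ^ 'd \<Rightarrow> real) set \<Rightarrow> (nat \<Rightarrow> (real ^ 'd \<Rightarrow> real) set) \<Rightarrow>
     real \<Rightarrow> ennreal \<Rightarrow> ennreal \<Rightarrow> real \<Rightarrow> real \<Rightarrow> (real ^ 'd \<Rightarrow> real) set" where
  "besov_densities_ge \<Phi> \<Psi> s p q L m =
     besov_densities \<Phi> \<Psi> s p q L \<inter> {f. AE x in leb_cube. m \<le> f x}"

section \<open>Wasserstein distance and minimax risk\<close>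

definition couplings :: "'a measure \<Rightarrow> 'a measure \<Rightarrow> ('a \<times> 'a) measure set" where
  "couplings \<mu> \<nu> = {\<pi>. sets \<pi> = sets (\<mu> \<Otimes>\<^sub>M \<nu>) \<and> distr \<pi> \<mu> fst = \<mu> \<and> distr \<pi> \<nu> snd = \<nu>}"

definition wasserstein :: "real \<Rightarrow> 'a::metric_space measure \<Rightarrow> 'a measure \<Rightarrow> ennreal" where
  "wasserstein p \<mu> \<nu> =
     ennreal_powr (INF \<pi>\<in>couplings \<mu> \<nu>. \<integral>\<^sup>+z. ennreal (dist (fst z) (snd z) powr p) \<partial>\<pi>) (1 / p)"

text \<open>The law on \<open>real ^ 'd\<close>, carried by the cube, with density \<open>f\<close> there.\<close>

definition law :: "(real ^ 'd \<Rightarrow> real) \<Rightarrow> (real ^ 'd) measure" where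
  "law f = density lborel (\<lambda>x. indicator unit_cube x * ennreal (f x))"

text \<open>Estimators are measurable functions of the sample with values in the Borel probability
  measures on \<open>real ^ 'd\<close>; they need not be carried by the cube.\<close>

definition estimators :: "nat \<Rightarrow> ((nat \<Rightarrow> real ^ 'd) \<Rightarrow> (real ^ 'd) measure) set" where
  "estimators n = (\<Pi>\<^sub>M i\<in>{..<n}. borel) \<rightarrow>\<^sub>M prob_algebra borel"

definition wasserstein_risk ::
    "real \<Rightarrow> nat \<Rightarrow> (real ^ 'd \<Rightarrow> real) \<Rightarrow> ((nat \<Rightarrow> real ^ 'd) \<Rightarrow> (real ^ 'd) measure) \<Rightarrow> ennreal" where
  "wasserstein_risk p n f \<mu>' = (\<integral>\<^sup>+X. wasserstein p (law f) (\<mu>' X) \<partial>(\<Pi>\<^sub>M i\<in>{..<n}. law f))"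

end

(* The density of the class with small Besov norm is mixed with the uniform density and perturbed by
   e * (sum of the wavelets in T), for T a subset of the wavelets of one level j outside Phi. Testing
   W_p against a Lipschitz combination of the level-j wavelets (Kantorovich duality, with the Lipschitz
   constant from Bernstein's inequality) bounds it from below by 2^(-j - d j / 2) times the l_1 error
   in estimating the level-j coefficients. Neighbouring T differ by chi-square distance at most
   e^2 / m, so with e of order at most n^(-1/2) Assouad's lemma applies.

   That there are of order 2^(d j) wavelets at some level j within bounded distance of any large J
   is not an axiom. It follows from the completeness of the system: cos (2^J pi x_1) is nearly
   orthogonal to much coarser levels (its sign alternates) and to much finer ones (it is smooth at
   their scale, and wavelets have mean zero), so its energy lies in the levels near J, where each
   coefficient is at most of order 2^(- d j / 2). *)
theory Submission
  imports Defs
begin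

section \<open>Mixed-exponent norms\<close>

text \<open>A perturbation needs room in two constraints. The strict inequality
  \<open>besov_norm \<Phi> \<Psi> s p' q f0 < ennreal L\<close> is the room in the norm. Mixing in
  the uniform density with weight \<delta> lifts the lower bound \<open>m\<close> by
  \<open>\<delta> * (1 - m)\<close>, which is positive since \<open>m < 1\<close>. Without a density
  strictly inside the ball the class may be empty, with supremum zero.

  With \<open>amp j\<close> equal to 2^(d j / 2), a perturbation of size \<open>e\<close> at level
  \<open>j\<close> has Besov norm at most of order e 2^(j s) amp j. So \<open>e\<close> is of the
  order of the smaller of 2^(- j s) / amp j and n^(-1/2), and the level yields the minimum of 2^(- j
  (1 + s)) and 2^(j (d/2 - 1)) n^(-1/2). The second term does not decrease in \<open>j\<close> when
  d >= 2, so 2^j is of order n^(1/(d + 2 s)); for d = 1 it decreases, so \<open>j\<close> stays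
  bounded.

  Orthonormality concerns the union of \<Phi> and all levels as one set, so a function may lie in
  \<Phi> and in several levels. Removing \<Phi> gives mean zero, and supremum norms show that levels
  sharing a function are close.\<close>

lemma ennreal_powr_ennreal [simp]: "0 \<le> x \<Longrightarrow> ennreal_powr (ennreal x) a = ennreal (x powr a)"
  by (simp add: ennreal_powr_def)

lemma ennreal_powr_top [simp]: "ennreal_powr \<top> a = \<top>"
  by (simp add: ennreal_powr_def)

lemma ennreal_powr_zero [simp]: "ennreal_powr 0 a = 0"
  by (simp add: ennreal_powr_def)

lemma ennreal_powr_mono:
  assumes "x \<le> y" "0 \<le> a" shows "ennreal_powr x a \<le> ennreal_powr y a"
proof (cases "y = \<top>")
  case False
  then obtain u v where "x = ennreal u" "y = ennreal v" "0 \<le> u" "0 \<le> v" "u \<le> v"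
    using assms(1) by (cases x; cases y) (auto simp: top_unique)
  then show ?thesis using assms(2) by (simp add: powr_mono2 ennreal_leI)
qed simp

lemma measurable_ennreal_powr [measurable]: "(\<lambda>x. ennreal_powr x a) \<in> borel_measurable borel"
  unfolding ennreal_powr_def by measurable

lemma ennreal_powr_cmult:
  assumes "0 \<le> c"
  shows "ennreal_powr (ennreal c * x) a = ennreal (c powr a) * ennreal_powr x a"
proof (cases x)
  case (real u)
  then show ?thesis using assms by (simp flip: ennreal_mult add: powr_mult)
next
  case top
  then show ?thesis using assms by (cases "c = 0") (auto simp: ennreal_mult_top)
qed

lemma exponent_cases:
  assumes "1 \<le> (t::ennreal)"
  obtains "t = \<infinity>" | a where "t = ennreal a" "1 \<le> a" "enn2real t = a" "inv_exponent t = 1 / a"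
proof (cases t)
  case (real a)
  then have "1 \<le> a" using assms by simp
  then show ?thesis using that(2)[of a] real
    by (simp add: inv_exponent_def inverse_ennreal enn2real_ennreal divide_simps)
qed (use that in auto)

lemma inv_exponent_top [simp]: "inv_exponent \<top> = 0"
  by (simp add: inv_exponent_def)

lemma inv_exponent_bounds:
  assumes "1 \<le> t" shows "0 \<le> inv_exponent t" "inv_exponent t \<le> 1"
proof -
  have "0 \<le> inv_exponent t \<and> inv_exponent t \<le> 1"
    using assms by (rule exponent_cases) auto
  then show "0 \<le> inv_exponent t" "inv_exponent t \<le> 1" by auto
qed

lemma Lnorm_top: "Lnorm \<top> M g = esssup M g"
  by (simp add: Lnorm_def)

lemma Lnorm_ennreal:
  "0 \<le> a \<Longrightarrow> Lnorm (ennreal a) M g = ennreal_powr (\<integral>\<^sup>+x. ennreal_powr (g x) a \<partial>M) (1 / a)"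
  by (simp add: Lnorm_def)

lemma Lnorm_one: "Lnorm 1 M g = (\<integral>\<^sup>+x. g x \<partial>M)"
proof -
  have "ennreal_powr x 1 = x" for x by (cases x) auto
  then show ?thesis using Lnorm_ennreal[of 1 M g] by simp
qed

lemma Lnorm_AE_mono:
  assumes t: "1 \<le> t" and [measurable]: "f \<in> borel_measurable M" and le: "AE x in M. f x \<le> g x"
  shows "Lnorm t M f \<le> Lnorm t M g"
  using t
proof (cases rule: exponent_cases)
  case 1
  then show ?thesis by (simp add: Lnorm_top esssup_AE_mono le)
next
  case (2 a)
  have "AE x in M. ennreal_powr (f x) a \<le> ennreal_powr (g x) a"
    using le by eventually_elim (use 2 in \<open>auto intro: ennreal_powr_mono\<close>)
  then show ?thesis using 2 by (auto simp: Lnorm_ennreal intro!: ennreal_powr_mono nn_integral_mono_AE)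
qed

lemma Lnorm_mono:
  assumes "1 \<le> t" "f \<in> borel_measurable M" "\<And>x. f x \<le> g x"
  shows "Lnorm t M f \<le> Lnorm t M g"
  using assms by (intro Lnorm_AE_mono) auto

lemma Lnorm_cmult_le:
  assumes t: "1 \<le> t" and c: "0 \<le> c" and [measurable]: "f \<in> borel_measurable M"
  shows "Lnorm t M (\<lambda>x. ennreal c * f x) \<le> ennreal c * Lnorm t M f"
  using t
proof (cases rule: exponent_cases)
  case 1
  have "AE x in M. ennreal c * f x \<le> ennreal c * esssup M f"
    using esssup_AE[where M=M and f=f] by eventually_elim (simp add: mult_left_mono)
  then show ?thesis using 1 by (auto simp: Lnorm_top)
next
  case (2 a)
  have "(\<integral>\<^sup>+x. ennreal_powr (ennreal c * f x) a \<partial>M) = ennreal (c powr a) * (\<integral>\<^sup>+x. ennreal_powr (f x) a \<partial>M)"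
    using c by (simp add: ennreal_powr_cmult nn_integral_cmult)
  then show ?thesis using 2 c by (simp add: Lnorm_ennreal ennreal_powr_cmult powr_powr)
qed

text \<open>Convexity of \<open>powr\<close> is available on the open half-line. At the endpoint 0
  the claim reduces to \<open>l powr a \<le> l\<close> for weights \<open>l\<close> at most
  1.\<close>

lemma powr_convex_combination:
  fixes x y l m a :: real
  assumes "0 \<le> x" "0 \<le> y" "0 \<le> l" "0 \<le> m" "l + m = 1" "1 \<le> a"
  shows "(l * x + m * y) powr a \<le> l * x powr a + m * y powr a"
proof -
  have *: "(l * x) powr a \<le> l * x powr a" if "0 \<le> x" "0 \<le> l" "l \<le> 1" for l x :: real
  proof (cases "l = 0")
    case False
    then have "l powr a \<le> l powr 1" using that assms by (intro powr_mono') auto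
    then show ?thesis using that False by (simp add: powr_mult mult_right_mono)
  qed simp
  show ?thesis
  proof (cases "x = 0 \<or> y = 0")
    case True
    then show ?thesis using *[of x l] *[of y m] assms by auto
  next
    case False
    have "l = 1 - m" using assms by simp
    moreover have "((1 - m) * x + m * y) powr a \<le> (1 - m) * x powr a + m * y powr a"
      using convex_onD[OF powr_convex[OF assms(6)], of m x y] False assms by simp
    ultimately show ?thesis by simp
  qed
qed

text \<open>Minkowski's inequality, with upper bounds in place of the two norms: dividing by
  \<open>A\<close> and \<open>B\<close> reduces it to the convexity of the power function.\<close>

lemma Lnorm_add_le_bound:
  assumes t: "1 \<le> t" and [measurable]: "f \<in> borel_measurable M" "g \<in> borel_measurable M"
    and A: "Lnorm t M f \<le> ennreal A" "0 < A" and B: "Lnorm t M g \<le> ennreal B" "0 < B"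
  shows "Lnorm t M (\<lambda>x. f x + g x) \<le> ennreal (A + B)"
  using t
proof (cases rule: exponent_cases)
  case 1
  have "AE x in M. f x \<le> ennreal A" "AE x in M. g x \<le> ennreal B"
    using A(1) B(1) esssup_AE[where M=M and f=f] esssup_AE[where M=M and f=g]
    by (simp_all add: 1 Lnorm_top) (metis (mono_tags, lifting) eventually_mono order_trans)+
  then have "AE x in M. f x + g x \<le> ennreal (A + B)"
    by eventually_elim (use A B in \<open>auto simp: ennreal_plus intro: add_mono\<close>)
  then show ?thesis using 1 by (auto simp: Lnorm_top)
next
  case (2 a)
  have a: "0 < a" using 2 by simp
  have bd: "(\<integral>\<^sup>+x. ennreal_powr (f x) a \<partial>M) \<le> ennreal (A powr a)"
    if "Lnorm t M f \<le> ennreal A" "0 < A" for f A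
  proof -
    have "ennreal_powr (ennreal_powr (\<integral>\<^sup>+x. ennreal_powr (f x) a \<partial>M) (1 / a)) a \<le> ennreal_powr (ennreal A) a"
      using that 2 by (intro ennreal_powr_mono) (auto simp: Lnorm_ennreal)
    moreover have "ennreal_powr (ennreal_powr I (1 / a)) a = I" for I
      using a by (cases I) (auto simp: powr_powr)
    ultimately show ?thesis using that by simp
  qed
  define l where "l = A / (A + B)"
  define k where "k = B / (A + B)"
  have lk: "0 \<le> l" "0 \<le> k" "l + k = 1" unfolding l_def k_def using A B by (auto simp: divide_simps)
  define D where "D = (A + B) powr a"
  \<comment> \<open>The weights \<open>l\<close> and \<open>k\<close> are the shares of
    \<open>A\<close> and \<open>B\<close> in \<open>A + B\<close>. The divisors
    \<open>A powr a\<close> and \<open>B powr a\<close> cancel against the bounds on the two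
    integrals, which leaves \<open>D * (l + k) = D\<close>.\<close>
  have pw: "ennreal_powr (u + v) a \<le> ennreal (D * l / A powr a) * ennreal_powr u a + ennreal (D * k / B powr a) * ennreal_powr v a" for u v
  proof (cases "u = \<top> \<or> v = \<top>")
    case True
    have "0 < D * l / A powr a" "0 < D * k / B powr a" unfolding D_def l_def k_def using A B by auto
    then show ?thesis using True by (auto simp: ennreal_mult_top)
  next
    case False
    then obtain x y where xy: "u = ennreal x" "v = ennreal y" "0 \<le> x" "0 \<le> y"
      by (cases u; cases v) auto
    have "x + y = (A + B) * (l * (x / A) + k * (y / B))"
    proof -
      have "l * (x / A) = x / (A + B)" "k * (y / B) = y / (A + B)"
        unfolding l_def k_def using A B by (auto simp: field_simps)
      then show ?thesis using A B by (simp flip: add_divide_distrib)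
    qed
    then have "(x + y) powr a = D * (l * (x / A) + k * (y / B)) powr a"
      unfolding D_def using A B xy lk by (simp add: powr_mult)
    also have "\<dots> \<le> D * (l * (x / A) powr a + k * (y / B) powr a)"
      using powr_convex_combination[of "x/A" "y/B" l k a] xy A B lk 2 by (intro mult_left_mono) (auto simp: D_def)
    also have "\<dots> = (D * l / A powr a) * x powr a + (D * k / B powr a) * y powr a"
      using xy A B by (simp add: powr_divide algebra_simps)
    finally have *: "(x + y) powr a \<le> (D * l / A powr a) * x powr a + (D * k / B powr a) * y powr a" .
    have "0 \<le> D * l / A powr a" "0 \<le> D * k / B powr a" unfolding D_def using A B lk by auto
    moreover from this have "0 \<le> D * l / A powr a * x powr a" "0 \<le> D * k / B powr a * y powr a"
      by (metis mult_nonneg_nonneg powr_ge_zero)+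
    ultimately have "ennreal ((D * l / A powr a) * x powr a + (D * k / B powr a) * y powr a)
        = ennreal (D * l / A powr a) * ennreal_powr u a + ennreal (D * k / B powr a) * ennreal_powr v a"
      using xy by (subst ennreal_plus) (simp_all only: ennreal_mult ennreal_powr_ennreal powr_ge_zero)
    then show ?thesis using * xy by (metis add_nonneg_nonneg ennreal_leI ennreal_plus ennreal_powr_ennreal)
  qed
  have "(\<integral>\<^sup>+x. ennreal_powr (f x + g x) a \<partial>M)
      \<le> (\<integral>\<^sup>+x. ennreal (D * l / A powr a) * ennreal_powr (f x) a + ennreal (D * k / B powr a) * ennreal_powr (g x) a \<partial>M)"
    by (intro nn_integral_mono pw)
  also have "\<dots> = ennreal (D * l / A powr a) * (\<integral>\<^sup>+x. ennreal_powr (f x) a \<partial>M)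
      + ennreal (D * k / B powr a) * (\<integral>\<^sup>+x. ennreal_powr (g x) a \<partial>M)"
    by (simp add: nn_integral_add nn_integral_cmult)
  also have "\<dots> \<le> ennreal (D * l / A powr a) * ennreal (A powr a) + ennreal (D * k / B powr a) * ennreal (B powr a)"
    by (intro add_mono mult_left_mono bd A B) auto
  also have "\<dots> = ennreal (D * l + D * k)"
    using A B lk by (simp flip: ennreal_plus ennreal_mult add: D_def)
  also have "D * l + D * k = D" using lk by (metis distrib_left mult.right_neutral)
  finally have "Lnorm t M (\<lambda>x. f x + g x) \<le> ennreal_powr (ennreal D) (1 / a)"
    using 2 by (auto simp: Lnorm_ennreal intro!: ennreal_powr_mono)
  also have "\<dots> = ennreal (A + B)" using a A B by (simp add: D_def powr_powr)
  finally show ?thesis .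
qed

lemma Lnorm_add_le:
  assumes t: "1 \<le> t" and "f \<in> borel_measurable M" "g \<in> borel_measurable M"
  shows "Lnorm t M (\<lambda>x. f x + g x) \<le> Lnorm t M f + Lnorm t M g"
proof (cases "Lnorm t M f" "Lnorm t M g" rule: ennreal2_cases)
  case (real_real A B)
  show ?thesis
  proof (rule ennreal_le_epsilon)
    \<comment> \<open>\<open>Lnorm_add_le_bound\<close> divides by its bounds, so a norm that is
      zero has to be enlarged; \<open>e / 2\<close> is added to each.\<close>
    fix e :: real assume e: "0 < e"
    have "Lnorm t M (\<lambda>x. f x + g x) \<le> ennreal ((A + e / 2) + (B + e / 2))"
      using real_real e assms by (intro Lnorm_add_le_bound) (auto intro!: ennreal_leI)
    also have "\<dots> = Lnorm t M f + Lnorm t M g + ennreal e"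
      using real_real e by (simp flip: ennreal_plus)
    finally show "Lnorm t M (\<lambda>x. f x + g x) \<le> Lnorm t M f + Lnorm t M g + ennreal e" .
  qed
qed auto

text \<open>Serves both layers of the Besov norm: the coefficients within one level and the sequence
  over the levels. The condition \<open>1 \<le> N\<close> makes the factor \<open>N powr 0\<close>
  equal to 1 at infinite exponent, whereas \<open>0 powr 0 = 0\<close>.\<close>

lemma Lnorm_sparse:
  assumes t: "1 \<le> t" and F: "finite F" "real (card F) \<le> N" "1 \<le> N" and e: "0 \<le> e"
    and g: "\<And>x. x \<in> I \<Longrightarrow> g x \<le> ennreal e" and z: "\<And>x. x \<in> I \<Longrightarrow> x \<notin> F \<Longrightarrow> g x = 0"
  shows "Lnorm t (count_space I) g \<le> ennreal (e * N powr inv_exponent t)"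
  using t
proof (cases rule: exponent_cases)
  case 1
  then show ?thesis using F g by (auto simp: Lnorm_top AE_count_space intro!: esssup_I)
next
  case (2 a)
  have a: "0 < a" using 2 by simp
  have "(\<integral>\<^sup>+x. ennreal_powr (g x) a \<partial>count_space I) = (\<integral>\<^sup>+x. ennreal_powr (g x) a \<partial>count_space (I \<inter> F))"
    using z by (intro nn_integral_count_space_eq) auto
  also have "\<dots> = (\<Sum>x\<in>I \<inter> F. ennreal_powr (g x) a)"
    using F by (intro nn_integral_count_space_finite) auto
  also have "\<dots> \<le> (\<Sum>x\<in>I \<inter> F. ennreal (e powr a))"
    using g a e ennreal_powr_mono[of _ "ennreal e" a] by (intro sum_mono) auto
  also have "\<dots> = ennreal (real (card (I \<inter> F)) * e powr a)"
    by (simp add: ennreal_mult ennreal_of_nat_eq_real_of_nat)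
  also have "\<dots> \<le> ennreal (N * e powr a)"
    using card_mono[of F "I \<inter> F"] F by (intro ennreal_leI mult_right_mono) auto
  finally have "Lnorm t (count_space I) g \<le> ennreal_powr (ennreal (N * e powr a)) (1 / a)"
    using 2 by (auto simp: Lnorm_ennreal intro!: ennreal_powr_mono)
  also have "\<dots> = ennreal (e * N powr inv_exponent t)"
    using F e a 2 by (simp add: powr_mult powr_powr mult.commute)
  finally show ?thesis .
qed

section \<open>Functions on the cube\<close>

lemma unit_cube_sets [measurable, simp]: "(unit_cube :: (real ^ 'd) set) \<in> sets borel"
  by (simp add: unit_cube_def)

lemma emeasure_unit_cube: "emeasure lborel (unit_cube :: (real ^ 'd) set) = 1"
proof -
  have "((1::real ^ 'd) - 0) \<bullet> b = 1" if "b \<in> Basis" for b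
    using that by (auto simp: Basis_vec_def inner_axis)
  then show ?thesis
    unfolding unit_cube_def
    by (subst emeasure_lborel_cbox) (auto simp: Basis_vec_def inner_axis)
qed

lemma space_leb_cube [simp]: "space leb_cube = unit_cube"
  by (simp add: space_restrict_space)

lemma prob_space_leb_cube: "prob_space (leb_cube :: (real ^ 'd) measure)"
  by (rule prob_spaceI) (simp add: emeasure_restrict_space emeasure_unit_cube space_restrict_space)

lemma AE_leb_cube_iff: "(AE x in leb_cube. P x) \<longleftrightarrow> (AE x in lborel. x \<in> unit_cube \<longrightarrow> P x)"
  by (rule AE_restrict_space_iff) simp

lemma AE_leb_cubeI: "(\<And>x. x \<in> unit_cube \<Longrightarrow> P x) \<Longrightarrow> AE x in leb_cube. P x"
  by (rule AE_I2) simp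

lemma compact_unit_cube: "compact (unit_cube :: (real ^ 'd) set)"
  and convex_unit_cube: "convex (unit_cube :: (real ^ 'd) set)"
  by (auto simp: unit_cube_def)

lemma continuous_on_cube_measurable:
  "continuous_on unit_cube f \<Longrightarrow> f \<in> borel_measurable (leb_cube :: (real ^ 'd) measure)"
  for f :: "real ^ 'd \<Rightarrow> 'b::topological_space"
  using borel_measurable_continuous_on_restrict[of unit_cube f]
  by (simp add: measurable_def space_restrict_space sets_restrict_space)

lemma bounded_integrable_leb_cube:
  fixes f :: "real ^ 'd \<Rightarrow> real"
  assumes "f \<in> borel_measurable leb_cube" "\<And>x. x \<in> unit_cube \<Longrightarrow> \<bar>f x\<bar> \<le> B"
  shows "integrable leb_cube f"
proof -
  interpret prob_space "leb_cube :: (real ^ 'd) measure" by (rule prob_space_leb_cube)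
  show ?thesis using assms by (intro integrable_const_bound[of _ B]) (auto intro!: AE_leb_cubeI)
qed

lemma continuous_integrable_leb_cube:
  fixes f :: "real ^ 'd \<Rightarrow> real"
  assumes "continuous_on unit_cube f"
  shows "integrable leb_cube f"
proof -
  have "bounded (f ` unit_cube)"
    using compact_continuous_image[OF assms compact_unit_cube] compact_imp_bounded by blast
  then obtain B where "\<And>x. x \<in> unit_cube \<Longrightarrow> \<bar>f x\<bar> \<le> B"
    by (auto simp: bounded_iff)
  then show ?thesis
    using bounded_integrable_leb_cube continuous_on_cube_measurable[OF assms] by blast
qed

text \<open>Every point of the cube is a limit of interior points, so a violation, even on the
  boundary, spreads to a nonempty open subset of the cube, which is not a null set. This converts
  the essential suprema in the wavelet axioms into pointwise bounds.\<close>

lemma continuous_AE_cube_le: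
  fixes f :: "real ^ 'd \<Rightarrow> real"
  assumes f: "continuous_on unit_cube f" and le: "AE x in leb_cube. f x \<le> B" and x: "x \<in> unit_cube"
  shows "f x \<le> B"
proof (rule ccontr)
  assume "\<not> f x \<le> B"
  then have fx: "f x \<in> {B<..}" by simp
  obtain U where U: "open U" "U \<inter> unit_cube = f -` {B<..} \<inter> unit_cube"
    using f[unfolded continuous_on_open_invariant, rule_format, OF open_greaterThan[of B]] by auto
  have "x \<in> U" using U fx x by auto
  have ne: "box 0 (1::real^'d) \<noteq> {}"
    by (auto simp: box_ne_empty Basis_vec_def inner_axis)
  have "x \<in> closure (box 0 1)"
    using x closure_box[OF ne] by (simp add: unit_cube_def)
  then have ne2: "U \<inter> box 0 1 \<noteq> {}"
    using open_Int_closure_eq_empty[OF U(1), of "box 0 1"] \<open>x \<in> U\<close> by blast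
  have "AE y in lborel. y \<notin> U \<inter> box 0 1"
  proof -
    have "AE y in lborel. y \<in> unit_cube \<longrightarrow> f y \<le> B" by (rule AE_leb_cube_iff[THEN iffD1, OF le])
    then show ?thesis
    proof eventually_elim
      case (elim y)
      have "y \<in> unit_cube" if "y \<in> box 0 1" using that box_subset_cbox by (auto simp: unit_cube_def)
      moreover have "B < f y" if "y \<in> U \<inter> unit_cube"
        using that unfolding U(2) by simp
      ultimately show ?case using elim by force
    qed
  qed
  moreover have op: "open (U \<inter> box 0 1)" by (intro open_Int open_box U(1))
  ultimately have "U \<inter> box 0 1 \<in> null_sets lborel"
    by (subst AE_iff_null_sets) (auto simp: borel_open)
  then have "negligible (U \<inter> box 0 1)"
    by (simp add: negligible_iff_null_sets null_sets_completionI)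
  then show False using open_not_negligible[OF op ne2] by simp
qed

lemma continuous_AE_cube_abs_le:
  fixes f :: "real ^ 'd \<Rightarrow> real"
  assumes f: "continuous_on unit_cube f" and le: "AE x in leb_cube. \<bar>f x\<bar> \<le> B" and x: "x \<in> unit_cube"
  shows "\<bar>f x\<bar> \<le> B"
  using continuous_AE_cube_le[of "\<lambda>x. \<bar>f x\<bar>", OF _ le x] f by (auto intro: continuous_intros)

text \<open>One unfolding of \<open>holder_on\<close>, with the moduli forgotten. The partial
  derivatives are kept as explicit continuous functions so that an almost everywhere bound on the
  gradient can be read at every point.\<close>

definition C1_cube :: "(real ^ 'd \<Rightarrow> real) \<Rightarrow> ('d \<Rightarrow> real ^ 'd \<Rightarrow> real) \<Rightarrow> bool" where
  "C1_cube f g \<longleftrightarrow>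
     (\<forall>x\<in>unit_cube. (f has_derivative (\<lambda>h. \<Sum>i\<in>UNIV. g i x * h $ i)) (at x within unit_cube)) \<and>
     (\<forall>i. continuous_on unit_cube (g i))"

lemma holder_on_continuous:
  assumes "holder_on \<gamma> k S f" shows "continuous_on S f"
proof (cases k)
  case (Suc l)
  then obtain g where "\<And>x. x \<in> S \<Longrightarrow> (f has_derivative (\<lambda>h. \<Sum>i\<in>UNIV. g i x * h $ i)) (at x within S)"
    using assms by auto
  then show ?thesis by (rule has_derivative_continuous_on)
qed (use assms in simp)

lemma C1_cubeI_Cr:
  assumes "f \<in> Cr_cube r" "1 < r" obtains g where "C1_cube f g"
proof -
  have "1 \<le> nat \<lfloor>r\<rfloor>" using assms(2) by linarith
  then obtain k where "nat \<lfloor>r\<rfloor> = Suc k" by (cases "nat \<lfloor>r\<rfloor>") auto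
  then obtain g where "\<forall>x\<in>unit_cube. (f has_derivative (\<lambda>h. \<Sum>i\<in>UNIV. g i x * h $ i)) (at x within unit_cube)"
    "\<forall>i. holder_on (frac r) k unit_cube (g i)"
    using assms(1) by (auto simp: Cr_cube_def)
  then have "C1_cube f g" by (auto simp: C1_cube_def intro: holder_on_continuous)
  then show ?thesis by (rule that)
qed

lemma C1_cube_continuous: "C1_cube f g \<Longrightarrow> continuous_on unit_cube f"
  unfolding C1_cube_def by (rule has_derivative_continuous_on) blast

lemma C1_cube_sum:
  fixes u :: "real ^ 'd \<Rightarrow> real"
  assumes "\<And>\<phi>. \<phi> \<in> S \<Longrightarrow> C1_cube \<phi> (G \<phi>)" and u: "\<And>x. x \<in> unit_cube \<Longrightarrow> u x = (\<Sum>\<phi>\<in>S. c \<phi> * \<phi> x)"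
  shows "C1_cube u (\<lambda>i x. \<Sum>\<phi>\<in>S. c \<phi> * G \<phi> i x)"
  unfolding C1_cube_def
proof (intro conjI ballI allI)
  fix x :: "real ^ 'd" assume x: "x \<in> unit_cube"
  have "((\<lambda>x. \<Sum>\<phi>\<in>S. c \<phi> * \<phi> x) has_derivative (\<lambda>h. \<Sum>\<phi>\<in>S. c \<phi> * (\<Sum>i\<in>UNIV. G \<phi> i x * h $ i))) (at x within unit_cube)"
    using assms(1) x by (intro has_derivative_sum has_derivative_mult_right) (auto simp: C1_cube_def)
  moreover have "(\<Sum>\<phi>\<in>S. c \<phi> * (\<Sum>i\<in>UNIV. G \<phi> i x * h $ i)) = (\<Sum>i\<in>UNIV. (\<Sum>\<phi>\<in>S. c \<phi> * G \<phi> i x) * h $ i)" for h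
    unfolding sum_distrib_left sum_distrib_right by (subst sum.swap) (simp add: mult.assoc)
  ultimately have "((\<lambda>x. \<Sum>\<phi>\<in>S. c \<phi> * \<phi> x) has_derivative (\<lambda>h. \<Sum>i\<in>UNIV. (\<Sum>\<phi>\<in>S. c \<phi> * G \<phi> i x) * h $ i)) (at x within unit_cube)"
    by simp
  then show "(u has_derivative (\<lambda>h. \<Sum>i\<in>UNIV. (\<Sum>\<phi>\<in>S. c \<phi> * G \<phi> i x) * h $ i)) (at x within unit_cube)"
    using x u by (rule has_derivative_transform[rotated 2]) auto
next
  show "continuous_on unit_cube (\<lambda>x. \<Sum>\<phi>\<in>S. c \<phi> * G \<phi> i x)" for i
    using assms(1) by (auto simp: C1_cube_def intro!: continuous_intros)
qed

text \<open>The cube is nondegenerate in every coordinate direction, so a derivative within it is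
  unique at boundary points too, and \<open>frechet_derivative\<close> must pick the given
  one.\<close>

lemma gradient_cube_eq:
  assumes "C1_cube f g" "x \<in> unit_cube"
  shows "gradient_cube f x = (\<chi> i. g i x)"
proof -
  have "frechet_derivative f (at x within unit_cube) = (\<lambda>h. \<Sum>i\<in>UNIV. g i x * h $ i)"
    unfolding unit_cube_def using assms
    by (intro frechet_derivative_within_cbox) (auto simp: C1_cube_def unit_cube_def Basis_vec_def inner_axis)
  then show ?thesis by (simp add: gradient_cube_def axis_def if_distrib cong: if_cong)
qed

lemma Lnorm_cube_top_AE:
  assumes "Lnorm_cube \<top> u \<le> ennreal M" "0 \<le> M"
  shows "AE x in leb_cube. norm (u x) \<le> M"
proof -
  have "AE x in leb_cube. ennreal (norm (u x)) \<le> Lnorm_cube \<top> u"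
    unfolding Lnorm_cube_def Lnorm_top by (rule esssup_AE)
  then show ?thesis
  proof eventually_elim
    case (elim x)
    then have "ennreal (norm (u x)) \<le> ennreal M" using assms(1) by (rule order_trans)
    then show ?case using assms(2) by simp
  qed
qed

text \<open>By continuity the essential bound on the gradient holds at every point, and the cube is
  convex, so the mean value inequality applies along segments.\<close>

lemma lipschitz_of_gradient_bound:
  fixes f :: "real ^ 'd \<Rightarrow> real"
  assumes C1: "C1_cube f g" and B: "Lnorm_cube \<top> (gradient_cube f) \<le> ennreal B" "0 \<le> B"
    and xy: "x \<in> unit_cube" "y \<in> unit_cube"
  shows "\<bar>f x - f y\<bar> \<le> B * dist x y"
proof -
  have cg: "continuous_on unit_cube (\<lambda>x. norm (\<chi> i. g i x))"
    using C1 by (intro continuous_intros continuous_on_vec_lambda) (auto simp: C1_cube_def)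
  have "AE z in leb_cube. norm (\<chi> i. g i z) \<le> B"
    using Lnorm_cube_top_AE[OF B] AE_space
  proof eventually_elim
    case (elim z)
    then show ?case using gradient_cube_eq[OF C1, of z] by simp
  qed
  then have le: "norm (\<chi> i. g i z) \<le> B" if "z \<in> unit_cube" for z
    using continuous_AE_cube_le[OF cg _ that] by blast
  have "norm (f x - f y) \<le> B * norm (x - y)"
  proof (rule differentiable_bound[OF convex_unit_cube _ _ xy])
    show "(f has_derivative (\<lambda>h. \<Sum>i\<in>UNIV. g i z * h $ i)) (at z within unit_cube)" if "z \<in> unit_cube" for z
      using C1 that by (auto simp: C1_cube_def)
    show "onorm (\<lambda>h::real^'d. \<Sum>i\<in>UNIV. g i z * h $ i) \<le> B" if z: "z \<in> unit_cube" for z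
    proof (rule onorm_le)
      fix h :: "real ^ 'd"
      have "(\<Sum>i\<in>UNIV. g i z * h $ i) = (\<chi> i. g i z) \<bullet> h" by (simp add: inner_vec_def)
      then have "norm (\<Sum>i\<in>UNIV. g i z * h $ i) \<le> norm (\<chi> i. g i z) * norm h"
        by (simp add: Cauchy_Schwarz_ineq2)
      also have "\<dots> \<le> B * norm h" using le[OF z] by (simp add: mult_right_mono)
      finally show "norm (\<Sum>i\<in>UNIV. g i z * h $ i) \<le> B * norm h" .
    qed
  qed
  then show ?thesis by (simp add: dist_norm)
qed

lemma Lnorm_cube_top_le:
  fixes u :: "real ^ 'd \<Rightarrow> real"
  assumes "u \<in> borel_measurable leb_cube" "\<And>x. x \<in> unit_cube \<Longrightarrow> \<bar>u x\<bar> \<le> M"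
  shows "Lnorm_cube \<top> u \<le> ennreal M"
  unfolding Lnorm_cube_def Lnorm_top
  by (rule esssup_I) (use assms in \<open>auto intro!: AE_leb_cubeI ennreal_leI\<close>)

section \<open>Algebra of the inner product on the cube\<close>

lemma inner_cube_cong_left:
  "(\<And>x. x \<in> unit_cube \<Longrightarrow> f x = f' x) \<Longrightarrow> inner_cube f g = inner_cube f' g"
  unfolding inner_cube_def by (intro Bochner_Integration.integral_cong) auto

lemma inner_cube_commute: "inner_cube f g = inner_cube g f"
  unfolding inner_cube_def by (simp add: mult.commute)

lemma inner_cube_sum_left:
  assumes "\<And>\<phi>. \<phi> \<in> S \<Longrightarrow> continuous_on unit_cube \<phi>" "continuous_on unit_cube g"
  shows "inner_cube (\<lambda>x. \<Sum>\<phi>\<in>S. c \<phi> * \<phi> x) g = (\<Sum>\<phi>\<in>S. c \<phi> * inner_cube \<phi> g)"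
proof -
  have "inner_cube (\<lambda>x. \<Sum>\<phi>\<in>S. c \<phi> * \<phi> x) g = (\<integral>x. (\<Sum>\<phi>\<in>S. c \<phi> * (\<phi> x * g x)) \<partial>leb_cube)"
    unfolding inner_cube_def by (simp add: sum_distrib_right mult.assoc)
  also have "\<dots> = (\<Sum>\<phi>\<in>S. \<integral>x. c \<phi> * (\<phi> x * g x) \<partial>leb_cube)"
    using assms by (intro Bochner_Integration.integral_sum continuous_integrable_leb_cube continuous_intros)
  finally show ?thesis by (simp add: inner_cube_def)
qed

section \<open>Wavelet systems of regularity above one\<close>

locale regular_wavelet_system = wavelet_system r \<Phi> \<Psi>
  for r :: real and \<Phi> :: "(real ^ 'd \<Rightarrow> real) set" and \<Psi> :: "nat \<Rightarrow> (real ^ 'd \<Rightarrow> real) set" +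
  assumes r_gt_1: "1 < r"
begin

abbreviation all_wavelets :: "(real ^ 'd \<Rightarrow> real) set" where
  "all_wavelets \<equiv> \<Phi> \<union> (\<Union>j. \<Psi> j)"

text \<open>Up to constants, the supremum norm of a wavelet of level \<open>j\<close>; its inverse
  is the order of the L_1 norm.\<close>

definition amp :: "nat \<Rightarrow> real" where
  "amp j = 2 powr (real (CARD('d) * j) / 2)"

lemma amp_pos [simp]: "0 < amp j" and amp_nonneg [simp]: "0 \<le> amp j"
  by (auto simp: amp_def)

lemma amp_mult_amp: "amp j * amp j = 2 ^ (CARD('d) * j)"
  by (simp add: amp_def mult.commute flip: powr_add powr_realpow)

lemma basis_C1:
  assumes "\<psi> \<in> all_wavelets" obtains g where "C1_cube \<psi> g"
proof -
  have "\<psi> \<in> Cr_cube r" using regular assms by blast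
  then show ?thesis using C1_cubeI_Cr[OF _ r_gt_1] that by blast
qed

lemma basis_continuous: "\<psi> \<in> all_wavelets \<Longrightarrow> continuous_on unit_cube \<psi>"
  by (metis basis_C1 C1_cube_continuous)

lemma psi_continuous: "\<psi> \<in> \<Psi> j \<Longrightarrow> continuous_on unit_cube \<psi>"
  by (rule basis_continuous) blast

lemma span_C1:
  assumes "u \<in> span_cube F" "F \<subseteq> all_wavelets" obtains g where "C1_cube u g"
proof -
  obtain S c where S: "finite S" "S \<subseteq> F" "\<forall>x\<in>unit_cube. u x = (\<Sum>\<phi>\<in>S. c \<phi> * \<phi> x)"
    using assms(1) by (auto simp: span_cube_def)
  have "\<exists>g. C1_cube \<phi> g" if "\<phi> \<in> S" for \<phi> using basis_C1 that S(2) assms(2) by (meson subsetD)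
  then obtain G where "\<And>\<phi>. \<phi> \<in> S \<Longrightarrow> C1_cube \<phi> (G \<phi>)" by metis
  then have "C1_cube u (\<lambda>i x. \<Sum>\<phi>\<in>S. c \<phi> * G \<phi> i x)" using S(3) by (intro C1_cube_sum) auto
  then show ?thesis by (rule that)
qed

lemma span_continuous:
  "u \<in> span_cube F \<Longrightarrow> F \<subseteq> all_wavelets \<Longrightarrow> continuous_on unit_cube u"
  by (metis span_C1 C1_cube_continuous)

text \<open>Bernstein's inequality at exponent infinity. It is applied to dual test functions, to
  single wavelets and, at level zero, to the span of \<Phi>. The span contains only levels strictly
  below \<open>j\<close>, so functions of level \<open>j\<close> itself are treated with
  \<open>Suc j\<close>, at the price of a factor 2.\<close>

lemma span_lipschitz:
  "\<exists>C>0. \<forall>j. \<forall>u\<in>span_cube (\<Phi> \<union> (\<Union>k<j. \<Psi> k)). \<forall>M\<ge>0. (\<forall>x\<in>unit_cube. \<bar>u x\<bar> \<le> M) \<longrightarrow>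
     (\<forall>x\<in>unit_cube. \<forall>y\<in>unit_cube. \<bar>u x - u y\<bar> \<le> C * 2 ^ j * M * dist x y)"
proof -
  obtain C where C: "\<And>j u. u \<in> span_cube (\<Phi> \<union> (\<Union>k<j. \<Psi> k)) \<Longrightarrow>
      Lnorm_cube \<top> (gradient_cube u) \<le> ennreal (C * 2 powr real j) * Lnorm_cube \<top> u"
    using bernstein[of \<top>] by auto
  define C' where "C' = max C 1"
  have "\<bar>u x - u y\<bar> \<le> C' * 2 ^ j * M * dist x y"
    if u: "u \<in> span_cube (\<Phi> \<union> (\<Union>k<j. \<Psi> k))" and M: "0 \<le> M" "\<forall>x\<in>unit_cube. \<bar>u x\<bar> \<le> M"
      and xy: "x \<in> unit_cube" "y \<in> unit_cube" for j u M x y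
  proof -
    obtain g where g: "C1_cube u g" using span_C1[OF u] by blast
    have "Lnorm_cube \<top> (gradient_cube u) \<le> ennreal (C * 2 powr real j) * Lnorm_cube \<top> u" by (rule C[OF u])
    also have "\<dots> \<le> ennreal (C' * 2 ^ j) * ennreal M"
      using M(2) g by (intro mult_mono ennreal_leI Lnorm_cube_top_le continuous_on_cube_measurable C1_cube_continuous)
        (auto simp: C'_def powr_realpow)
    also have "\<dots> = ennreal (C' * 2 ^ j * M)" using M by (simp add: C'_def flip: ennreal_mult)
    finally show ?thesis using M xy by (intro lipschitz_of_gradient_bound[OF g]) (auto simp: C'_def)
  qed
  then show ?thesis by (intro exI[of _ C']) (auto simp: C'_def)
qed

lemma span_cube_member: "\<phi> \<in> F \<Longrightarrow> \<phi> \<in> span_cube F"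
  unfolding span_cube_def by (intro CollectI exI[of _ "{\<phi>}"] exI[of _ "\<lambda>_. 1"]) auto

lemma psi_bound: "\<exists>C>0. \<forall>j. \<forall>\<psi>\<in>\<Psi> j. \<forall>x\<in>unit_cube. \<bar>\<psi> x\<bar> \<le> C * amp j"
proof -
  obtain C where C: "\<And>j \<psi>. \<psi> \<in> \<Psi> j \<Longrightarrow> Lnorm_cube \<top> \<psi> \<le> ennreal (C * 2 powr (real (CARD('d) * j) / 2))"
    using norms[of \<top>] by auto
  have "\<bar>\<psi> x\<bar> \<le> max C 1 * amp j" if "\<psi> \<in> \<Psi> j" "x \<in> unit_cube" for j \<psi> x
  proof -
    have "C * amp j \<le> max C 1 * amp j" by (intro mult_right_mono) auto
    then have "Lnorm_cube \<top> \<psi> \<le> ennreal (max C 1 * amp j)"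
      using C[OF that(1)] by (metis amp_def ennreal_leI order_trans)
    then have "AE x in leb_cube. norm (\<psi> x) \<le> max C 1 * amp j" by (intro Lnorm_cube_top_AE) auto
    then show ?thesis using psi_continuous[OF that(1)] that(2) by (intro continuous_AE_cube_abs_le) auto
  qed
  then show ?thesis by (intro exI[of _ "max C 1"]) auto
qed

lemma psi_sup_lower:
  "\<exists>c>0. \<forall>j. \<forall>\<psi>\<in>\<Psi> j. \<forall>M. (\<forall>x\<in>unit_cube. \<bar>\<psi> x\<bar> \<le> M) \<longrightarrow> c * amp j \<le> M"
proof -
  obtain c where c: "0 < c" "\<And>j \<psi>. \<psi> \<in> \<Psi> j \<Longrightarrow> ennreal (c * 2 powr (real (CARD('d) * j) / 2)) \<le> Lnorm_cube \<top> \<psi>"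
    using norms[of \<top>] by auto
  have "c * amp j \<le> M" if "\<psi> \<in> \<Psi> j" "\<forall>x\<in>unit_cube. \<bar>\<psi> x\<bar> \<le> M" for j \<psi> M
  proof -
    have "ennreal (c * amp j) \<le> Lnorm_cube \<top> \<psi>" using c(2)[OF that(1)] by (simp add: amp_def)
    also have "\<dots> \<le> ennreal M"
      using that psi_continuous by (intro Lnorm_cube_top_le continuous_on_cube_measurable) auto
    finally show ?thesis using c(1) by (metis amp_pos ennreal_le_iff2 mult_pos_pos not_le)
  qed
  then show ?thesis using c(1) by blast
qed

lemma psi_L1_bound: "\<exists>C>0. \<forall>j. \<forall>\<psi>\<in>\<Psi> j. (\<integral>x. \<bar>\<psi> x\<bar> \<partial>leb_cube) \<le> C / amp j"
proof -
  have [simp]: "inv_exponent 1 = 1" by (simp add: inv_exponent_def)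
  have e: "2 powr (real (CARD('d) * j) * (1 / 2 - 1)) = 1 / amp j" for j
    by (simp add: amp_def powr_minus_divide)
  obtain C where C: "\<And>j \<psi>. \<psi> \<in> \<Psi> j \<Longrightarrow> Lnorm_cube 1 \<psi> \<le> ennreal (C * (1 / amp j))"
    using norms[of 1] unfolding \<open>inv_exponent 1 = 1\<close> e by auto
  have "(\<integral>x. \<bar>\<psi> x\<bar> \<partial>leb_cube) \<le> max C 1 / amp j" if p: "\<psi> \<in> \<Psi> j" for j \<psi>
  proof -
    have "integrable leb_cube \<psi>" using psi_continuous[OF p] by (rule continuous_integrable_leb_cube)
    then have "Lnorm_cube 1 \<psi> = ennreal (\<integral>x. \<bar>\<psi> x\<bar> \<partial>leb_cube)"
      by (simp add: Lnorm_cube_def Lnorm_one nn_integral_eq_integral)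
    moreover have "C * (1 / amp j) \<le> max C 1 / amp j"
      by (simp add: divide_right_mono less_imp_le)
    ultimately have "ennreal (\<integral>x. \<bar>\<psi> x\<bar> \<partial>leb_cube) \<le> ennreal (max C 1 / amp j)"
      using C[OF p] by (metis ennreal_leI order_trans)
    then show ?thesis by (subst (asm) ennreal_le_iff) (auto simp: less_imp_le)
  qed
  then show ?thesis by (intro exI[of _ "max C 1"]) auto
qed

text \<open>Almost every point lies in boundedly many boxes of one level, each wavelet there is of
  size at most of order \<open>amp j\<close>, and continuity removes the exceptional null set.
  Finite subsets are used because the finiteness of a level is itself derived from this
  bound.\<close>

lemma level_sum_abs_bound:
  "\<exists>C>0. \<forall>j F. finite F \<longrightarrow> F \<subseteq> \<Psi> j \<longrightarrow> (\<forall>x\<in>unit_cube. (\<Sum>\<psi>\<in>F. \<bar>\<psi> x\<bar>) \<le> C * amp j)"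
proof -
  obtain I C0 where
    supp: "\<And>j \<psi>. \<psi> \<in> \<Psi> j \<Longrightarrow> closure {x\<in>unit_cube. \<psi> x \<noteq> 0} \<subseteq> I j \<psi>" and
    ov: "\<And>j. AE x in leb_cube. finite {\<psi>\<in>\<Psi> j. x \<in> I j \<psi>} \<and> real (card {\<psi>\<in>\<Psi> j. x \<in> I j \<psi>}) \<le> C0"
    using localized by (elim exE) meson
  obtain C where C: "0 < C" "\<And>j \<psi> x. \<psi> \<in> \<Psi> j \<Longrightarrow> x \<in> unit_cube \<Longrightarrow> \<bar>\<psi> x\<bar> \<le> C * amp j"
    using psi_bound by blast
  have "(\<Sum>\<psi>\<in>F. \<bar>\<psi> x\<bar>) \<le> (max C0 1 * C) * amp j" if F: "finite F" "F \<subseteq> \<Psi> j" and x: "x \<in> unit_cube" for j F x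
  proof (rule continuous_AE_cube_le[OF _ _ x])
    show "continuous_on unit_cube (\<lambda>x. \<Sum>\<psi>\<in>F. \<bar>\<psi> x\<bar>)"
      using F psi_continuous by (intro continuous_intros) auto
    show "AE x in leb_cube. (\<Sum>\<psi>\<in>F. \<bar>\<psi> x\<bar>) \<le> (max C0 1 * C) * amp j"
      using ov[of j] AE_space
    proof eventually_elim
      case (elim x)
      let ?G = "{\<psi>\<in>\<Psi> j. x \<in> I j \<psi>}"
      have "(\<Sum>\<psi>\<in>F. \<bar>\<psi> x\<bar>) = (\<Sum>\<psi>\<in>F \<inter> ?G. \<bar>\<psi> x\<bar>)"
      proof (rule sum.mono_neutral_right)
        show "\<forall>\<psi>\<in>F - F \<inter> ?G. \<bar>\<psi> x\<bar> = 0"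
        proof
          fix \<psi> assume a: "\<psi> \<in> F - F \<inter> ?G"
          then have p: "\<psi> \<in> \<Psi> j" and "x \<notin> I j \<psi>" using F(2) by auto
          then have "x \<notin> {x\<in>unit_cube. \<psi> x \<noteq> 0}" using subsetD[OF supp[OF p] subsetD[OF closure_subset]] by metis
          then show "\<bar>\<psi> x\<bar> = 0" using elim by auto
        qed
      qed (use F in auto)
      also have "\<dots> \<le> (\<Sum>\<psi>\<in>F \<inter> ?G. C * amp j)"
        using C(2) elim F by (intro sum_mono) auto
      also have "\<dots> = real (card (F \<inter> ?G)) * (C * amp j)" by simp
      also have "\<dots> \<le> max C0 1 * (C * amp j)"
      proof (rule mult_right_mono)
        have "card (F \<inter> ?G) \<le> card ?G" using elim by (intro card_mono) auto
        then show "real (card (F \<inter> ?G)) \<le> max C0 1" using elim by linarith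
      qed (use C in auto)
      finally show ?case by (simp add: mult.assoc)
    qed
  qed
  then show ?thesis using C(1) by (intro exI[of _ "max C0 1 * C"]) auto
qed

lemma basis_inner:
  "f \<in> all_wavelets \<Longrightarrow> g \<in> all_wavelets \<Longrightarrow> inner_cube f g = (if f = g then 1 else 0)"
  using basis unfolding orthonormal_basis_cube_def by blast

text \<open>Each wavelet has unit energy, so \<open>card F\<close> is the integral of the sum of
  squares. Pointwise that sum is at most the largest supremum norm times the sum of absolute values,
  hence of order \<open>amp j * amp j\<close>.\<close>

lemma card_level: "\<exists>C>0. \<forall>j. finite (\<Psi> j) \<and> real (card (\<Psi> j)) \<le> C * 2 ^ (CARD('d) * j)"
proof -
  obtain C where C: "0 < C" "\<And>j \<psi> x. \<psi> \<in> \<Psi> j \<Longrightarrow> x \<in> unit_cube \<Longrightarrow> \<bar>\<psi> x\<bar> \<le> C * amp j"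
    using psi_bound by blast
  obtain D where D: "0 < D"
    "\<forall>j F. finite F \<longrightarrow> F \<subseteq> \<Psi> j \<longrightarrow> (\<forall>x\<in>unit_cube. (\<Sum>\<psi>\<in>F. \<bar>\<psi> x\<bar>) \<le> D * amp j)"
    using level_sum_abs_bound by (elim exE conjE) (rule that)
  interpret prob_space "leb_cube :: (real ^ 'd) measure" by (rule prob_space_leb_cube)
  have main: "real (card F) \<le> (C * D) * 2 ^ (CARD('d) * j)" if F: "finite F" "F \<subseteq> \<Psi> j" for F j
  proof -
    have cont: "continuous_on unit_cube \<psi>" if "\<psi> \<in> F" for \<psi> using psi_continuous that F by blast
    have "real (card F) = (\<Sum>\<psi>\<in>F. inner_cube \<psi> \<psi>)"
    proof -
      have "inner_cube \<psi> \<psi> = 1" if "\<psi> \<in> F" for \<psi>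
        using basis_inner[of \<psi> \<psi>] that F(2) by auto
      then show ?thesis by simp
    qed
    also have "\<dots> = (\<integral>x. (\<Sum>\<psi>\<in>F. \<psi> x * \<psi> x) \<partial>leb_cube)"
      unfolding inner_cube_def using cont
      by (intro Bochner_Integration.integral_sum[symmetric] continuous_integrable_leb_cube continuous_intros) auto
    also have "\<dots> \<le> (\<integral>x. (C * D) * 2 ^ (CARD('d) * j) \<partial>(leb_cube :: (real ^ 'd) measure))"
    proof (rule integral_mono_AE)
      show "integrable leb_cube (\<lambda>x. \<Sum>\<psi>\<in>F. \<psi> x * \<psi> x)"
        using cont by (intro continuous_integrable_leb_cube continuous_intros) auto
      show "AE x in leb_cube. (\<Sum>\<psi>\<in>F. \<psi> x * \<psi> x) \<le> (C * D) * 2 ^ (CARD('d) * j)"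
      proof (rule AE_leb_cubeI)
        fix x :: "real ^ 'd" assume x: "x \<in> unit_cube"
        have "(\<Sum>\<psi>\<in>F. \<psi> x * \<psi> x) \<le> (\<Sum>\<psi>\<in>F. (C * amp j) * \<bar>\<psi> x\<bar>)"
        proof (rule sum_mono)
          fix \<psi> assume "\<psi> \<in> F"
          then have "\<bar>\<psi> x\<bar> * \<bar>\<psi> x\<bar> \<le> (C * amp j) * \<bar>\<psi> x\<bar>" using C(2) F(2) x by (intro mult_right_mono) auto
          then show "\<psi> x * \<psi> x \<le> (C * amp j) * \<bar>\<psi> x\<bar>" by simp
        qed
        also have "\<dots> = (C * amp j) * (\<Sum>\<psi>\<in>F. \<bar>\<psi> x\<bar>)" by (simp add: sum_distrib_left)
        also have "\<dots> \<le> (C * amp j) * (D * amp j)" using D(2)[rule_format, OF F x] C(1) by (intro mult_left_mono) auto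
        also have "\<dots> = (C * D) * (amp j * amp j)" by simp
        finally show "(\<Sum>\<psi>\<in>F. \<psi> x * \<psi> x) \<le> (C * D) * 2 ^ (CARD('d) * j)" by (simp only: amp_mult_amp)
      qed
    qed simp
    also have "\<dots> = (C * D) * 2 ^ (CARD('d) * j)" using prob_space by simp
    finally show ?thesis .
  qed
  have "finite (\<Psi> j)" for j
  proof (rule ccontr)
    assume inf: "infinite (\<Psi> j)"
    define N where "N = Suc (nat \<lceil>(C * D) * 2 ^ (CARD('d) * j)\<rceil>)"
    obtain F where F: "F \<subseteq> \<Psi> j" "finite F" "card F = N"
      using infinite_arbitrarily_large[OF inf] by blast
    have "real N \<le> (C * D) * 2 ^ (CARD('d) * j)" using main[OF F(2,1)] F(3) by simp
    then show False unfolding N_def by linarith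
  qed
  then show ?thesis using main C(1) D(1) by (intro exI[of _ "C * D"]) auto
qed

lemma finite_level: "finite (\<Psi> j)"
  using card_level by blast

text \<open>A function in two levels has supremum norm of order \<open>amp\<close> of both indices,
  which forces the indices to be close. This limits on how many levels the same wavelet is counted
  in the Besov norm.\<close>

lemma level_overlap: "\<exists>K. \<forall>j k. \<Psi> j \<inter> \<Psi> k \<noteq> {} \<longrightarrow> k \<le> j + K"
proof -
  obtain C where C: "0 < C" "\<And>j \<psi> x. \<psi> \<in> \<Psi> j \<Longrightarrow> x \<in> unit_cube \<Longrightarrow> \<bar>\<psi> x\<bar> \<le> C * amp j"
    using psi_bound by blast
  obtain c where c: "0 < c" "\<And>j \<psi> M. \<psi> \<in> \<Psi> j \<Longrightarrow> (\<forall>x\<in>unit_cube. \<bar>\<psi> x\<bar> \<le> M) \<Longrightarrow> c * amp j \<le> M"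
    using psi_sup_lower by blast
  obtain K :: nat where K: "(C / c)\<^sup>2 < 2 ^ K" using real_arch_pow[of 2 "(C / c)\<^sup>2"] by auto
  have "k \<le> j + K" if p: "\<psi> \<in> \<Psi> j" "\<psi> \<in> \<Psi> k" for \<psi> j k
  proof (rule ccontr)
    assume "\<not> k \<le> j + K"
    then have le: "CARD('d) * j + K \<le> CARD('d) * k"
    proof -
      have "CARD('d) * (j + K) \<le> CARD('d) * k" using \<open>\<not> k \<le> j + K\<close> by (intro mult_le_mono2) simp
      moreover have "1 * K \<le> CARD('d) * K" by (intro mult_le_mono1) (simp add: Suc_leI)
      ultimately show ?thesis unfolding distrib_left by linarith
    qed
    have "c * amp k \<le> C * amp j" using c(2)[OF p(2)] C(2)[OF p(1)] by blast
    then have "(c * amp k) * (c * amp k) \<le> (C * amp j) * (C * amp j)"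
      using c(1) C(1) by (intro mult_mono[of "c * amp k" "C * amp j"]) auto
    then have "c\<^sup>2 * (amp k * amp k) \<le> C\<^sup>2 * (amp j * amp j)" by (simp add: power2_eq_square algebra_simps)
    then have "2 ^ (CARD('d) * k) \<le> (C / c)\<^sup>2 * 2 ^ (CARD('d) * j)"
      unfolding amp_mult_amp using c(1) by (simp add: power_divide field_simps)
    also have "\<dots> < 2 ^ K * 2 ^ (CARD('d) * j)" using K by simp
    also have "\<dots> = 2 ^ (CARD('d) * j + K)" by (simp add: power_add)
    also have "\<dots> \<le> 2 ^ (CARD('d) * k)" using le by (intro power_increasing) auto
    finally show False by simp
  qed
  then show ?thesis by (intro exI[of _ K]) blast
qed

lemma one_in_span: "(\<lambda>x. 1) \<in> span_cube \<Phi>"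
  using polynomials[of "\<lambda>_. 0"] r_gt_1 by simp

text \<open>The constants lie in the span of \<Phi>, to which a wavelet outside \<Phi> is
  orthogonal. Mean zero preserves the mass of a perturbed density and makes the fine-scale
  coefficients of smooth functions small.\<close>

lemma integral_psi_zero:
  assumes "\<psi> \<in> \<Psi> j" "\<psi> \<notin> \<Phi>"
  shows "(\<integral>x. \<psi> x \<partial>leb_cube) = 0"
proof -
  obtain S c where S: "finite S" "S \<subseteq> \<Phi>" "\<And>x. x \<in> unit_cube \<Longrightarrow> 1 = (\<Sum>\<phi>\<in>S. c \<phi> * \<phi> x)"
    using one_in_span unfolding span_cube_def by blast
  have "(\<integral>x. \<psi> x \<partial>leb_cube) = inner_cube (\<lambda>x. 1) \<psi>" by (simp add: inner_cube_def)
  also have "\<dots> = inner_cube (\<lambda>x. \<Sum>\<phi>\<in>S. c \<phi> * \<phi> x) \<psi>" using S(3) by (rule inner_cube_cong_left)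
  also have "\<dots> = (\<Sum>\<phi>\<in>S. c \<phi> * inner_cube \<phi> \<psi>)"
    using S assms by (intro inner_cube_sum_left basis_continuous) auto
  also have "\<dots> = 0"
    using S assms by (intro sum.neutral ballI) (subst basis_inner; auto)
  finally show ?thesis .
qed

end

section \<open>Lower bounds for the Wasserstein distance\<close>

lemma powr_above_tangent:
  fixes w D p :: real
  assumes "1 \<le> p" "0 < D" "0 \<le> w"
  shows "D powr p + p * D powr (p - 1) * (w - D) \<le> w powr p"
proof (cases "w = 0")
  case True
  have "D powr p = D powr (p - 1) * D" using assms(2) powr_add[of D "p - 1" 1] by simp
  then have "D powr p + p * D powr (p - 1) * (w - D) = (1 - p) * D powr p" using True by (simp add: algebra_simps)
  then show ?thesis using True assms by (simp add: mult_nonpos_nonneg)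
next
  case False
  have "w powr p - D powr p \<ge> (p * D powr (p - 1)) * (w - D)"
  proof (rule convex_on_imp_above_tangent[where A = "{0<..}"])
    show "convex_on {0<..} (\<lambda>x. x powr p)" using assms(1) by (rule powr_convex)
    show "connected {0::real<..}" by simp
    show "D \<in> interior {0<..}" using assms by (simp add: interior_open)
    show "w \<in> {0<..}" using False assms by simp
    show "((\<lambda>x. x powr p) has_real_derivative p * D powr (p - 1)) (at D within {0<..})"
      using has_real_derivative_powr[OF assms(2)] by (rule has_field_derivative_at_within)
  qed
  then show ?thesis by simp
qed

text \<open>The tangent to \<open>t powr p\<close> at the dual value \<open>D\<close> gives \<open>W\<^sub>p \<ge> D\<close> without passing through
  \<open>W\<^sub>1\<close>, whose cost need not be integrable.\<close>

lemma wasserstein_ge_lipschitz: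
  fixes h :: "'a::metric_space \<Rightarrow> real"
  assumes \<mu>: "prob_space \<mu>" "sets \<mu> = sets borel" and \<nu>: "prob_space \<nu>" "sets \<nu> = sets borel"
    and p: "1 \<le> p" and lip: "\<And>x y. h x - h y \<le> dist x y" and bd: "\<And>x. \<bar>h x\<bar> \<le> B"
    and h: "h \<in> borel_measurable borel"
  shows "ennreal ((\<integral>x. h x \<partial>\<mu>) - (\<integral>x. h x \<partial>\<nu>)) \<le> wasserstein p \<mu> \<nu>"
proof (cases "(\<integral>x. h x \<partial>\<mu>) - (\<integral>x. h x \<partial>\<nu>) \<le> 0")
  case True
  then show ?thesis by (simp add: ennreal_neg)
next
  case False
  define D where "D = (\<integral>x. h x \<partial>\<mu>) - (\<integral>x. h x \<partial>\<nu>)"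
  have D: "0 < D" using False by (simp add: D_def)
  have "ennreal (D powr p) \<le> (\<integral>\<^sup>+z. ennreal (dist (fst z) (snd z) powr p) \<partial>\<pi>)" if "\<pi> \<in> couplings \<mu> \<nu>" for \<pi>
  proof -
    have \<pi>: "sets \<pi> = sets (\<mu> \<Otimes>\<^sub>M \<nu>)" "distr \<pi> \<mu> fst = \<mu>" "distr \<pi> \<nu> snd = \<nu>"
      using that by (auto simp: couplings_def)
    have m1[measurable]: "fst \<in> \<pi> \<rightarrow>\<^sub>M \<mu>" and m2[measurable]: "snd \<in> \<pi> \<rightarrow>\<^sub>M \<nu>"
      using measurable_cong_sets[OF \<pi>(1) refl] by auto
    have h\<mu>[measurable]: "h \<in> borel_measurable \<mu>" and h\<nu>[measurable]: "h \<in> borel_measurable \<nu>"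
      using h measurable_cong_sets[OF \<mu>(2) refl] measurable_cong_sets[OF \<nu>(2) refl] by auto
    have "prob_space (distr \<pi> \<mu> fst)" using \<mu>(1) \<pi>(2) by simp
    then interpret \<pi>: prob_space \<pi> by (rule prob_space_distrD[OF m1])
    define u where "u z = h (fst z) - h (snd z)" for z
    have i1: "integrable \<pi> (\<lambda>z. h (fst z))" and i2: "integrable \<pi> (\<lambda>z. h (snd z))"
      by (rule \<pi>.integrable_const_bound[of _ B]; use bd in auto)+
    then have iu: "integrable \<pi> u" unfolding u_def by simp
    have "(\<integral>z. h (fst z) \<partial>\<pi>) = (\<integral>x. h x \<partial>\<mu>)" "(\<integral>z. h (snd z) \<partial>\<pi>) = (\<integral>x. h x \<partial>\<nu>)"
      using integral_distr[OF m1 h\<mu>] integral_distr[OF m2 h\<nu>] \<pi>(2,3) by auto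
    then have "(\<integral>z. u z \<partial>\<pi>) = D" unfolding u_def D_def using i1 i2 by simp
    then have "D powr p = (\<integral>z. D powr p + p * D powr (p - 1) * (u z - D) \<partial>\<pi>)"
      using iu by (simp add: \<pi>.prob_space)
    \<comment> \<open>The tangent can be negative, while the transport cost is an extended
      nonnegative integral. Its positive part is still below the cost, which is nonnegative.\<close>
    also have "\<dots> \<le> (\<integral>z. max 0 (D powr p + p * D powr (p - 1) * (u z - D)) \<partial>\<pi>)"
      using iu by (intro integral_mono) auto
    finally have "ennreal (D powr p) \<le> ennreal \<dots>" by (rule ennreal_leI)
    also have "\<dots> = (\<integral>\<^sup>+z. ennreal (max 0 (D powr p + p * D powr (p - 1) * (u z - D))) \<partial>\<pi>)"
      using iu by (intro nn_integral_eq_integral[symmetric]) auto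
    also have "\<dots> \<le> (\<integral>\<^sup>+z. ennreal (dist (fst z) (snd z) powr p) \<partial>\<pi>)"
    proof (intro nn_integral_mono ennreal_leI max.boundedI)
      fix z
      have "D powr p + p * D powr (p - 1) * (u z - D) \<le> D powr p + p * D powr (p - 1) * (dist (fst z) (snd z) - D)"
        using p lip by (intro add_left_mono mult_left_mono) (auto simp: u_def)
      also have "\<dots> \<le> dist (fst z) (snd z) powr p" using p D by (intro powr_above_tangent) auto
      finally show "D powr p + p * D powr (p - 1) * (u z - D) \<le> dist (fst z) (snd z) powr p" .
    qed simp
    finally show ?thesis .
  qed
  then have "ennreal (D powr p) \<le> (INF \<pi>\<in>couplings \<mu> \<nu>. \<integral>\<^sup>+z. ennreal (dist (fst z) (snd z) powr p) \<partial>\<pi>)"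
    by (rule INF_greatest)
  then have "ennreal_powr (ennreal (D powr p)) (1 / p) \<le> wasserstein p \<mu> \<nu>"
    unfolding wasserstein_def using p by (intro ennreal_powr_mono) auto
  moreover have "ennreal_powr (ennreal (D powr p)) (1 / p) = ennreal D"
    using D p by (simp add: powr_powr)
  ultimately show ?thesis by (simp add: D_def)
qed

section \<open>Two-point testing and Assouad's lemma\<close>

text \<open>By the triangle inequality the two losses at a point sum to at least \<open>e\<close>,
  and both laws dominate the weight \<open>min 1 (G x)\<close> with respect to \<open>P\<close>.
  This weight has mass at least 1/4: integrating \<open>G x \<le> min 1 (G x) + (G x)^2 / 4\<close>
  with second moment at most 3 gives 1 \<le> mass + 3/4.\<close>

lemma two_point_lower:
  fixes G b :: "'a \<Rightarrow> real"
  assumes [measurable]: "G \<in> borel_measurable P" "b \<in> borel_measurable P"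
    and G: "\<And>x. 0 \<le> G x" "(\<integral>\<^sup>+x. ennreal (G x) \<partial>P) = 1" "(\<integral>\<^sup>+x. ennreal ((G x)\<^sup>2) \<partial>P) \<le> 3"
    and e: "0 \<le> e"
  shows "ennreal (e / 4) \<le> (\<integral>\<^sup>+x. ennreal \<bar>a - b x\<bar> \<partial>P)
      + (\<integral>\<^sup>+x. ennreal \<bar>a + e - b x\<bar> \<partial>(density P (\<lambda>x. ennreal (G x))))"
proof -
  define I where "I = (\<integral>\<^sup>+x. ennreal (min 1 (G x)) \<partial>P)"
  have "1 \<le> (\<integral>\<^sup>+x. ennreal (min 1 (G x)) + ennreal (1 / 4) * ennreal ((G x)\<^sup>2) \<partial>P)"
    unfolding G(2)[symmetric]
  proof (rule nn_integral_mono)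
    fix x
    have "0 \<le> (G x / 2 - 1)\<^sup>2" by simp
    then have "G x \<le> 1 + (1 / 4) * (G x)\<^sup>2" by (simp add: power2_eq_square algebra_simps)
    then have "G x \<le> min 1 (G x) + (1 / 4) * (G x)\<^sup>2" by (simp add: min_def)
    then show "ennreal (G x) \<le> ennreal (min 1 (G x)) + ennreal (1 / 4) * ennreal ((G x)\<^sup>2)"
      using G(1) by (simp add: ennreal_leI flip: ennreal_mult ennreal_plus)
  qed
  also have "\<dots> = I + ennreal (1 / 4) * (\<integral>\<^sup>+x. ennreal ((G x)\<^sup>2) \<partial>P)"
    unfolding I_def by (simp add: nn_integral_add nn_integral_cmult)
  also have "\<dots> \<le> I + ennreal (1 / 4) * 3" using G(3) by (intro add_left_mono mult_left_mono) auto
  also have "ennreal (1 / 4) * 3 = ennreal (3 / 4)" by (simp flip: ennreal_mult ennreal_numeral)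
  finally have le: "1 \<le> I + ennreal (3 / 4)" .
  have I: "ennreal (1 / 4) \<le> I"
  proof (cases I)
    case (real i)
    then have "ennreal 1 \<le> ennreal (i + 3 / 4)" using le by (subst ennreal_plus) auto
    then have "1 \<le> i + 3 / 4" using real by (subst (asm) ennreal_le_iff) auto
    then show ?thesis using real by (auto intro!: ennreal_leI)
  qed simp
  have "ennreal (e / 4) = ennreal e * ennreal (1 / 4)" using e by (simp flip: ennreal_mult)
  also have "\<dots> \<le> ennreal e * I" using I by (rule mult_left_mono) simp
  also have "\<dots> = (\<integral>\<^sup>+x. ennreal e * ennreal (min 1 (G x)) \<partial>P)" unfolding I_def by (simp add: nn_integral_cmult)
  also have "\<dots> \<le> (\<integral>\<^sup>+x. ennreal \<bar>a - b x\<bar> + ennreal (G x) * ennreal \<bar>a + e - b x\<bar> \<partial>P)"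
  proof (rule nn_integral_mono)
    fix x
    define c where "c = min 1 (G x)"
    have c: "0 \<le> c" "c \<le> 1" "c \<le> G x" using G(1)[of x] by (auto simp: c_def)
    have "e * c \<le> c * \<bar>a - b x\<bar> + c * \<bar>a + e - b x\<bar>"
    proof -
      have "e \<le> \<bar>a - b x\<bar> + \<bar>a + e - b x\<bar>" by linarith
      then have "c * e \<le> c * (\<bar>a - b x\<bar> + \<bar>a + e - b x\<bar>)" using c by (intro mult_left_mono) auto
      then show ?thesis by (simp add: algebra_simps)
    qed
    also have "\<dots> \<le> 1 * \<bar>a - b x\<bar> + G x * \<bar>a + e - b x\<bar>" using c by (intro add_mono mult_right_mono) auto
    finally show "ennreal e * ennreal (min 1 (G x)) \<le> ennreal \<bar>a - b x\<bar> + ennreal (G x) * ennreal \<bar>a + e - b x\<bar>"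
      using c e G(1)[of x] unfolding c_def by (simp add: ennreal_leI flip: ennreal_mult ennreal_plus)
  qed
  also have "\<dots> = (\<integral>\<^sup>+x. ennreal \<bar>a - b x\<bar> \<partial>P)
      + (\<integral>\<^sup>+x. ennreal \<bar>a + e - b x\<bar> \<partial>(density P (\<lambda>x. ennreal (G x))))"
    by (subst nn_integral_density) (auto intro!: nn_integral_add)
  finally show ?thesis .
qed

text \<open>A product measure is determined by its values on rectangles, and there the integral of a
  product of densities factors.\<close>

lemma PiM_density:
  fixes g :: "'a \<Rightarrow> ennreal"
  assumes M: "prob_space M" and [measurable]: "g \<in> borel_measurable M" and D: "prob_space (density M g)" and I: "finite I"
  shows "(\<Pi>\<^sub>M i\<in>I. density M g) = density (\<Pi>\<^sub>M i\<in>I. M) (\<lambda>X. \<Prod>i\<in>I. g (X i))"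
proof -
  interpret M: product_sigma_finite "\<lambda>_. M"
    using M by (simp add: product_sigma_finite_def prob_space_imp_sigma_finite)
  interpret D: product_sigma_finite "\<lambda>_. density M g"
    using D by (simp add: product_sigma_finite_def prob_space_imp_sigma_finite)
  show ?thesis
  proof (rule D.PiM_eqI[OF I, symmetric])
    show "sets (density (\<Pi>\<^sub>M i\<in>I. M) (\<lambda>X. \<Prod>i\<in>I. g (X i))) = sets (\<Pi>\<^sub>M i\<in>I. density M g)"
      unfolding sets_density by (intro sets_PiM_cong) auto
    fix A assume A: "\<And>i. i \<in> I \<Longrightarrow> A i \<in> sets (density M g)"
    then have A'[measurable]: "\<And>i. i \<in> I \<Longrightarrow> A i \<in> sets M" by simp
    have "emeasure (density (\<Pi>\<^sub>M i\<in>I. M) (\<lambda>X. \<Prod>i\<in>I. g (X i))) (Pi\<^sub>E I A)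
        = (\<integral>\<^sup>+X. (\<Prod>i\<in>I. g (X i)) * indicator (Pi\<^sub>E I A) X \<partial>(\<Pi>\<^sub>M i\<in>I. M))"
      using I A' by (intro emeasure_density) (auto intro!: sets_PiM_I_finite)
    also have "\<dots> = (\<integral>\<^sup>+X. (\<Prod>i\<in>I. g (X i) * indicator (A i) (X i)) \<partial>(\<Pi>\<^sub>M i\<in>I. M))"
    proof (rule nn_integral_cong)
      fix X assume X: "X \<in> space (\<Pi>\<^sub>M i\<in>I. M)"
      have "indicator (Pi\<^sub>E I A) X = (\<Prod>i\<in>I. indicator (A i) (X i) :: ennreal)"
      proof (cases "X \<in> Pi\<^sub>E I A")
        case False
        then obtain i where "i \<in> I" "X i \<notin> A i" using X by (auto simp: space_PiM PiE_iff)
        then have "(\<Prod>i\<in>I. indicator (A i) (X i) :: ennreal) = 0"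
          using I by (intro prod_zero bexI[of _ i]) auto
        then show ?thesis using False by simp
      qed (auto simp: PiE_iff)
      then show "(\<Prod>i\<in>I. g (X i)) * indicator (Pi\<^sub>E I A) X = (\<Prod>i\<in>I. g (X i) * indicator (A i) (X i))"
        by (simp add: prod.distrib)
    qed
    also have "\<dots> = (\<Prod>i\<in>I. \<integral>\<^sup>+x. g x * indicator (A i) x \<partial>M)"
      using I A' by (intro M.product_nn_integral_prod) auto
    also have "\<dots> = (\<Prod>i\<in>I. emeasure (density M g) (A i))"
      using A' by (intro prod.cong) (auto simp: emeasure_density)
    finally show "emeasure (density (\<Pi>\<^sub>M i\<in>I. M) (\<lambda>X. \<Prod>i\<in>I. g (X i))) (Pi\<^sub>E I A) = (\<Prod>i\<in>I. emeasure (density M g) (A i))" .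
  qed
qed

text \<open>The second moment of a likelihood ratio is multiplicative over independent observations,
  and \<open>(1 + 1 / real n) ^ n\<close> is at most \<open>exp 1\<close>, hence at most 3.\<close>

lemma product_two_point_lower:
  fixes g :: "'a \<Rightarrow> real" and b :: "(nat \<Rightarrow> 'a) \<Rightarrow> real"
  assumes M: "prob_space M" and g[measurable]: "g \<in> borel_measurable M" and g0: "\<And>x. 0 \<le> g x"
    and D: "prob_space (density M (\<lambda>x. ennreal (g x)))"
    and chi: "(\<integral>\<^sup>+x. ennreal ((g x)\<^sup>2) \<partial>M) \<le> ennreal (1 + 1 / real n)" and n: "1 \<le> n"
    and b: "b \<in> borel_measurable (\<Pi>\<^sub>M i\<in>{..<n}. M)" and e: "0 \<le> e"
  shows "ennreal (e / 4) \<le> (\<integral>\<^sup>+X. ennreal \<bar>a - b X\<bar> \<partial>(\<Pi>\<^sub>M i\<in>{..<n}. M))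
      + (\<integral>\<^sup>+X. ennreal \<bar>a + e - b X\<bar> \<partial>(\<Pi>\<^sub>M i\<in>{..<n}. density M (\<lambda>x. ennreal (g x))))"
proof -
  let ?P = "\<Pi>\<^sub>M i\<in>{..<n}. M"
  interpret M: product_sigma_finite "\<lambda>_. M"
    using M by (simp add: product_sigma_finite_def prob_space_imp_sigma_finite)
  define G where "G X = (\<Prod>i<n. g (X i))" for X :: "nat \<Rightarrow> 'a"
  have eqG: "(\<Prod>i<n. ennreal (f (X i))) = ennreal (\<Prod>i<n. f (X i))" if "\<And>x. 0 \<le> f x" for f X
    using that by (intro prod_ennreal) auto
  have mG[measurable]: "G \<in> borel_measurable ?P" unfolding G_def by measurable
  have "(\<integral>\<^sup>+x. ennreal (g x) \<partial>M) = emeasure (density M (\<lambda>x. ennreal (g x))) (space M)"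
    by (subst emeasure_density) (auto intro!: nn_integral_cong)
  also have "\<dots> = 1" using prob_space.emeasure_space_1[OF D] by simp
  finally have g1: "(\<integral>\<^sup>+x. ennreal (g x) \<partial>M) = 1" .
  have "(\<integral>\<^sup>+X. ennreal (G X) \<partial>?P) = (\<Prod>i<n. \<integral>\<^sup>+x. ennreal (g x) \<partial>M)"
    unfolding G_def using M.product_nn_integral_prod[of "{..<n}" "\<lambda>_ x. ennreal (g x)"] by (simp add: eqG[of g] g0)
  then have G1: "(\<integral>\<^sup>+X. ennreal (G X) \<partial>?P) = 1" by (simp add: g1)
  have "(\<integral>\<^sup>+X. ennreal ((G X)\<^sup>2) \<partial>?P) = (\<Prod>i<n. \<integral>\<^sup>+x. ennreal ((g x)\<^sup>2) \<partial>M)"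
    unfolding G_def prod_power_distrib
    using M.product_nn_integral_prod[of "{..<n}" "\<lambda>_ x. ennreal ((g x)\<^sup>2)"] by (simp add: eqG[of "\<lambda>x. (g x)\<^sup>2"])
  also have "\<dots> \<le> ennreal (1 + 1 / real n) ^ n" using chi by (simp add: power_mono)
  also have "\<dots> = ennreal ((1 + 1 / real n) ^ n)" by (rule ennreal_power) simp
  also have "\<dots> \<le> ennreal 3"
    using exp_ge_one_plus_x_over_n_power_n[of n 1] exp_le n by (intro ennreal_leI) auto
  finally have G2: "(\<integral>\<^sup>+X. ennreal ((G X)\<^sup>2) \<partial>?P) \<le> 3" by simp
  have "(\<Pi>\<^sub>M i\<in>{..<n}. density M (\<lambda>x. ennreal (g x))) = density ?P (\<lambda>X. ennreal (G X))"
    unfolding G_def using PiM_density[OF M _ D, of "{..<n}"] by (simp add: eqG[of g] g0)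
  then show ?thesis
    using two_point_lower[OF mG b _ G1 G2 e, of a] g0 by (simp add: G_def prod_nonneg)
qed

text \<open>Toggling the membership of \<psi> is an involution of \<open>Pow S\<close> that matches
  each set with a neighbour, so the average of \<open>r \<psi>\<close> over all subsets is at least
  \<open>e / 2\<close>. The bound \<open>V\<close> dominates every subset, hence also the
  average.\<close>

lemma assouad:
  fixes r :: "'a \<Rightarrow> 'a set \<Rightarrow> ennreal"
  assumes S: "finite S" and e: "0 \<le> e" and \<kappa>: "0 \<le> \<kappa>"
    and pair: "\<And>\<psi> T. \<psi> \<in> S \<Longrightarrow> T \<subseteq> S - {\<psi>} \<Longrightarrow> ennreal e \<le> r \<psi> T + r \<psi> (insert \<psi> T)"
    and V: "\<And>T. T \<subseteq> S \<Longrightarrow> ennreal \<kappa> * (\<Sum>\<psi>\<in>S. r \<psi> T) \<le> V"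
  shows "ennreal (\<kappa> * real (card S) * e / 2) \<le> V"
proof (cases V)
  case (real v)
  define flip where "flip \<psi> T = (if \<psi> \<in> T then T - {\<psi>} else insert \<psi> T)" for \<psi> and T :: "'a set"
  define N where "N = card (Pow S)"
  have N: "0 < N" using S by (simp add: N_def card_Pow)
  have half: "of_nat N * ennreal e \<le> 2 * (\<Sum>T\<in>Pow S. r \<psi> T)" if \<psi>: "\<psi> \<in> S" for \<psi>
  proof -
    have "(\<Sum>T\<in>Pow S. r \<psi> (flip \<psi> T)) = (\<Sum>T\<in>Pow S. r \<psi> T)"
      by (rule sum.reindex_bij_witness[of _ "flip \<psi>" "flip \<psi>"]) (use \<psi> in \<open>auto simp: flip_def\<close>)
    then have "2 * (\<Sum>T\<in>Pow S. r \<psi> T) = (\<Sum>T\<in>Pow S. r \<psi> T + r \<psi> (flip \<psi> T))"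
      by (simp add: sum.distrib mult_2)
    also have "\<dots> \<ge> (\<Sum>T\<in>Pow S. ennreal e)"
    proof (rule sum_mono)
      fix T assume T: "T \<in> Pow S"
      show "ennreal e \<le> r \<psi> T + r \<psi> (flip \<psi> T)"
      proof (cases "\<psi> \<in> T")
        case True
        then show ?thesis using pair[OF \<psi>, of "T - {\<psi>}"] T
          by (auto simp: flip_def insert_absorb add.commute)
      next
        case False
        then show ?thesis using pair[OF \<psi>, of T] T by (auto simp: flip_def)
      qed
    qed
    finally show ?thesis by (simp add: N_def)
  qed
  have "ennreal \<kappa> * (of_nat (card S) * (of_nat N * ennreal e)) = ennreal \<kappa> * (\<Sum>\<psi>\<in>S. of_nat N * ennreal e)"
    by simp
  also have "\<dots> \<le> ennreal \<kappa> * (\<Sum>\<psi>\<in>S. 2 * (\<Sum>T\<in>Pow S. r \<psi> T))"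
    by (intro mult_left_mono sum_mono half) auto
  also have "\<dots> = 2 * (\<Sum>T\<in>Pow S. ennreal \<kappa> * (\<Sum>\<psi>\<in>S. r \<psi> T))"
    by (simp add: sum_distrib_left[symmetric] mult.left_commute) (subst sum.swap, simp)
  also have "\<dots> \<le> 2 * (\<Sum>T\<in>Pow S. V)" by (intro mult_left_mono sum_mono V) auto
  also have "\<dots> = ennreal (2 * real N * v)"
    using real by (simp add: N_def ennreal_mult ennreal_of_nat_eq_real_of_nat mult.assoc)
  finally have "ennreal (\<kappa> * (real (card S) * (real N * e))) \<le> ennreal (2 * real N * v)"
    using \<kappa> e by (simp add: ennreal_mult ennreal_of_nat_eq_real_of_nat)
  then have "\<kappa> * (real (card S) * (real N * e)) \<le> 2 * real N * v"
    using real by (subst (asm) ennreal_le_iff) auto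
  then have "real N * (\<kappa> * real (card S) * e) \<le> real N * (2 * v)" by (simp add: algebra_simps)
  then have "\<kappa> * real (card S) * e \<le> 2 * v" using N by (subst (asm) mult_le_cancel_left_pos) auto
  then show ?thesis using real by (simp add: ennreal_leI)
qed simp

section \<open>Laws with a density on the cube\<close>

definition cube_density :: "(real ^ 'd \<Rightarrow> real) \<Rightarrow> bool" where
  "cube_density f \<longleftrightarrow> f \<in> borel_measurable leb_cube \<and> (AE x in leb_cube. 0 \<le> f x) \<and> (\<integral>x. f x \<partial>leb_cube) = 1"

text \<open>The Bochner integral of a nonintegrable function is 0 by convention, so the value 1
  forces integrability.\<close>

lemma cube_density_integrable: "cube_density f \<Longrightarrow> integrable leb_cube f"
  unfolding cube_density_def by (metis not_integrable_integral_eq zero_neq_one)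

lemma law_density_measurable:
  "f \<in> borel_measurable leb_cube \<Longrightarrow> (\<lambda>x. indicator unit_cube x * ennreal (f x)) \<in> borel_measurable lborel"
  using borel_measurable_restrict_space_iff_ennreal[of unit_cube lborel "\<lambda>x. ennreal (f x)"]
  by (simp add: mult.commute)

lemma sets_law [simp]: "sets (law f) = sets borel"
  by (simp add: law_def)

lemma space_law [simp]: "space (law f) = UNIV"
  by (simp add: law_def)

lemma nn_integral_law:
  assumes f: "f \<in> borel_measurable leb_cube" and h: "h \<in> borel_measurable borel"
  shows "(\<integral>\<^sup>+x. h x \<partial>law f) = (\<integral>\<^sup>+x. ennreal (f x) * h x \<partial>leb_cube)"
proof -
  have "(\<integral>\<^sup>+x. h x \<partial>law f) = (\<integral>\<^sup>+x. (indicator unit_cube x * ennreal (f x)) * h x \<partial>lborel)"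
    unfolding law_def using law_density_measurable[OF f] h by (intro nn_integral_density) auto
  also have "\<dots> = (\<integral>\<^sup>+x. ennreal (f x) * h x \<partial>leb_cube)"
    by (subst nn_integral_restrict_space) (auto intro!: nn_integral_cong simp: mult_ac)
  finally show ?thesis .
qed

lemma prob_space_law:
  assumes f: "cube_density f" shows "prob_space (law f)"
proof (rule prob_spaceI)
  have m: "f \<in> borel_measurable leb_cube" using f by (simp add: cube_density_def)
  have "emeasure (law f) (space (law f)) = (\<integral>\<^sup>+x. 1 \<partial>law f)" by simp
  also have "\<dots> = (\<integral>\<^sup>+x. ennreal (f x) \<partial>leb_cube)" by (subst nn_integral_law[OF m]) auto
  also have "\<dots> = ennreal (\<integral>x. f x \<partial>leb_cube)"
    using f by (intro nn_integral_eq_integral cube_density_integrable) (auto simp: cube_density_def)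
  finally show "emeasure (law f) (space (law f)) = 1" using f by (simp add: cube_density_def)
qed

lemma integral_law:
  fixes h :: "real ^ 'd \<Rightarrow> real"
  assumes f: "cube_density f" and h: "h \<in> borel_measurable borel"
  shows "(\<integral>x. h x \<partial>law f) = (\<integral>x. f x * h x \<partial>leb_cube)"
proof -
  have m: "(\<lambda>x. indicator unit_cube x * f x) \<in> borel_measurable lborel"
    using f borel_measurable_restrict_space_iff[of unit_cube lborel f]
    by (simp add: cube_density_def)
  have "AE x in lborel. x \<in> unit_cube \<longrightarrow> 0 \<le> f x"
    using f by (subst AE_leb_cube_iff[symmetric]) (simp add: cube_density_def)
  then have ae: "AE x in lborel. 0 \<le> indicator unit_cube x * f x"
    by eventually_elim (simp add: indicator_def)
  have "law f = density lborel (\<lambda>x. ennreal (indicator unit_cube x * f x))"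
    unfolding law_def by (intro arg_cong2[where f=density] ext refl) (simp add: indicator_def)
  then have "(\<integral>x. h x \<partial>law f) = (\<integral>x. (indicator unit_cube x * f x) *\<^sub>R h x \<partial>lborel)"
    using h m ae by (simp only:) (rule integral_density; simp)
  also have "\<dots> = (\<integral>x. f x * h x \<partial>leb_cube)"
    by (subst integral_restrict_space) (auto simp: mult.assoc)
  finally show ?thesis .
qed

text \<open>The second moment of \<open>f2 / f1\<close> under the law of \<open>f1\<close> is 1 plus
  the integral of (f2 - f1)^2 / f1. The lower bound \<open>m\<close> on \<open>f1\<close> turns this
  into a squared L_2 distance, for which \<open>m / real n\<close> is exactly the budget of
  \<open>product_two_point_lower\<close>.\<close>

lemma law_two_point_lower:
  fixes f1 f2 :: "real ^ 'd \<Rightarrow> real"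
  assumes f1: "cube_density f1" and f2: "cube_density f2"
    and m: "0 < m" "AE x in leb_cube. m \<le> f1 x"
    and sq: "integrable leb_cube (\<lambda>x. (f2 x - f1 x)\<^sup>2)" "(\<integral>x. (f2 x - f1 x)\<^sup>2 \<partial>leb_cube) \<le> m / real n"
    and n: "1 \<le> n" and b: "b \<in> borel_measurable (\<Pi>\<^sub>M i\<in>{..<n}. borel)" and e: "0 \<le> e"
  shows "ennreal (e / 4) \<le> (\<integral>\<^sup>+X. ennreal \<bar>a - b X\<bar> \<partial>(\<Pi>\<^sub>M i\<in>{..<n}. law f1))
      + (\<integral>\<^sup>+X. ennreal \<bar>a + e - b X\<bar> \<partial>(\<Pi>\<^sub>M i\<in>{..<n}. law f2))"
proof -
  have m1: "f1 \<in> borel_measurable leb_cube" and m2: "f2 \<in> borel_measurable leb_cube"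
    and ae2: "AE x in leb_cube. 0 \<le> f2 x"
    using f1 f2 by (auto simp: cube_density_def)
  have mu: "(\<lambda>x. indicator unit_cube x * f x) \<in> borel_measurable lborel"
    if "f \<in> borel_measurable leb_cube" for f :: "real ^ 'd \<Rightarrow> real"
    using that borel_measurable_restrict_space_iff[of unit_cube lborel f] by simp
  \<comment> \<open>The indicators make the ratio Borel on the whole space, with value 0 / 0 = 0 off
    the cube, and \<open>max 0\<close> makes it nonnegative even on the null set where
    \<open>f2\<close> may be negative.\<close>
  define g where "g x = max 0 ((indicator unit_cube x * f2 x) / (indicator unit_cube x * f1 x))" for x
  have g[measurable]: "g \<in> borel_measurable borel"
    unfolding g_def[abs_def] using borel_measurable_divide[OF mu[OF m2] mu[OF m1]]
    by (intro borel_measurable_max) auto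
  have g0: "0 \<le> g x" for x by (simp add: g_def)
  have ratio: "AE x in leb_cube. 0 \<le> f2 x \<and> 0 < f1 x \<and> g x = f2 x / f1 x"
    using m(2) ae2 AE_space
  proof eventually_elim
    case (elim x)
    then show ?case using m(1) by (simp add: g_def)
  qed
  have eq: "law f2 = density (law f1) (\<lambda>x. ennreal (g x))"
  proof -
    have "density (law f1) (\<lambda>x. ennreal (g x)) = density lborel (\<lambda>x. (indicator unit_cube x * ennreal (f1 x)) * ennreal (g x))"
      unfolding law_def using law_density_measurable[OF m1] by (intro density_density_eq) auto
    also have "\<dots> = law f2"
      unfolding law_def
    proof (rule density_cong)
      have "AE x in lborel. x \<in> unit_cube \<longrightarrow> (0 \<le> f2 x \<and> 0 < f1 x \<and> g x = f2 x / f1 x)"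
        using ratio by (subst AE_leb_cube_iff[symmetric])
      then show "AE x in lborel. (indicator unit_cube x * ennreal (f1 x)) * ennreal (g x) = indicator unit_cube x * ennreal (f2 x)"
      proof eventually_elim
        case (elim x)
        then show ?case by (auto simp: indicator_def simp flip: ennreal_mult)
      qed
      show "(\<lambda>x. (indicator unit_cube x * ennreal (f1 x)) * ennreal (g x)) \<in> borel_measurable lborel"
        by (rule borel_measurable_times_ennreal[OF law_density_measurable[OF m1]]) simp
    qed (rule law_density_measurable[OF m2])
    finally show ?thesis by simp
  qed
  have chi: "(\<integral>\<^sup>+x. ennreal ((g x)\<^sup>2) \<partial>law f1) \<le> ennreal (1 + 1 / real n)"
  proof -
    \<comment> \<open>This is the expansion of \<open>f2^2 / f1\<close> around \<open>f1\<close>,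
      with the last denominator replaced by \<open>m\<close>; it is integrable with an explicit
      integral.\<close>
    define k where "k x = 2 * f2 x - f1 x + (f2 x - f1 x)\<^sup>2 / m" for x
    have le: "AE x in leb_cube. f1 x * (g x)\<^sup>2 \<le> k x \<and> 0 \<le> k x \<and> 0 \<le> f1 x"
      using ratio m(2)
    proof eventually_elim
      case (elim x)
      have "f1 x * (g x)\<^sup>2 = 2 * f2 x - f1 x + (f2 x - f1 x)\<^sup>2 / f1 x"
        using elim by (simp add: power2_eq_square field_simps)
      also have "\<dots> \<le> k x" unfolding k_def using elim m(1) by (intro add_left_mono divide_left_mono) auto
      finally have 1: "f1 x * (g x)\<^sup>2 \<le> k x" .
      moreover have "0 \<le> f1 x * (g x)\<^sup>2" using elim by simp
      ultimately show ?case using elim by linarith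
    qed
    have ik: "integrable leb_cube k"
      unfolding k_def using sq(1) cube_density_integrable[OF f1] cube_density_integrable[OF f2]
      by (intro Bochner_Integration.integrable_add Bochner_Integration.integrable_diff integrable_mult_right) auto
    have "(\<integral>\<^sup>+x. ennreal ((g x)\<^sup>2) \<partial>law f1) = (\<integral>\<^sup>+x. ennreal (f1 x) * ennreal ((g x)\<^sup>2) \<partial>leb_cube)"
      by (rule nn_integral_law[OF m1]) auto
    also have "\<dots> \<le> (\<integral>\<^sup>+x. ennreal (k x) \<partial>leb_cube)"
    proof (rule nn_integral_mono_AE)
      show "AE x in leb_cube. ennreal (f1 x) * ennreal ((g x)\<^sup>2) \<le> ennreal (k x)"
        using le by eventually_elim (simp add: ennreal_leI flip: ennreal_mult)
    qed
    also have "\<dots> = ennreal (\<integral>x. k x \<partial>leb_cube)"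
      using ik le by (intro nn_integral_eq_integral) auto
    also have "(\<integral>x. k x \<partial>leb_cube) = 1 + (\<integral>x. (f2 x - f1 x)\<^sup>2 \<partial>leb_cube) / m"
      unfolding k_def using sq(1) cube_density_integrable[OF f1] cube_density_integrable[OF f2] f1 f2
      by (simp add: cube_density_def)
    also have "ennreal \<dots> \<le> ennreal (1 + 1 / real n)"
      using sq(2) m(1) n by (intro ennreal_leI) (simp add: field_simps)
    finally show ?thesis .
  qed
  have b': "b \<in> borel_measurable (\<Pi>\<^sub>M i\<in>{..<n}. law f1)"
  proof -
    have "sets (\<Pi>\<^sub>M i\<in>{..<n}. law f1) = sets (\<Pi>\<^sub>M i\<in>{..<n}. borel :: (real ^ 'd) measure)"
      by (intro sets_PiM_cong) auto
    then show ?thesis using b measurable_cong_sets by blast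
  qed
  have g': "g \<in> borel_measurable (law f1)" using g by (simp add: law_def)
  show ?thesis
    using product_two_point_lower[OF prob_space_law[OF f1] g' g0 _ chi n b' e, of a] prob_space_law[OF f2]
    unfolding eq by blast
qed

section \<open>Wavelet coefficients as Wasserstein test functionals\<close>

context regular_wavelet_system
begin

text \<open>Estimated measures need not live on the cube, so wavelets are extended by clamping; this keeps
  the Lipschitz constant.\<close>

definition cube_extend :: "(real ^ 'd \<Rightarrow> real) \<Rightarrow> real ^ 'd \<Rightarrow> real" where
  "cube_extend f x = f (clamp 0 1 x)"

lemma clamp_unit_cube: "clamp 0 (1 :: real ^ 'd) x \<in> unit_cube"
  unfolding unit_cube_def by (rule clamp_in_interval) (auto simp: Basis_vec_def inner_axis)

lemma cube_extend_eq: "x \<in> unit_cube \<Longrightarrow> cube_extend f x = f x"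
  by (simp add: cube_extend_def unit_cube_def clamp_cancel_cbox)

lemma cube_extend_measurable: "continuous_on unit_cube f \<Longrightarrow> cube_extend f \<in> borel_measurable borel"
  unfolding cube_extend_def[abs_def]
  by (intro borel_measurable_continuous_onI clamp_continuous_on) (simp add: unit_cube_def)

lemma inner_cube_integrable:
  assumes "integrable leb_cube f" "b \<in> all_wavelets"
  shows "integrable leb_cube (\<lambda>x. f x * b x)"
proof -
  have cb: "continuous_on unit_cube b" using assms(2) by (rule basis_continuous)
  have "bounded (b ` unit_cube)"
    using compact_continuous_image[OF cb compact_unit_cube] compact_imp_bounded by blast
  then obtain B where B: "\<And>x. x \<in> unit_cube \<Longrightarrow> \<bar>b x\<bar> \<le> B" by (auto simp: bounded_iff)
  have "AE x in leb_cube. norm (f x * b x) \<le> norm (B * f x)"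
  proof (rule AE_leb_cubeI)
    fix x :: "real ^ 'd" assume "x \<in> unit_cube"
    then have "\<bar>b x\<bar> \<le> \<bar>B\<bar>" using B by (metis abs_ge_self order_trans)
    then have "\<bar>f x\<bar> * \<bar>b x\<bar> \<le> \<bar>f x\<bar> * \<bar>B\<bar>" by (intro mult_left_mono) auto
    then show "norm (f x * b x) \<le> norm (B * f x)" by (simp only: real_norm_def abs_mult mult_ac)
  qed
  moreover have "(\<lambda>x. f x * b x) \<in> borel_measurable leb_cube"
    using borel_measurable_integrable[OF assms(1)] continuous_on_cube_measurable[OF cb]
    by (rule borel_measurable_times)
  ultimately show ?thesis
    using integrable_mult_right[OF assms(1), of B] by (metis (no_types) Bochner_Integration.integrable_bound)
qed

text \<open>Each wavelet in the test function carries the sign of its coefficient error, so that the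
  errors add up in absolute value. The bounded overlap keeps the supremum of such a signed sum of
  order \<open>amp j\<close>, whatever the number of summands and the signs.\<close>

lemma wasserstein_ge_coefficients:
  "\<exists>c>0. \<forall>j S f \<nu> p. S \<subseteq> \<Psi> j \<longrightarrow> cube_density f \<longrightarrow> prob_space \<nu> \<longrightarrow> sets \<nu> = sets borel \<longrightarrow> 1 \<le> p \<longrightarrow>
     ennreal (c / (2 ^ j * amp j) * (\<Sum>\<psi>\<in>S. \<bar>inner_cube f \<psi> - (\<integral>y. cube_extend \<psi> y \<partial>\<nu>)\<bar>)) \<le> wasserstein p (law f) \<nu>"
proof -
  obtain C where C: "0 < C" "\<forall>j. \<forall>u\<in>span_cube (\<Phi> \<union> (\<Union>k<j. \<Psi> k)). \<forall>M\<ge>0. (\<forall>x\<in>unit_cube. \<bar>u x\<bar> \<le> M) \<longrightarrow>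
     (\<forall>x\<in>unit_cube. \<forall>y\<in>unit_cube. \<bar>u x - u y\<bar> \<le> C * 2 ^ j * M * dist x y)"
    using span_lipschitz by (elim exE conjE) (rule that)
  obtain D where D: "0 < D"
    "\<forall>j F. finite F \<longrightarrow> F \<subseteq> \<Psi> j \<longrightarrow> (\<forall>x\<in>unit_cube. (\<Sum>\<psi>\<in>F. \<bar>\<psi> x\<bar>) \<le> D * amp j)"
    using level_sum_abs_bound by (elim exE conjE) (rule that)
  \<comment> \<open>\<open>D * amp j\<close> bounds the signed sum and Bernstein's inequality at
    index \<open>Suc j\<close> contributes \<open>C * 2 ^ Suc j\<close>; hence the factor 2. With
    this \<open>c\<close> the test function is 1-Lipschitz.\<close>
  define c where "c = 1 / (2 * C * D)"
  have c: "0 < c" using C D by (simp add: c_def)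
  have "ennreal (c / (2 ^ j * amp j) * (\<Sum>\<psi>\<in>S. \<bar>inner_cube f \<psi> - (\<integral>y. cube_extend \<psi> y \<partial>\<nu>)\<bar>)) \<le> wasserstein p (law f) \<nu>"
    if S: "S \<subseteq> \<Psi> j" and f: "cube_density f" and \<nu>: "prob_space \<nu>" "sets \<nu> = sets borel" and p: "1 \<le> p" for j S f \<nu> p
  proof -
    have fin: "finite S" using S finite_level finite_subset by blast
    have cont: "continuous_on unit_cube \<psi>" if "\<psi> \<in> S" for \<psi> using that S psi_continuous by blast
    define \<sigma> where "\<sigma> \<psi> = sgn (inner_cube f \<psi> - (\<integral>y. cube_extend \<psi> y \<partial>\<nu>))" for \<psi>
    define u where "u x = (\<Sum>\<psi>\<in>S. \<sigma> \<psi> * \<psi> x)" for x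
    define \<kappa> where "\<kappa> = c / (2 ^ j * amp j)"
    have \<kappa>: "0 < \<kappa>" using c by (simp add: \<kappa>_def)
    define h where "h x = \<kappa> * cube_extend u x" for x
    have u_bd: "\<bar>u x\<bar> \<le> D * amp j" if x: "x \<in> unit_cube" for x
    proof -
      have "\<bar>u x\<bar> \<le> (\<Sum>\<psi>\<in>S. \<bar>\<sigma> \<psi> * \<psi> x\<bar>)" unfolding u_def by (rule sum_abs)
      also have "\<dots> \<le> (\<Sum>\<psi>\<in>S. \<bar>\<psi> x\<bar>)"
        by (intro sum_mono) (auto simp: abs_mult \<sigma>_def abs_sgn_eq)
      also have "\<dots> \<le> D * amp j" using D(2)[rule_format, OF fin S x] .
      finally show ?thesis .
    qed
    have "u \<in> span_cube (\<Phi> \<union> (\<Union>k<Suc j. \<Psi> k))"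
      unfolding span_cube_def using fin S
      by (intro CollectI exI[of _ S] exI[of _ \<sigma>]) (auto simp: u_def)
    then have u_lip: "\<bar>u x - u y\<bar> \<le> C * 2 ^ Suc j * (D * amp j) * dist x y" if "x \<in> unit_cube" "y \<in> unit_cube" for x y
      using C(2)[rule_format, of u "Suc j" "D * amp j" x y] that u_bd D(1) by (auto simp: less_imp_le)
    have u_cont: "continuous_on unit_cube u"
      unfolding u_def using cont by (intro continuous_intros) auto
    have lip: "h x - h y \<le> dist x y" for x y
    proof -
      have "h x - h y \<le> \<kappa> * \<bar>u (clamp 0 1 x) - u (clamp 0 1 y)\<bar>"
        using \<kappa> by (simp add: h_def cube_extend_def flip: right_diff_distrib)
      also have "\<dots> \<le> \<kappa> * (C * 2 ^ Suc j * (D * amp j) * dist (clamp 0 1 x) (clamp 0 1 y))"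
        using \<kappa> by (intro mult_left_mono u_lip clamp_unit_cube) auto
      also have "\<dots> \<le> \<kappa> * (C * 2 ^ Suc j * (D * amp j) * dist x y)"
        using \<kappa> C(1) D(1) by (intro mult_left_mono dist_clamps_le_dist_args) auto
      also have "\<dots> = dist x y"
      proof -
        have "amp j \<noteq> 0" using amp_pos[of j] by linarith
        then show ?thesis using C(1) D(1) by (simp add: \<kappa>_def c_def)
      qed
      finally show ?thesis .
    qed
    have bd: "\<bar>h x\<bar> \<le> \<kappa> * (D * amp j)" for x
      using u_bd[OF clamp_unit_cube[of x]] \<kappa> by (simp add: h_def cube_extend_def abs_mult mult_left_mono)
    have hm: "h \<in> borel_measurable borel"
      unfolding h_def[abs_def] using cube_extend_measurable[OF u_cont] by simp
    have ib: "integrable \<nu> (cube_extend \<psi>)" if \<psi>: "\<psi> \<in> S" for \<psi>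
    proof -
      interpret \<nu>: prob_space \<nu> by (rule \<nu>(1))
      obtain B where "\<And>x. x \<in> unit_cube \<Longrightarrow> \<bar>\<psi> x\<bar> \<le> B * amp j" using psi_bound \<psi> S by blast
      then have "\<And>x. \<bar>cube_extend \<psi> x\<bar> \<le> B * amp j" unfolding cube_extend_def using clamp_unit_cube by blast
      moreover have "cube_extend \<psi> \<in> borel_measurable \<nu>"
        using cube_extend_measurable[OF cont[OF \<psi>]] measurable_cong_sets[OF \<nu>(2) refl] by blast
      ultimately show ?thesis by (intro \<nu>.integrable_const_bound[of _ "B * amp j"]) auto
    qed
    have "(\<integral>x. h x \<partial>\<nu>) = \<kappa> * (\<integral>x. (\<Sum>\<psi>\<in>S. \<sigma> \<psi> * cube_extend \<psi> x) \<partial>\<nu>)"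
      by (simp add: h_def u_def cube_extend_def)
    also have "\<dots> = \<kappa> * (\<Sum>\<psi>\<in>S. \<sigma> \<psi> * (\<integral>y. cube_extend \<psi> y \<partial>\<nu>))"
      using ib by (subst Bochner_Integration.integral_sum) auto
    finally have h\<nu>: "(\<integral>x. h x \<partial>\<nu>) = \<kappa> * (\<Sum>\<psi>\<in>S. \<sigma> \<psi> * (\<integral>y. cube_extend \<psi> y \<partial>\<nu>))" .
    have "(\<integral>x. h x \<partial>law f) = (\<integral>x. f x * h x \<partial>leb_cube)" by (rule integral_law[OF f hm])
    also have "\<dots> = (\<integral>x. \<kappa> * (\<Sum>\<psi>\<in>S. \<sigma> \<psi> * (f x * \<psi> x)) \<partial>leb_cube)"
      by (intro Bochner_Integration.integral_cong)
         (auto simp: h_def cube_extend_eq u_def sum_distrib_left algebra_simps)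
    also have "\<dots> = \<kappa> * (\<Sum>\<psi>\<in>S. \<sigma> \<psi> * inner_cube f \<psi>)"
    proof -
      have "integrable leb_cube (\<lambda>x. f x * \<psi> x)" if "\<psi> \<in> S" for \<psi>
        using that S by (intro inner_cube_integrable cube_density_integrable[OF f]) blast
      then show ?thesis
        unfolding inner_cube_def integral_mult_right_zero by (subst Bochner_Integration.integral_sum) auto
    qed
    finally have hf: "(\<integral>x. h x \<partial>law f) = \<kappa> * (\<Sum>\<psi>\<in>S. \<sigma> \<psi> * inner_cube f \<psi>)" .
    have "(\<integral>x. h x \<partial>law f) - (\<integral>x. h x \<partial>\<nu>) = \<kappa> * (\<Sum>\<psi>\<in>S. \<bar>inner_cube f \<psi> - (\<integral>y. cube_extend \<psi> y \<partial>\<nu>)\<bar>)"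
      unfolding hf h\<nu> right_diff_distrib[symmetric] sum_subtractf[symmetric]
      by (intro arg_cong2[where f=times] refl sum.cong) (auto simp: \<sigma>_def abs_sgn algebra_simps)
    then show ?thesis
      using wasserstein_ge_lipschitz[OF prob_space_law[OF f] _ \<nu> p lip bd hm] by (simp add: \<kappa>_def)
  qed
  then show ?thesis using c by blast
qed

end

section \<open>Oscillating test functions\<close>

lemma AE_component_neq: "AE x in lborel. (x :: real ^ 'd) $ i \<noteq> c"
proof -
  have ax: "axis i 1 \<in> (Basis :: (real ^ 'd) set)" by (auto simp: Basis_vec_def)
  have "negligible {x :: real ^ 'd. x \<bullet> axis i 1 = c}" by (rule negligible_standard_hyperplane[OF ax])
  then have "negligible {x :: real ^ 'd. x $ i = c}" by (simp add: inner_axis)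
  then have "{x :: real ^ 'd. x $ i = c} \<in> null_sets (completion lborel)" by (simp add: negligible_iff_null_sets)
  moreover have "closed {x :: real ^ 'd. x $ i = c}"
    by (intro closed_Collect_eq continuous_intros)
  ultimately have "{x :: real ^ 'd. x $ i = c} \<in> null_sets lborel"
    by (subst (asm) null_sets_completion_iff) auto
  then show ?thesis by (rule AE_I') auto
qed

lemma integral_lborel_translate:
  fixes G :: "real ^ 'd \<Rightarrow> real"
  assumes "G \<in> borel_measurable borel"
  shows "(\<integral>x. G (v + x) \<partial>lborel) = (\<integral>x. G x \<partial>lborel)"
  using integral_distr[of "(+) v" lborel borel G] assms lborel_distr_plus[of v] by simp

lemma measure_cbox_le_diameter_power:
  fixes a b :: "real ^ 'd"
  shows "measure lborel (cbox a b) \<le> diameter (cbox a b) ^ CARD('d)"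
proof (cases "cbox a b = {}")
  case False
  then have ab: "a \<in> cbox a b" "b \<in> cbox a b" by (auto simp: mem_box box_ne_empty)
  have "measure lborel (cbox a b) = (\<Prod>i\<in>UNIV. b $ i - a $ i)"
    using content_cbox_cart[OF False] by simp
  also have "\<dots> \<le> (\<Prod>i\<in>(UNIV :: 'd set). diameter (cbox a b))"
  proof (rule prod_mono)
    fix i :: 'd
    have "b $ i - a $ i \<le> norm (b - a)" using component_le_norm_cart[of "b - a" i] by simp
    also have "\<dots> \<le> diameter (cbox a b)"
      using diameter_bounded_bound[OF bounded_cbox ab(2,1)] by (simp add: dist_norm)
    finally show "0 \<le> b $ i - a $ i \<and> b $ i - a $ i \<le> diameter (cbox a b)"
      using False by (auto simp: interval_ne_empty_cart)
  qed
  finally show ?thesis by simp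
qed (simp add: diameter_def)

text \<open>Pairing each point of an even strip with its translate by the half-period, where the
  antiperiodic factor changes sign, replaces \<open>g\<close> by its increments.\<close>

lemma antiperiodic_integral_bound:
  fixes F g :: "real ^ 'd \<Rightarrow> real" and i :: 'd and N :: nat
  assumes N: "even N" "0 < N"
    and F: "continuous_on UNIV F" "\<And>x. \<bar>F x\<bar> \<le> 1" "\<And>x. F (x + axis i (1 / real N)) = - F x"
    and g: "continuous_on unit_cube g" "\<And>x y. x \<in> unit_cube \<Longrightarrow> y \<in> unit_cube \<Longrightarrow> \<bar>g x - g y\<bar> \<le> L * dist x y"
    and L: "0 \<le> L" and supp: "\<And>x. x \<in> unit_cube \<Longrightarrow> g x \<noteq> 0 \<Longrightarrow> x \<in> cbox a b"
  shows "\<bar>inner_cube F g\<bar> \<le> 2 * L * measure lborel (cbox a b) / real N"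
proof -
  define v :: "real ^ 'd" where "v = axis i (1 / real N)"
  define e where "e x \<longleftrightarrow> even \<lfloor>x $ i * real N\<rfloor>" for x :: "real ^ 'd"
  \<comment> \<open>The cube is cut into \<open>N\<close> half-open strips of width
    \<open>1 / real N\<close>. Since \<open>N\<close> is even, translation by \<open>v\<close>
    carries the strips of even index onto those of odd index; the face where the coordinate equals 1
    is a null set.\<close>
  define A where "A = {x \<in> unit_cube. x $ i < 1 \<and> e x}"
  define A' where "A' = {x \<in> unit_cube. x $ i < 1 \<and> \<not> e x}"
  have [measurable]: "A \<in> sets borel" "A' \<in> sets borel"
  proof -
    have "Measurable.pred borel (\<lambda>x :: real ^ 'd. x $ i < 1)" "Measurable.pred borel e"
      unfolding e_def by measurable
    then show "A \<in> sets borel" "A' \<in> sets borel" unfolding A_def A'_def by measurable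
  qed
  have norm_v: "norm v = 1 / real N" by (simp add: v_def norm_eq_sqrt_inner inner_axis_axis real_sqrt_divide)
  have shift: "v + x \<in> A' \<longleftrightarrow> x \<in> A" for x
  proof -
    have comp: "(v + x) $ k = (if k = i then x $ i + 1 / real N else x $ k)" for k
      by (simp add: v_def axis_def)
    have "(v + x) $ i * real N = x $ i * real N + 1" using comp[of i] N by (simp add: field_simps)
    then have fl: "\<lfloor>(v + x) $ i * real N\<rfloor> = \<lfloor>x $ i * real N\<rfloor> + 1" by simp
    then have e: "e (v + x) \<longleftrightarrow> \<not> e x" by (simp add: e_def)
    have mem: "y \<in> unit_cube \<longleftrightarrow> (\<forall>k. 0 \<le> y $ k \<and> y $ k \<le> 1)" for y :: "real ^ 'd"
      by (simp add: unit_cube_def mem_box_cart)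
    have "0 \<le> x $ i \<and> x $ i < 1 \<longleftrightarrow> 0 \<le> x $ i + 1 / real N \<and> x $ i + 1 / real N < 1" if ex: "e x"
    proof -
      define k where "k = \<lfloor>x $ i * real N\<rfloor>"
      have k: "even k" "of_int k \<le> x $ i * real N" "x $ i * real N < of_int k + 1"
        using ex by (auto simp: k_def e_def)
      show ?thesis
      proof
        assume a: "0 \<le> x $ i \<and> x $ i < 1"
        then have "x $ i * real N < real N" using N by simp
        then have "k < int N" using k(2) by linarith
        \<comment> \<open>\<open>N - 1\<close> is odd, so a strip of even index is never the last
          one and its translate stays inside the cube.\<close>
        moreover have "k \<noteq> int N - 1" using k(1) N(1) by auto
        ultimately have "k + 2 \<le> int N" by linarith
        then have "of_int k + 2 \<le> real N" by linarith
        then have "x $ i * real N + 1 < real N" using k(3) by linarith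
        then have "x $ i + 1 / real N < 1" using N by (simp add: field_simps)
        then show "0 \<le> x $ i + 1 / real N \<and> x $ i + 1 / real N < 1" using a by simp
      next
        assume a: "0 \<le> x $ i + 1 / real N \<and> x $ i + 1 / real N < 1"
        then have "0 \<le> (x $ i + 1 / real N) * real N" by simp
        then have "0 \<le> x $ i * real N + 1" using N by (simp only: distrib_right) simp
        then have "-1 \<le> k" using k(3) by linarith
        moreover have "k \<noteq> -1" using k(1) by auto
        ultimately have "0 \<le> k" by linarith
        then have "0 \<le> x $ i * real N" using k(2) by linarith
        then have "0 \<le> x $ i" using N by (simp add: zero_le_mult_iff)
        moreover have "0 < 1 / real N" using N by simp
        ultimately show "0 \<le> x $ i \<and> x $ i < 1" using a by linarith
      qed
    qed
    then have "e x \<Longrightarrow> (v + x \<in> unit_cube \<and> (v + x) $ i < 1) \<longleftrightarrow> (x \<in> unit_cube \<and> x $ i < 1)"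
      unfolding mem comp by (smt (verit, ccfv_threshold))
    then show ?thesis unfolding A_def A'_def mem_Collect_eq using e by blast
  qed
  define gt where "gt x = indicator unit_cube x * g x" for x
  have gt_m[measurable]: "gt \<in> borel_measurable borel"
    using borel_measurable_restrict_space_iff[of unit_cube lborel g] continuous_on_cube_measurable[OF g(1)]
    by (simp add: gt_def[abs_def])
  have F_m[measurable]: "F \<in> borel_measurable borel" using F(1) by (rule borel_measurable_continuous_onI)
  obtain B where B: "\<And>x. x \<in> unit_cube \<Longrightarrow> \<bar>g x\<bar> \<le> B" "0 \<le> B"
  proof -
    have "bounded (g ` unit_cube)"
      using compact_continuous_image[OF g(1) compact_unit_cube] compact_imp_bounded by blast
    then obtain B where "\<And>x. x \<in> unit_cube \<Longrightarrow> \<bar>g x\<bar> \<le> B" by (auto simp: bounded_iff)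
    then show ?thesis using that[of "max B 0"] by (meson max.cobounded1 max.cobounded2 order_trans)
  qed
  have int: "integrable lborel (\<lambda>x. indicator Q x * F x * gt x)" if "Q \<in> sets borel" for Q
  proof (rule Bochner_Integration.integrable_bound)
    show "integrable lborel (\<lambda>x. B * indicator (unit_cube :: (real ^ 'd) set) x)"
      by (intro integrable_mult_right integrable_real_indicator) (auto simp: emeasure_unit_cube)
    show "AE x in lborel. norm (indicator Q x * F x * gt x) \<le> norm (B * indicator unit_cube x)"
    proof (rule AE_I2)
      fix x
      have "\<bar>F x\<bar> * \<bar>g x\<bar> \<le> 1 * B" if "x \<in> unit_cube" using F(2) B that by (intro mult_mono) auto
      then show "norm (indicator Q x * F x * gt x) \<le> norm (B * indicator unit_cube x)"
        using B(2) by (auto simp: indicator_def gt_def abs_mult)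
    qed
    show "(\<lambda>x. indicator Q x * F x * gt x) \<in> borel_measurable lborel"
      using that by measurable
  qed
  define T where "T x = indicator A x * F x * gt (v + x)" for x
  have T: "indicator A' (v + x) * F (v + x) * gt (v + x) = - T x" for x
    using shift[of x] F(3)[of x] by (simp add: T_def indicator_def v_def add.commute)
  have intT: "integrable lborel T"
  proof -
    have "integrable (distr lborel borel ((+) v)) (\<lambda>x. indicator A' x * F x * gt x)"
      using int[of A'] by (simp add: lborel_distr_plus)
    then have "integrable lborel (\<lambda>x. indicator A' (v + x) * F (v + x) * gt (v + x))"
      by (subst (asm) integrable_distr_eq) auto
    then show ?thesis unfolding T by simp
  qed
  have "inner_cube F g = (\<integral>x. indicator unit_cube x *\<^sub>R (F x * g x) \<partial>lborel)"
    unfolding inner_cube_def by (rule integral_restrict_space) simp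
  also have "\<dots> = (\<integral>x. indicator A x * F x * gt x + indicator A' x * F x * gt x \<partial>lborel)"
  proof (rule integral_cong_AE)
    show "(\<lambda>x. indicator unit_cube x *\<^sub>R (F x * g x)) \<in> borel_measurable lborel"
    proof -
      have "(\<lambda>x. indicator unit_cube x *\<^sub>R (F x * g x)) = (\<lambda>x. F x * gt x)" by (auto simp: gt_def fun_eq_iff)
      then show ?thesis by simp
    qed
    show "(\<lambda>x. indicator A x * F x * gt x + indicator A' x * F x * gt x) \<in> borel_measurable lborel" by measurable
    have le: "x $ i \<le> 1" if "x \<in> unit_cube" for x :: "real ^ 'd" using that by (simp add: unit_cube_def mem_box_cart)
    show "AE x in lborel. indicator unit_cube x *\<^sub>R (F x * g x) = indicator A x * F x * gt x + indicator A' x * F x * gt x"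
      using AE_component_neq[of i 1]
    proof eventually_elim
      case (elim x)
      then show ?case using le[of x] by (auto simp: A_def A'_def gt_def indicator_def)
    qed
  qed
  also have "\<dots> = (\<integral>x. indicator A x * F x * gt x \<partial>lborel) + (\<integral>x. indicator A' x * F x * gt x \<partial>lborel)"
    by (intro Bochner_Integration.integral_add int) auto
  also have "(\<integral>x. indicator A' x * F x * gt x \<partial>lborel) = (\<integral>x. - T x \<partial>lborel)"
    unfolding T[symmetric] by (rule integral_lborel_translate[symmetric]) measurable
  also have "(\<integral>x. indicator A x * F x * gt x \<partial>lborel) + (\<integral>x. - T x \<partial>lborel)
      = (\<integral>x. indicator A x * F x * gt x - T x \<partial>lborel)"
    using int[of A] intT by (simp add: Bochner_Integration.integral_diff)
  finally have eq: "inner_cube F g = (\<integral>x. indicator A x * F x * gt x - T x \<partial>lborel)" .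
  let ?I = "indicator (cbox a b) :: real ^ 'd \<Rightarrow> real"
  have i1: "integrable lborel ?I" using emeasure_bounded_finite[OF bounded_cbox[of a b]] by (intro integrable_real_indicator) auto
  have i2: "integrable lborel (\<lambda>x. ?I (v + x))"
  proof -
    have "integrable (distr lborel borel ((+) v)) ?I" using i1 by (simp add: lborel_distr_plus)
    then show ?thesis by (subst (asm) integrable_distr_eq) auto
  qed
  \<comment> \<open>On \<open>A\<close> the difference equals
    \<open>F x * (g x - g (v + x))\<close>, of size at most \<open>L / real N\<close>. It vanishes
    unless \<open>x\<close> or its translate lies in the box; the two indicators are the origin of
    the factor 2 in the result.\<close>
  have pw: "\<bar>indicator A x * F x * gt x - T x\<bar> \<le> L / real N * (?I x + ?I (v + x))" for x
  proof (cases "x \<in> A")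
    case True
    then have xc: "x \<in> unit_cube" "v + x \<in> unit_cube" using shift[of x] by (auto simp: A_def A'_def)
    have "indicator A x * F x * gt x - T x = F x * (g x - g (v + x))"
      using True xc by (simp add: T_def gt_def right_diff_distrib)
    then have "\<bar>indicator A x * F x * gt x - T x\<bar> \<le> 1 * \<bar>g x - g (v + x)\<bar>"
      using mult_right_mono[OF F(2)[of x], of "\<bar>g x - g (v + x)\<bar>"] by (simp add: abs_mult)
    also have "\<dots> \<le> L / real N * (?I x + ?I (v + x))"
    proof (cases "x \<in> cbox a b \<or> v + x \<in> cbox a b")
      case True
      have "1 * \<bar>g x - g (v + x)\<bar> \<le> L / real N * 1" using g(2)[OF xc] norm_v by (simp add: dist_norm)
      also have "\<dots> \<le> L / real N * (?I x + ?I (v + x))" using L True by (intro mult_left_mono) (auto simp: indicator_def)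
      finally show ?thesis .
    next
      case False
      then have "g x = 0" "g (v + x) = 0" using supp xc by blast+
      then show ?thesis using L by simp
    qed
    finally show ?thesis .
  next
    case False
    then show ?thesis using L by (simp add: T_def)
  qed
  have "\<bar>inner_cube F g\<bar> \<le> (\<integral>x. \<bar>indicator A x * F x * gt x - T x\<bar> \<partial>lborel)"
    unfolding eq by (rule integral_abs_bound)
  also have "\<dots> \<le> (\<integral>x. L / real N * (?I x + ?I (v + x)) \<partial>lborel)"
    using int[of A] intT i1 i2 pw by (intro integral_mono) auto
  also have "\<dots> = L / real N * ((\<integral>x. ?I x \<partial>lborel) + (\<integral>x. ?I (v + x) \<partial>lborel))"
    using i1 i2 by simp
  also have "(\<integral>x. ?I (v + x) \<partial>lborel) = (\<integral>x. ?I x \<partial>lborel)" by (rule integral_lborel_translate) simp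
  finally show ?thesis by (simp add: field_simps)
qed

abbreviation energy :: "(real ^ 'd \<Rightarrow> real) \<Rightarrow> (real ^ 'd \<Rightarrow> real) set \<Rightarrow> real" where
  "energy F S \<equiv> \<Sum>\<phi>\<in>S. (inner_cube F \<phi>)\<^sup>2"

text \<open>The interface to the waves \<open>cos (pi * real N * x $ i)\<close> and
  \<open>sin (pi * real N * x $ i)\<close>. The evenness of \<open>N\<close> allows strips of
  opposite sign to be paired within the cube, and the 4 is an upper bound for
  \<open>pi\<close>.\<close>

definition oscillating :: "'d \<Rightarrow> nat \<Rightarrow> (real ^ 'd \<Rightarrow> real) \<Rightarrow> bool" where
  "oscillating i N F \<longleftrightarrow> even N \<and> 0 < N \<and> continuous_on UNIV F \<and> (\<forall>x. \<bar>F x\<bar> \<le> 1) \<and>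
     (\<forall>x. F (x + axis i (1 / real N)) = - F x) \<and> (\<forall>x y. \<bar>F x - F y\<bar> \<le> 4 * real N * dist x y) \<and>
     1 / 2 \<le> inner_cube F F"

text \<open>A half-period of \<open>1 / N\<close>; one of cosine and sine carries at least half of the energy.\<close>

lemma oscillating_exists:
  fixes N :: nat and i :: "'d::finite"
  assumes N: "0 < N" "even N"
  shows "\<exists>F. oscillating i N F"
proof -
  interpret prob_space "leb_cube :: (real ^ 'd) measure" by (rule prob_space_leb_cube)
  define \<theta> where "\<theta> x = pi * real N * x $ i" for x :: "real ^ 'd"
  have shift: "\<theta> (x + axis i (1 / real N)) = \<theta> x + pi" for x
    using N by (simp add: \<theta>_def axis_def field_simps)
  have cont: "continuous_on S (\<lambda>x. cos (\<theta> x))" "continuous_on S (\<lambda>x. sin (\<theta> x))" for S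
    unfolding \<theta>_def by (intro continuous_intros)+
  have \<theta>_lip: "\<bar>\<theta> x - \<theta> y\<bar> \<le> 4 * real N * dist x y" for x y
  proof -
    have "\<bar>\<theta> x - \<theta> y\<bar> = pi * real N * \<bar>(x - y) $ i\<bar>"
      by (simp add: \<theta>_def abs_mult flip: right_diff_distrib)
    also have "\<dots> \<le> 4 * real N * norm (x - y)"
      using pi_less_4 component_le_norm_cart[of "x - y" i] by (intro mult_mono) auto
    finally show ?thesis by (simp add: dist_norm)
  qed
  have one: "\<bar>f a - f b\<bar> \<le> \<bar>a - b\<bar>"
    if "\<And>x. (f has_real_derivative f' x) (at x)" "\<And>x. \<bar>f' x\<bar> \<le> 1" for f f' :: "real \<Rightarrow> real" and a b
    using field_differentiable_bound[of UNIV f f' 1 a b] that by simp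
  have cos_lip: "\<bar>cos a - cos b\<bar> \<le> \<bar>a - b\<bar>" for a b :: real
    by (rule one[of cos "\<lambda>x. - sin x"]) (auto intro: DERIV_cos)
  have sin_lip: "\<bar>sin a - sin b\<bar> \<le> \<bar>a - b\<bar>" for a b :: real
    by (rule one[of sin cos]) (auto intro: DERIV_sin)
  have "inner_cube (\<lambda>x. cos (\<theta> x)) (\<lambda>x. cos (\<theta> x)) + inner_cube (\<lambda>x. sin (\<theta> x)) (\<lambda>x. sin (\<theta> x))
      = (\<integral>x. cos (\<theta> x) * cos (\<theta> x) + sin (\<theta> x) * sin (\<theta> x) \<partial>leb_cube)"
    unfolding inner_cube_def
    by (intro Bochner_Integration.integral_add[symmetric] continuous_integrable_leb_cube continuous_intros cont)
  also have "\<dots> = (\<integral>x. 1 \<partial>(leb_cube :: (real ^ 'd) measure))"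
    by (metis (no_types) sin_cos_squared_add3 add.commute)
  also have "\<dots> = 1" using prob_space by simp
  finally consider "1 / 2 \<le> inner_cube (\<lambda>x. cos (\<theta> x)) (\<lambda>x. cos (\<theta> x))"
    | "1 / 2 \<le> inner_cube (\<lambda>x. sin (\<theta> x)) (\<lambda>x. sin (\<theta> x))" by linarith
  then show ?thesis
  proof cases
    case 1
    then show ?thesis
      using N cont shift order_trans[OF cos_lip \<theta>_lip] unfolding oscillating_def
      by (intro exI[of _ "\<lambda>x. cos (\<theta> x)"]) simp
  next
    case 2
    then show ?thesis
      using N cont shift order_trans[OF sin_lip \<theta>_lip] unfolding oscillating_def
      by (intro exI[of _ "\<lambda>x. sin (\<theta> x)"]) simp
  qed
qed

section \<open>Counting wavelets\<close>

lemma inner_cube_self_nonneg: "0 \<le> inner_cube f f"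
  by (simp add: inner_cube_def)

context regular_wavelet_system
begin

lemma basis_support:
  "\<exists>C>0. \<forall>k. \<forall>\<psi>\<in>\<Psi> k. \<exists>a b. (\<forall>x\<in>unit_cube. \<psi> x \<noteq> 0 \<longrightarrow> x \<in> cbox a b) \<and> diameter (cbox a b) \<le> C / 2 ^ k"
proof -
  obtain I :: "nat \<Rightarrow> (real ^ 'd \<Rightarrow> real) \<Rightarrow> (real ^ 'd) set" and C where loc: "\<forall>j.
      (\<forall>\<psi>\<in>\<Psi> j. (\<exists>a b. I j \<psi> = cbox a b) \<and> I j \<psi> \<subseteq> unit_cube \<and>
         closure {x\<in>unit_cube. \<psi> x \<noteq> 0} \<subseteq> I j \<psi> \<and> diameter (I j \<psi>) \<le> C * 2 powr (- real j)) \<and>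
      (AE x in leb_cube. finite {\<psi>\<in>\<Psi> j. x \<in> I j \<psi>} \<and> real (card {\<psi>\<in>\<Psi> j. x \<in> I j \<psi>}) \<le> C)"
    using localized by (elim exE) (rule that)
  have I: "(\<exists>a b. I k \<psi> = cbox a b) \<and> closure {x\<in>unit_cube. \<psi> x \<noteq> 0} \<subseteq> I k \<psi> \<and>
      diameter (I k \<psi>) \<le> C * 2 powr (- real k)" if "\<psi> \<in> \<Psi> k" for k \<psi>
    using bspec[OF conjunct1[OF spec[OF loc, of k]] that] by simp
  have "\<exists>a b. (\<forall>x\<in>unit_cube. \<psi> x \<noteq> 0 \<longrightarrow> x \<in> cbox a b) \<and> diameter (cbox a b) \<le> max C 1 / 2 ^ k"
    if p: "\<psi> \<in> \<Psi> k" for k \<psi>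
  proof -
    obtain a b where ab: "I k \<psi> = cbox a b" using I[OF p] by blast
    have "{x\<in>unit_cube. \<psi> x \<noteq> 0} \<subseteq> cbox a b" using I[OF p] ab closure_subset by (metis (no_types, lifting) order_trans)
    moreover have "diameter (cbox a b) \<le> C * 2 powr (- real k)" using I[OF p] ab by simp
    moreover have "C * 2 powr (- real k) \<le> max C 1 / 2 ^ k"
      by (simp add: powr_minus_divide powr_realpow divide_right_mono)
    ultimately show ?thesis by (intro exI[of _ a] exI[of _ b]) auto
  qed
  then show ?thesis by (intro exI[of _ "max C 1"]) auto
qed

lemma psi_lipschitz:
  "\<exists>C>0. \<forall>k. \<forall>\<psi>\<in>\<Psi> k. \<forall>x\<in>unit_cube. \<forall>y\<in>unit_cube. \<bar>\<psi> x - \<psi> y\<bar> \<le> C * 2 ^ k * amp k * dist x y"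
proof -
  obtain C where C: "0 < C" "\<forall>j. \<forall>u\<in>span_cube (\<Phi> \<union> (\<Union>k<j. \<Psi> k)). \<forall>M\<ge>0. (\<forall>x\<in>unit_cube. \<bar>u x\<bar> \<le> M) \<longrightarrow>
     (\<forall>x\<in>unit_cube. \<forall>y\<in>unit_cube. \<bar>u x - u y\<bar> \<le> C * 2 ^ j * M * dist x y)"
    using span_lipschitz by (elim exE conjE) (rule that)
  obtain D where D: "0 < D" "\<And>j \<psi> x. \<psi> \<in> \<Psi> j \<Longrightarrow> x \<in> unit_cube \<Longrightarrow> \<bar>\<psi> x\<bar> \<le> D * amp j"
    using psi_bound by blast
  have "\<bar>\<psi> x - \<psi> y\<bar> \<le> (2 * C * D) * 2 ^ k * amp k * dist x y"
    if p: "\<psi> \<in> \<Psi> k" and xy: "x \<in> unit_cube" "y \<in> unit_cube" for k \<psi> x y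
  proof -
    have "\<psi> \<in> span_cube (\<Phi> \<union> (\<Union>k<Suc k. \<Psi> k))" using p by (intro span_cube_member) auto
    then have "\<bar>\<psi> x - \<psi> y\<bar> \<le> C * 2 ^ Suc k * (D * amp k) * dist x y"
      using C(2)[rule_format, of \<psi> "Suc k" "D * amp k" x y] D p xy by (auto simp: less_imp_le)
    then show ?thesis by (simp add: mult_ac)
  qed
  then show ?thesis using C D by (intro exI[of _ "2 * C * D"]) auto
qed

text \<open>Bernstein's inequality at level zero makes the supremum of a coarse function comparable to its
  values on a box of fixed size around a maximum point.\<close>

lemma coarse_sup_le_L2:
  "\<exists>C>0. \<forall>u\<in>span_cube \<Phi>. \<forall>x\<in>unit_cube. (u x)\<^sup>2 \<le> C * inner_cube u u"
proof -
  obtain C where C: "0 < C" "\<forall>j. \<forall>u\<in>span_cube (\<Phi> \<union> (\<Union>k<j. \<Psi> k)). \<forall>M\<ge>0. (\<forall>x\<in>unit_cube. \<bar>u x\<bar> \<le> M) \<longrightarrow>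
     (\<forall>x\<in>unit_cube. \<forall>y\<in>unit_cube. \<bar>u x - u y\<bar> \<le> C * 2 ^ j * M * dist x y)"
    using span_lipschitz by (elim exE conjE) (rule that)
  define d where "d = real CARD('d)"
  have d: "0 < d" by (simp add: d_def)
  \<comment> \<open>A box of half-width \<rho> around \<open>z\<close> has l_1 radius at most
    \<open>d * \<rho>\<close>, so the Lipschitz bound lets \<open>u\<close> lose at most half of its
    maximum there. The cap at 1 guarantees that the box, clipped to the cube, keeps side lengths at
    least \<rho>.\<close>
  define \<rho> where "\<rho> = min 1 (1 / (2 * C * d))"
  have \<rho>: "0 < \<rho>" "\<rho> \<le> 1" "C * (d * \<rho>) \<le> 1 / 2"
  proof -
    have "d * \<rho> \<le> d * (1 / (2 * C * d))" using d by (intro mult_left_mono) (auto simp: \<rho>_def)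
    then have "C * (d * \<rho>) \<le> C * (d * (1 / (2 * C * d)))" by (rule mult_left_mono) (use C(1) in auto)
    then show "C * (d * \<rho>) \<le> 1 / 2" using C(1) d by simp
  qed (use C d in \<open>auto simp: \<rho>_def\<close>)
  have "(u x)\<^sup>2 \<le> (4 / \<rho> ^ CARD('d)) * inner_cube u u" if u: "u \<in> span_cube \<Phi>" and x: "x \<in> unit_cube" for u x
  proof -
    have cont: "continuous_on unit_cube u" using u by (rule span_continuous) auto
    obtain z where z: "z \<in> unit_cube" "\<And>y. y \<in> unit_cube \<Longrightarrow> \<bar>u y\<bar> \<le> \<bar>u z\<bar>"
      using continuous_attains_sup[OF compact_unit_cube _ continuous_on_rabs[OF cont]] x by blast
    define R where "R = cbox (\<chi> i. max 0 (z $ i - \<rho>)) (\<chi> i. min 1 (z $ i + \<rho>) )"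
    have z01: "0 \<le> z $ i" "z $ i \<le> 1" for i using z(1) by (auto simp: unit_cube_def mem_box_cart)
    have side: "\<rho> \<le> min 1 (z $ i + \<rho>) - max 0 (z $ i - \<rho>)" for i
      using z01[of i] \<rho> by (simp add: min_def max_def)
    have R_ne: "R \<noteq> {}"
    proof -
      have "max 0 (z $ i - \<rho>) \<le> min 1 (z $ i + \<rho>)" for i using side[of i] \<rho>(1) by linarith
      then show ?thesis unfolding R_def interval_ne_empty_cart by simp
    qed
    have R_sub: "R \<subseteq> unit_cube" by (auto simp: R_def unit_cube_def mem_box_cart)
    have vol: "\<rho> ^ CARD('d) \<le> measure lborel R"
    proof -
      have "measure lborel R = (\<Prod>i\<in>UNIV. min 1 (z $ i + \<rho>) - max 0 (z $ i - \<rho>))"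
        using content_cbox_cart[OF R_ne[unfolded R_def]] by (simp add: R_def)
      also have "\<dots> \<ge> (\<Prod>i\<in>(UNIV :: 'd set). \<rho>)" using side \<rho>(1) by (intro prod_mono) auto
      finally show ?thesis by simp
    qed
    have big: "\<bar>u z\<bar> / 2 \<le> \<bar>u y\<bar>" if y: "y \<in> R" for y
    proof -
      have "dist z y \<le> (\<Sum>i\<in>UNIV. \<bar>(z - y) $ i\<bar>)" unfolding dist_norm by (rule norm_le_l1_cart)
      also have "\<dots> \<le> (\<Sum>i\<in>(UNIV :: 'd set). \<rho>)"
        using y by (intro sum_mono) (auto simp: R_def mem_box_cart abs_le_iff; smt (verit))
      also have "\<dots> = d * \<rho>" by (simp add: d_def)
      finally have dist: "dist z y \<le> d * \<rho>" .
      have "\<bar>u z - u y\<bar> \<le> C * 2 ^ 0 * \<bar>u z\<bar> * dist z y"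
        using C(2)[rule_format, of u 0 "\<bar>u z\<bar>" z y] u z y R_sub by auto
      also have "\<dots> = \<bar>u z\<bar> * (C * dist z y)" by simp
      also have "\<dots> \<le> \<bar>u z\<bar> * (C * (d * \<rho>))" using dist C(1) by (intro mult_left_mono) auto
      also have "\<dots> \<le> \<bar>u z\<bar> * (1 / 2)" using \<rho>(3) by (intro mult_left_mono) auto
      finally show ?thesis by linarith
    qed
    have i1: "integrable leb_cube (\<lambda>y. u y * u y)"
      using cont by (intro continuous_integrable_leb_cube continuous_intros)
    have "\<rho> ^ CARD('d) * ((u z)\<^sup>2 / 4) \<le> measure lborel R * ((u z)\<^sup>2 / 4)" using vol by (intro mult_right_mono) auto
    also have "\<dots> = (\<integral>y. (u z)\<^sup>2 / 4 * indicator R y \<partial>lborel)" by simp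
    also have "\<dots> \<le> (\<integral>y. indicator unit_cube y *\<^sub>R (u y * u y) \<partial>lborel)"
    proof (rule integral_mono)
      show "integrable lborel (\<lambda>y. (u z)\<^sup>2 / 4 * indicator R y)"
        using emeasure_bounded_finite[OF bounded_cbox] by (intro integrable_mult_right integrable_real_indicator) (auto simp: R_def)
      show "integrable lborel (\<lambda>y. indicator unit_cube y *\<^sub>R (u y * u y))"
        using i1 by (subst (asm) integrable_restrict_space) auto
      fix y :: "real ^ 'd"
      have "(u z)\<^sup>2 / 4 \<le> u y * u y" if "y \<in> R"
        using power_mono[OF big[OF that], of 2] by (simp add: power2_eq_square)
      then show "(u z)\<^sup>2 / 4 * indicator R y \<le> indicator unit_cube y *\<^sub>R (u y * u y)"
        using R_sub by (auto simp: indicator_def)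
    qed
    also have "\<dots> = inner_cube u u" unfolding inner_cube_def by (rule integral_restrict_space[symmetric]) simp
    finally have "(u z)\<^sup>2 \<le> (4 / \<rho> ^ CARD('d)) * inner_cube u u" using \<rho>(1) by (simp add: field_simps)
    moreover have "(u x)\<^sup>2 \<le> (u z)\<^sup>2" using z(2)[OF x] by (simp add: abs_le_square_iff)
    ultimately show ?thesis by linarith
  qed
  then show ?thesis using \<rho>(1) by (intro exI[of _ "4 / \<rho> ^ CARD('d)"]) auto
qed

text \<open>Let \<open>u\<close> be the projection of \<open>F\<close> onto the span of
  \<open>S\<close>, with energy \<open>E\<close>. Then the inner product of \<open>F\<close> and
  \<open>u\<close> is \<open>E\<close>, while the Lipschitz constant of \<open>u\<close> is of order
  sqrt E, so antiperiodicity gives E of order at most (sqrt E) / N. Treating the projection as a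
  whole makes the bound independent of the number of functions in \<open>S\<close>.\<close>

lemma coarse_energy_small:
  "\<exists>a>0. \<forall>i N F S. oscillating i N F \<longrightarrow> finite S \<longrightarrow> S \<subseteq> \<Phi> \<longrightarrow> energy F S \<le> a / (real N)\<^sup>2"
proof -
  obtain C where C: "0 < C" "\<forall>j. \<forall>u\<in>span_cube (\<Phi> \<union> (\<Union>k<j. \<Psi> k)). \<forall>M\<ge>0. (\<forall>x\<in>unit_cube. \<bar>u x\<bar> \<le> M) \<longrightarrow>
     (\<forall>x\<in>unit_cube. \<forall>y\<in>unit_cube. \<bar>u x - u y\<bar> \<le> C * 2 ^ j * M * dist x y)"
    using span_lipschitz by (elim exE conjE) (rule that)
  obtain D where D: "0 < D" "\<And>u x. u \<in> span_cube \<Phi> \<Longrightarrow> x \<in> unit_cube \<Longrightarrow> (u x)\<^sup>2 \<le> D * inner_cube u u"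
    using coarse_sup_le_L2 by blast
  have "energy F S \<le> (4 * C\<^sup>2 * D) / (real N)\<^sup>2"
    if osc: "oscillating i N F" and S: "finite S" "S \<subseteq> \<Phi>" for i N F S
  proof -
    define E where "E = energy F S"
    have E0: "0 \<le> E" by (simp add: E_def sum_nonneg)
    define u where "u x = (\<Sum>\<phi>\<in>S. inner_cube F \<phi> * \<phi> x)" for x
    have cS: "continuous_on unit_cube \<phi>" if "\<phi> \<in> S" for \<phi> using that S(2) by (intro basis_continuous) auto
    have cu: "continuous_on unit_cube u" unfolding u_def using cS by (intro continuous_intros) auto
    have cF: "continuous_on unit_cube F" using osc continuous_on_subset by (auto simp: oscillating_def)
    have us: "u \<in> span_cube \<Phi>" unfolding span_cube_def using S by (intro CollectI exI[of _ S]) (auto simp: u_def)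
    have uF: "inner_cube u F = E"
      unfolding u_def using cS cF by (subst inner_cube_sum_left) (auto simp: E_def power2_eq_square inner_cube_commute[of _ F])
    have u\<phi>: "inner_cube \<phi> u = inner_cube F \<phi>" if \<phi>: "\<phi> \<in> S" for \<phi>
    proof -
      have "inner_cube u \<phi> = (\<Sum>\<eta>\<in>S. inner_cube F \<eta> * inner_cube \<eta> \<phi>)"
        unfolding u_def using cS \<phi> by (intro inner_cube_sum_left) auto
      also have "\<dots> = (\<Sum>\<eta>\<in>S. if \<eta> = \<phi> then inner_cube F \<eta> else 0)"
        using S(2) \<phi> by (intro sum.cong refl) (subst basis_inner; auto)
      also have "\<dots> = inner_cube F \<phi>" using S(1) \<phi> by simp
      finally show ?thesis by (simp add: inner_cube_commute)
    qed
    have "inner_cube u u = (\<Sum>\<phi>\<in>S. inner_cube F \<phi> * inner_cube \<phi> u)"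
      unfolding u_def[abs_def] using cS cu[unfolded u_def[abs_def]] by (intro inner_cube_sum_left) auto
    then have uu: "inner_cube u u = E" using u\<phi> by (simp add: E_def power2_eq_square)
    define M where "M = sqrt (D * E)"
    have M: "0 \<le> M" using D(1) E0 by (simp add: M_def)
    have "\<bar>u x\<bar> \<le> M" if "x \<in> unit_cube" for x
      using D(2)[OF us that] uu by (simp add: M_def real_le_rsqrt)
    then have lip: "\<bar>u x - u y\<bar> \<le> (C * M) * dist x y" if "x \<in> unit_cube" "y \<in> unit_cube" for x y
      using C(2)[rule_format, of u 0 M x y] us M that by auto
    have "\<bar>inner_cube F u\<bar> \<le> 2 * (C * M) * measure lborel (cbox 0 (1 :: real ^ 'd)) / real N"
      using osc cu lip C(1) M
      by (intro antiperiodic_integral_bound[of N F i u]) (auto simp: oscillating_def unit_cube_def)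
    also have "measure lborel (cbox 0 (1 :: real ^ 'd)) = 1"
      using emeasure_unit_cube by (simp add: unit_cube_def measure_def)
    finally have "E \<le> 2 * C * M / real N" using uF E0 by (simp add: inner_cube_commute)
    then have "E\<^sup>2 \<le> (2 * C * M / real N)\<^sup>2" using E0 by (rule power_mono)
    also have "\<dots> = (4 * C\<^sup>2 * D / (real N)\<^sup>2) * E"
      using D(1) E0 by (simp add: M_def power_divide power_mult_distrib)
    finally have "E * E \<le> (4 * C\<^sup>2 * D / (real N)\<^sup>2) * E" by (simp add: power2_eq_square)
    moreover have "0 \<le> 4 * C\<^sup>2 * D / (real N)\<^sup>2" using D(1) by simp
    ultimately show ?thesis unfolding E_def[symmetric]
      using E0 mult_right_le_imp_le[of E E "4 * C\<^sup>2 * D / (real N)\<^sup>2"] by (cases "E = 0") auto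
  qed
  then show ?thesis using C(1) D(1) by (intro exI[of _ "4 * C\<^sup>2 * D"]) auto
qed

text \<open>Completeness gives a finite combination \<open>u\<close> within distance 1/2 of
  \<open>F\<close>. The best coefficients are the inner products, so the energy of \<open>F\<close>
  missed by \<open>S\<close> is at most the squared distance, below 1/4, out of a total of at least
  1/2.\<close>

lemma energy_captured:
  assumes osc: "oscillating i N F"
  shows "\<exists>S. finite S \<and> S \<subseteq> all_wavelets \<and> 1 / 4 \<le> energy F S"
proof -
  have cF: "continuous_on unit_cube F" using osc continuous_on_subset by (auto simp: oscillating_def)
  have pw2: "ennreal_powr (ennreal \<bar>y\<bar>) 2 = ennreal (y\<^sup>2)" for y :: real
    by (simp add: powr_numeral)
  have L2: "Lnorm_cube 2 f = ennreal (sqrt (inner_cube f f))" if "continuous_on unit_cube f" for f :: "real ^ 'd \<Rightarrow> real"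
  proof -
    have "(\<integral>\<^sup>+x. ennreal ((f x)\<^sup>2) \<partial>leb_cube) = ennreal (\<integral>x. (f x)\<^sup>2 \<partial>leb_cube)"
      using that by (intro nn_integral_eq_integral continuous_integrable_leb_cube continuous_intros) auto
    then show ?thesis
      using Lnorm_ennreal[of 2 leb_cube "\<lambda>x. ennreal \<bar>f x\<bar>"]
      by (simp add: Lnorm_cube_def pw2 inner_cube_def power2_eq_square powr_half_sqrt)
  qed
  have "F \<in> Lspace_cube 2"
    using continuous_on_cube_measurable[OF cF] L2[OF cF] by (simp add: Lspace_cube_def)
  then have "\<exists>u\<in>span_cube all_wavelets. Lnorm_cube 2 (\<lambda>x. F x - u x) < ennreal (1 / 2)"
    using basis unfolding orthonormal_basis_cube_def by (metis half_gt_zero_iff zero_less_one)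
  then obtain u where u: "u \<in> span_cube all_wavelets" "Lnorm_cube 2 (\<lambda>x. F x - u x) < ennreal (1 / 2)" by blast
  obtain S c where S: "finite S" "S \<subseteq> all_wavelets" and uc: "\<And>x. x \<in> unit_cube \<Longrightarrow> u x = (\<Sum>\<phi>\<in>S. c \<phi> * \<phi> x)"
    using u(1) unfolding span_cube_def by blast
  have cS: "continuous_on unit_cube \<phi>" if "\<phi> \<in> S" for \<phi> using that S(2) by (intro basis_continuous) auto
  have cu: "continuous_on unit_cube u" using u(1) by (rule span_continuous) auto
  have "ennreal (sqrt (inner_cube (\<lambda>x. F x - u x) (\<lambda>x. F x - u x))) < ennreal (1 / 2)"
    using u(2) cF cu by (subst (asm) L2) (auto intro!: continuous_intros)
  then have "sqrt (inner_cube (\<lambda>x. F x - u x) (\<lambda>x. F x - u x)) < 1 / 2" by (subst (asm) ennreal_less_iff) (auto simp: inner_cube_self_nonneg)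
  then have dist: "inner_cube (\<lambda>x. F x - u x) (\<lambda>x. F x - u x) < 1 / 4"
    using real_less_lsqrt real_sqrt_less_iff[of _ "1/4"] by (simp add: real_sqrt_divide)
  have u_left: "inner_cube u g = (\<Sum>\<phi>\<in>S. c \<phi> * inner_cube \<phi> g)" if "continuous_on unit_cube g" for g
  proof -
    have "inner_cube u g = inner_cube (\<lambda>x. \<Sum>\<phi>\<in>S. c \<phi> * \<phi> x) g" using uc by (rule inner_cube_cong_left)
    also have "\<dots> = (\<Sum>\<phi>\<in>S. c \<phi> * inner_cube \<phi> g)" using cS that by (rule inner_cube_sum_left)
    finally show ?thesis .
  qed
  have u\<phi>: "inner_cube \<phi> u = c \<phi>" if \<phi>: "\<phi> \<in> S" for \<phi>
  proof -
    have "inner_cube u \<phi> = (\<Sum>\<eta>\<in>S. if \<eta> = \<phi> then c \<eta> else 0)"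
      unfolding u_left[OF cS[OF \<phi>]]
      using S(2) \<phi> by (intro sum.cong refl) (subst basis_inner; auto)
    then show ?thesis using S(1) \<phi> by (simp add: inner_cube_commute)
  qed
  have "inner_cube (\<lambda>x. F x - u x) (\<lambda>x. F x - u x)
      = (\<integral>x. F x * F x - 2 * (u x * F x) + u x * u x \<partial>leb_cube)"
    unfolding inner_cube_def by (simp add: algebra_simps)
  also have "\<dots> = inner_cube F F - 2 * inner_cube u F + inner_cube u u"
  proof -
    have "integrable leb_cube (\<lambda>x. F x * F x)" "integrable leb_cube (\<lambda>x. u x * F x)" "integrable leb_cube (\<lambda>x. u x * u x)"
      using cF cu by (auto intro!: continuous_integrable_leb_cube continuous_intros)
    then show ?thesis unfolding inner_cube_def by simp
  qed
  also have "inner_cube u F = (\<Sum>\<phi>\<in>S. c \<phi> * inner_cube F \<phi>)"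
    unfolding u_left[OF cF] by (intro sum.cong refl) (simp add: inner_cube_commute)
  also have "inner_cube u u = (\<Sum>\<phi>\<in>S. (c \<phi>)\<^sup>2)"
    by (simp add: u_left[OF cu] u\<phi> power2_eq_square)
  also have "inner_cube F F - 2 * (\<Sum>\<phi>\<in>S. c \<phi> * inner_cube F \<phi>) + (\<Sum>\<phi>\<in>S. (c \<phi>)\<^sup>2)
      = inner_cube F F + (\<Sum>\<phi>\<in>S. (c \<phi>)\<^sup>2 - 2 * (c \<phi> * inner_cube F \<phi>))"
    by (simp add: sum_subtractf sum_distrib_left)
  also have "\<dots> \<ge> inner_cube F F + (\<Sum>\<phi>\<in>S. - (inner_cube F \<phi>)\<^sup>2)"
  proof (intro add_left_mono sum_mono)
    fix \<phi>
    have "0 \<le> (c \<phi> - inner_cube F \<phi>)\<^sup>2" by simp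
    then show "- (inner_cube F \<phi>)\<^sup>2 \<le> (c \<phi>)\<^sup>2 - 2 * (c \<phi> * inner_cube F \<phi>)"
      by (simp add: power2_eq_square algebra_simps)
  qed
  finally have "inner_cube F F - energy F S \<le> inner_cube (\<lambda>x. F x - u x) (\<lambda>x. F x - u x)"
    by (simp add: sum_negf)
  moreover have "1 / 2 \<le> inner_cube F F" using osc by (simp add: oscillating_def)
  ultimately have "1 / 4 \<le> energy F S" using dist by linarith
  then show ?thesis using S by blast
qed

end

section \<open>Energy of an oscillation across the levels\<close>

lemma sum_power4_le: "(\<Sum>k<n. (4::real) ^ k) \<le> 4 ^ n"
proof (induction n)
  case (Suc n)
  have "0 \<le> (4::real) ^ n" by simp
  then have "4 ^ n + 4 ^ n \<le> (4::real) ^ Suc n" by simp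
  then show ?case using Suc unfolding sum.lessThan_Suc by linarith
qed simp

lemma sum_inverse_power4_le: "(\<Sum>k\<in>{m..<n}. 1 / (4::real) ^ k) \<le> 2 / 4 ^ m"
proof (cases "m \<le> n")
  case True
  have "(\<Sum>k\<in>{m..<n}. 1 / (4::real) ^ k) + (4 / 3) / 4 ^ n = (4 / 3) / 4 ^ m"
    using True by (induction rule: dec_induct) auto
  moreover have "0 \<le> (4 / 3) / (4::real) ^ n" "(4 / 3) / (4::real) ^ m \<le> 2 / 4 ^ m"
    by (simp, rule divide_right_mono) auto
  ultimately show ?thesis by linarith
qed simp

context regular_wavelet_system
begin

lemma amp_squared_inverse: "(c / amp k)\<^sup>2 = c\<^sup>2 / 2 ^ (CARD('d) * k)"
  by (simp add: power_divide power2_eq_square amp_mult_amp)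

lemma wavelet_coefficient_trivial:
  "\<exists>a>0. \<forall>i N F k. oscillating i N F \<longrightarrow> (\<forall>\<psi>\<in>\<Psi> k. \<bar>inner_cube F \<psi>\<bar> \<le> a / amp k)"
proof -
  obtain E where E: "0 < E" "\<And>k \<psi>. \<psi> \<in> \<Psi> k \<Longrightarrow> (\<integral>x. \<bar>\<psi> x\<bar> \<partial>leb_cube) \<le> E / amp k"
    using psi_L1_bound by blast
  have "\<bar>inner_cube F \<psi>\<bar> \<le> E / amp k" if osc: "oscillating i N F" and p: "\<psi> \<in> \<Psi> k" for i N F k \<psi>
  proof -
    have cF: "continuous_on unit_cube F" using osc continuous_on_subset by (auto simp: oscillating_def)
    note cp = psi_continuous[OF p]
    have "\<bar>inner_cube F \<psi>\<bar> \<le> (\<integral>x. \<bar>F x * \<psi> x\<bar> \<partial>leb_cube)"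
      unfolding inner_cube_def by (rule integral_abs_bound)
    also have "\<dots> \<le> (\<integral>x. \<bar>\<psi> x\<bar> \<partial>leb_cube)"
    proof (rule integral_mono)
      show "integrable leb_cube (\<lambda>x. \<bar>F x * \<psi> x\<bar>)" "integrable leb_cube (\<lambda>x. \<bar>\<psi> x\<bar>)"
        using cF cp by (auto intro!: continuous_integrable_leb_cube continuous_intros)
      have "\<bar>F x\<bar> \<le> 1" for x using osc by (simp add: oscillating_def)
      then show "\<bar>F x * \<psi> x\<bar> \<le> \<bar>\<psi> x\<bar>" for x
        using mult_right_mono[of "\<bar>F x\<bar>" 1 "\<bar>\<psi> x\<bar>"] by (simp add: abs_mult)
    qed
    also have "\<dots> \<le> E / amp k" by (rule E(2)[OF p])
    finally show ?thesis .
  qed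
  then show ?thesis using E(1) by blast
qed

text \<open>Mean zero allows the subtraction of \<open>F z\<close> for a point \<open>z\<close> of
  the support. On the support \<open>F\<close> then deviates by at most its Lipschitz constant times
  the diameter, of order N / 2^k, and the L_1 norm of \<psi> supplies the rest.\<close>

lemma wavelet_coefficient_fine:
  "\<exists>a>0. \<forall>i N F k. oscillating i N F \<longrightarrow> (\<forall>\<psi>\<in>\<Psi> k - \<Phi>. \<bar>inner_cube F \<psi>\<bar> \<le> a * (real N / 2 ^ k) / amp k)"
proof -
  obtain E where E: "0 < E" "\<And>k \<psi>. \<psi> \<in> \<Psi> k \<Longrightarrow> (\<integral>x. \<bar>\<psi> x\<bar> \<partial>leb_cube) \<le> E / amp k"
    using psi_L1_bound by blast
  obtain D where D: "0 < D" "\<And>k \<psi>. \<psi> \<in> \<Psi> k \<Longrightarrow>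
      \<exists>a b. (\<forall>x\<in>unit_cube. \<psi> x \<noteq> 0 \<longrightarrow> x \<in> cbox a b) \<and> diameter (cbox a b) \<le> D / 2 ^ k"
    using basis_support by blast
  have "\<bar>inner_cube F \<psi>\<bar> \<le> (4 * D * E) * (real N / 2 ^ k) / amp k"
    if osc: "oscillating i N F" and p: "\<psi> \<in> \<Psi> k" "\<psi> \<notin> \<Phi>" for i N F k \<psi>
  proof (cases "\<exists>z\<in>unit_cube. \<psi> z \<noteq> 0")
    case True
    then obtain z where z: "z \<in> unit_cube" "\<psi> z \<noteq> 0" by blast
    obtain a b where ab: "\<forall>x\<in>unit_cube. \<psi> x \<noteq> 0 \<longrightarrow> x \<in> cbox a b" "diameter (cbox a b) \<le> D / 2 ^ k"
      using D(2)[OF p(1)] by blast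
    have cF: "continuous_on unit_cube F" using osc continuous_on_subset by (auto simp: oscillating_def)
    have lip: "\<bar>F x - F y\<bar> \<le> 4 * real N * dist x y" for x y using osc by (simp add: oscillating_def)
    note cp = psi_continuous[OF p(1)]
    have "(\<integral>x. (F x - F z) * \<psi> x \<partial>leb_cube) = inner_cube F \<psi> - F z * (\<integral>x. \<psi> x \<partial>leb_cube)"
    proof -
      have "integrable leb_cube (\<lambda>x. F x * \<psi> x)" "integrable leb_cube \<psi>"
        using cF cp by (auto intro!: continuous_integrable_leb_cube continuous_intros)
      then show ?thesis by (simp add: inner_cube_def left_diff_distrib)
    qed
    then have "\<bar>inner_cube F \<psi>\<bar> = \<bar>\<integral>x. (F x - F z) * \<psi> x \<partial>leb_cube\<bar>" using integral_psi_zero[OF p] by simp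
    also have "\<dots> \<le> (\<integral>x. \<bar>(F x - F z) * \<psi> x\<bar> \<partial>leb_cube)" by (rule integral_abs_bound)
    also have "\<dots> \<le> (\<integral>x. (4 * real N * (D / 2 ^ k)) * \<bar>\<psi> x\<bar> \<partial>leb_cube)"
    proof (rule integral_mono_AE)
      show "integrable leb_cube (\<lambda>x. \<bar>(F x - F z) * \<psi> x\<bar>)" "integrable leb_cube (\<lambda>x. (4 * real N * (D / 2 ^ k)) * \<bar>\<psi> x\<bar>)"
        using cF cp by (auto intro!: continuous_integrable_leb_cube continuous_intros)
      show "AE x in leb_cube. \<bar>(F x - F z) * \<psi> x\<bar> \<le> (4 * real N * (D / 2 ^ k)) * \<bar>\<psi> x\<bar>"
      proof (rule AE_leb_cubeI)
        fix x :: "real ^ 'd" assume x: "x \<in> unit_cube"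
        show "\<bar>(F x - F z) * \<psi> x\<bar> \<le> (4 * real N * (D / 2 ^ k)) * \<bar>\<psi> x\<bar>"
        proof (cases "\<psi> x = 0")
          case False
          then have "dist x z \<le> diameter (cbox a b)"
            using ab(1) x z by (intro diameter_bounded_bound) auto
          then have "4 * real N * dist x z \<le> 4 * real N * (D / 2 ^ k)" using ab(2) by (intro mult_left_mono) auto
          then have "\<bar>F x - F z\<bar> \<le> 4 * real N * (D / 2 ^ k)" using lip[of x z] by linarith
          then show ?thesis unfolding abs_mult by (rule mult_right_mono) simp
        qed simp
      qed
    qed
    also have "\<dots> = (4 * real N * (D / 2 ^ k)) * (\<integral>x. \<bar>\<psi> x\<bar> \<partial>leb_cube)" by simp
    also have "\<dots> \<le> (4 * real N * (D / 2 ^ k)) * (E / amp k)" using E(2)[OF p(1)] D(1) by (intro mult_left_mono) auto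
    finally show ?thesis by (simp add: mult_ac)
  next
    case False
    then have "inner_cube \<psi> F = inner_cube (\<lambda>x. 0) F" by (intro inner_cube_cong_left) auto
    then have "inner_cube F \<psi> = 0" by (simp add: inner_cube_commute[of F]) (simp add: inner_cube_def)
    then show ?thesis using D(1) E(1) amp_nonneg[of k] by simp
  qed
  then show ?thesis using D(1) E(1) by (intro exI[of _ "4 * D * E"]) auto
qed

text \<open>Antiperiodicity replaces \<psi> by its increments over 1 / N, of order 2^k amp k / N, on
  a box whose volume is of order 1 / (amp k)^2.\<close>

lemma wavelet_coefficient_coarse:
  "\<exists>a>0. \<forall>i N F k. oscillating i N F \<longrightarrow> (\<forall>\<psi>\<in>\<Psi> k. \<bar>inner_cube F \<psi>\<bar> \<le> a * (2 ^ k / real N) / amp k)"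
proof -
  obtain C where C: "0 < C" "\<And>k \<psi> x y. \<psi> \<in> \<Psi> k \<Longrightarrow> x \<in> unit_cube \<Longrightarrow> y \<in> unit_cube \<Longrightarrow>
      \<bar>\<psi> x - \<psi> y\<bar> \<le> C * 2 ^ k * amp k * dist x y"
    using psi_lipschitz by blast
  obtain D where D: "0 < D" "\<And>k \<psi>. \<psi> \<in> \<Psi> k \<Longrightarrow>
      \<exists>a b. (\<forall>x\<in>unit_cube. \<psi> x \<noteq> 0 \<longrightarrow> x \<in> cbox a b) \<and> diameter (cbox a b) \<le> D / 2 ^ k"
    using basis_support by blast
  have "\<bar>inner_cube F \<psi>\<bar> \<le> (2 * C * D ^ CARD('d)) * (2 ^ k / real N) / amp k"
    if osc: "oscillating i N F" and p: "\<psi> \<in> \<Psi> k" for i N F k \<psi>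
  proof -
    obtain a b where ab: "\<forall>x\<in>unit_cube. \<psi> x \<noteq> 0 \<longrightarrow> x \<in> cbox a b" "diameter (cbox a b) \<le> D / 2 ^ k"
      using D(2)[OF p] by blast
    have "\<bar>inner_cube F \<psi>\<bar> \<le> 2 * (C * 2 ^ k * amp k) * measure lborel (cbox a b) / real N"
      using osc psi_continuous[OF p] C p ab(1)
      by (intro antiperiodic_integral_bound[of N F i \<psi>]) (auto simp: oscillating_def)
    also have "measure lborel (cbox a b) \<le> (D / 2 ^ k) ^ CARD('d)"
    proof -
      have "diameter (cbox a b) ^ CARD('d) \<le> (D / 2 ^ k) ^ CARD('d)"
        using ab(2) by (intro power_mono diameter_ge_0 bounded_cbox)
      then show ?thesis using measure_cbox_le_diameter_power[of a b] by linarith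
    qed
    also have "(D / 2 ^ k) ^ CARD('d) = D ^ CARD('d) / (amp k * amp k)"
      by (simp add: power_divide amp_mult_amp power_mult mult.commute)
    finally have "\<bar>inner_cube F \<psi>\<bar> \<le> 2 * (C * 2 ^ k * amp k) * (D ^ CARD('d) / (amp k * amp k)) / real N"
      using C(1) by (simp add: divide_right_mono mult_left_mono)
    also have "\<dots> = (2 * C * D ^ CARD('d)) * (2 ^ k / real N) / amp k"
    proof -
      have "amp k \<noteq> 0" using amp_pos[of k] by linarith
      then show ?thesis by (simp add: field_simps)
    qed
    finally show ?thesis .
  qed
  then show ?thesis using C(1) D(1) by (intro exI[of _ "2 * C * D ^ CARD('d)"]) auto
qed

text \<open>The coefficient bounds are squared and summed. The first two estimates insert the upper
  bound on the number of wavelets and decay away from 2^k = N; the third keeps that number, so that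
  energy on a level can be converted into a count.\<close>

lemma level_energy:
  "\<exists>a>0. \<forall>i N F k. oscillating i N F \<longrightarrow>
     energy F (\<Psi> k - \<Phi>) \<le> a * (2 ^ k / real N)\<^sup>2 \<and>
     energy F (\<Psi> k - \<Phi>) \<le> a * (real N / 2 ^ k)\<^sup>2 \<and>
     energy F (\<Psi> k - \<Phi>) \<le> a * (real (card (\<Psi> k - \<Phi>)) / 2 ^ (CARD('d) * k))"
proof -
  obtain a1 where a1: "0 < a1" "\<And>i N F k \<psi>. oscillating i N F \<Longrightarrow> \<psi> \<in> \<Psi> k \<Longrightarrow> \<bar>inner_cube F \<psi>\<bar> \<le> a1 / amp k"
    using wavelet_coefficient_trivial by blast
  obtain a2 where a2: "0 < a2" "\<And>i N F k \<psi>. oscillating i N F \<Longrightarrow> \<psi> \<in> \<Psi> k - \<Phi> \<Longrightarrow> \<bar>inner_cube F \<psi>\<bar> \<le> a2 * (real N / 2 ^ k) / amp k"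
    using wavelet_coefficient_fine by blast
  obtain a3 where a3: "0 < a3" "\<And>i N F k \<psi>. oscillating i N F \<Longrightarrow> \<psi> \<in> \<Psi> k \<Longrightarrow> \<bar>inner_cube F \<psi>\<bar> \<le> a3 * (2 ^ k / real N) / amp k"
    using wavelet_coefficient_coarse by blast
  obtain C where C: "0 < C" "\<And>k. real (card (\<Psi> k)) \<le> C * 2 ^ (CARD('d) * k)" using card_level by blast
  define a where "a = a1\<^sup>2 + C * a2\<^sup>2 + C * a3\<^sup>2"
  have pos: "0 < a1\<^sup>2" "0 < C * a2\<^sup>2" "0 < C * a3\<^sup>2" using a1 a2 a3 C(1) by auto
  have sum_le: "energy F (\<Psi> k - \<Phi>) \<le> t\<^sup>2 * (real (card (\<Psi> k - \<Phi>)) / 2 ^ (CARD('d) * k))"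
    if "\<And>\<psi>. \<psi> \<in> \<Psi> k - \<Phi> \<Longrightarrow> \<bar>inner_cube F \<psi>\<bar> \<le> t / amp k" for F k t
  proof -
    have "energy F (\<Psi> k - \<Phi>) \<le> (\<Sum>\<psi>\<in>\<Psi> k - \<Phi>. t\<^sup>2 / 2 ^ (CARD('d) * k))"
    proof (rule sum_mono)
      fix \<psi> assume "\<psi> \<in> \<Psi> k - \<Phi>"
      then have "\<bar>inner_cube F \<psi>\<bar>\<^sup>2 \<le> (t / amp k)\<^sup>2" using that by (intro power_mono) auto
      then show "(inner_cube F \<psi>)\<^sup>2 \<le> t\<^sup>2 / 2 ^ (CARD('d) * k)" by (simp only: amp_squared_inverse power2_abs)
    qed
    then show ?thesis by (simp add: mult.commute)
  qed
  have card_le: "real (card (\<Psi> k - \<Phi>)) / 2 ^ (CARD('d) * k) \<le> C" for k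
  proof -
    have "card (\<Psi> k - \<Phi>) \<le> card (\<Psi> k)" using finite_level by (intro card_mono) auto
    then have "real (card (\<Psi> k - \<Phi>)) \<le> C * 2 ^ (CARD('d) * k)" using C(2)[of k] by linarith
    then show ?thesis by (simp add: pos_divide_le_eq)
  qed
  have "energy F (\<Psi> k - \<Phi>) \<le> a * (2 ^ k / real N)\<^sup>2 \<and>
     energy F (\<Psi> k - \<Phi>) \<le> a * (real N / 2 ^ k)\<^sup>2 \<and>
     energy F (\<Psi> k - \<Phi>) \<le> a * (real (card (\<Psi> k - \<Phi>)) / 2 ^ (CARD('d) * k))"
    if osc: "oscillating i N F" for i N F k
  proof (intro conjI)
    have "energy F (\<Psi> k - \<Phi>) \<le> (a3 * (2 ^ k / real N))\<^sup>2 * (real (card (\<Psi> k - \<Phi>)) / 2 ^ (CARD('d) * k))"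
      using a3(2)[OF osc] by (intro sum_le) auto
    also have "\<dots> \<le> (a3 * (2 ^ k / real N))\<^sup>2 * C" by (intro mult_left_mono card_le) auto
    also have "\<dots> = (C * a3\<^sup>2) * (2 ^ k / real N)\<^sup>2" by (simp only: power_mult_distrib mult_ac)
    also have "\<dots> \<le> a * (2 ^ k / real N)\<^sup>2" using pos by (intro mult_right_mono) (auto simp: a_def)
    finally show "energy F (\<Psi> k - \<Phi>) \<le> a * (2 ^ k / real N)\<^sup>2" .
    have "energy F (\<Psi> k - \<Phi>) \<le> (a2 * (real N / 2 ^ k))\<^sup>2 * (real (card (\<Psi> k - \<Phi>)) / 2 ^ (CARD('d) * k))"
      using a2(2)[OF osc] by (intro sum_le) auto
    also have "\<dots> \<le> (a2 * (real N / 2 ^ k))\<^sup>2 * C" by (intro mult_left_mono card_le) auto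
    also have "\<dots> = (C * a2\<^sup>2) * (real N / 2 ^ k)\<^sup>2" by (simp only: power_mult_distrib mult_ac)
    also have "\<dots> \<le> a * (real N / 2 ^ k)\<^sup>2" using pos by (intro mult_right_mono) (auto simp: a_def)
    finally show "energy F (\<Psi> k - \<Phi>) \<le> a * (real N / 2 ^ k)\<^sup>2" .
    have "energy F (\<Psi> k - \<Phi>) \<le> a1\<^sup>2 * (real (card (\<Psi> k - \<Phi>)) / 2 ^ (CARD('d) * k))"
      using a1(2)[OF osc] by (intro sum_le) auto
    also have "\<dots> \<le> a * (real (card (\<Psi> k - \<Phi>)) / 2 ^ (CARD('d) * k))" using pos by (intro mult_right_mono) (auto simp: a_def)
    finally show "energy F (\<Psi> k - \<Phi>) \<le> a * (real (card (\<Psi> k - \<Phi>)) / 2 ^ (CARD('d) * k))" .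
  qed
  moreover have "0 < a" using pos unfolding a_def by linarith
  ultimately show ?thesis by blast
qed

text \<open>The axioms allow individual levels to be empty, so wavelets are only found within a window of
  bounded width: levels far from \<open>J\<close> carry little of the energy of an oscillation at scale \<open>2 ^ J\<close>.\<close>

lemma many_wavelets:
  "\<exists>B c. 0 < c \<and> (\<forall>J\<ge>B. \<exists>k. J \<le> k + B \<and> k < J + B \<and> c * 2 ^ (CARD('d) * k) \<le> real (card (\<Psi> k - \<Phi>)))"
proof -
  obtain a1 where a1: "0 < a1" "\<And>i N F S. oscillating i N F \<Longrightarrow> finite S \<Longrightarrow> S \<subseteq> \<Phi> \<Longrightarrow> energy F S \<le> a1 / (real N)\<^sup>2"
    using coarse_energy_small by blast
  obtain a2 where a2: "0 < a2" and le: "\<forall>i N F k. oscillating i N F \<longrightarrow>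
     energy F (\<Psi> k - \<Phi>) \<le> a2 * (2 ^ k / real N)\<^sup>2 \<and>
     energy F (\<Psi> k - \<Phi>) \<le> a2 * (real N / 2 ^ k)\<^sup>2 \<and>
     energy F (\<Psi> k - \<Phi>) \<le> a2 * (real (card (\<Psi> k - \<Phi>)) / 2 ^ (CARD('d) * k))"
    using level_energy by (elim exE conjE) (rule that)
  define a where "a = a1 + a2"
  have a: "0 < a" using a1 a2 by (simp add: a_def)
  \<comment> \<open>With \<open>a / 4 ^ B\<close> below 1/32, the lower tail, the upper tail and the
    part in \<Phi> together stay below 4/32. Adding 1/16 from the window gives 3/16, less than the
    captured energy 1/4.\<close>
  obtain B0 :: nat where "32 * a < 4 ^ B0" using real_arch_pow[of 4 "32 * a"] by auto
  moreover have "(4::real) ^ B0 \<le> 4 ^ Suc B0" by (rule power_increasing) auto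
  ultimately have B0: "32 * a < 4 ^ Suc B0" by linarith
  define B where "B = Suc B0"
  have B: "32 * a < 4 ^ B" "1 \<le> B" using B0 by (auto simp: B_def)
  have aB: "a / 4 ^ B < 1 / 32" using B(1) by (simp add: field_simps)
  \<comment> \<open>The window has \<open>2 * B\<close> levels, each of energy at most
    \<open>a * c\<close> if it is sparsely populated; this value makes their total 1/16.\<close>
  define c where "c = 1 / (32 * a * real B)"
  have c: "0 < c" using a B by (simp add: c_def)
  have "\<exists>k. J \<le> k + B \<and> k < J + B \<and> c * 2 ^ (CARD('d) * k) \<le> real (card (\<Psi> k - \<Phi>))" if J: "B \<le> J" for J
  proof (rule ccontr)
    assume "\<not> ?thesis"
    then have few: "real (card (\<Psi> k - \<Phi>)) < c * 2 ^ (CARD('d) * k)" if "J \<le> k + B" "k < J + B" for k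
      using that by (meson not_le)
    define N :: nat where "N = 2 ^ J"
    \<comment> \<open>The frequency is even because \<open>J \<ge> B \<ge> 1\<close>.\<close>
    have N: "0 < N" "even N" using J B(2) by (auto simp: N_def)
    have k4: "((2::real) ^ k)\<^sup>2 = 4 ^ k" for k by (induction k) (auto simp: power_mult_distrib)
    have N4: "(real N)\<^sup>2 = 4 ^ J" by (simp add: N_def k4)
    obtain F :: "real ^ 'd \<Rightarrow> real" and i where osc: "oscillating i N F"
      using oscillating_exists[OF N, of undefined] by blast
    define e where "e k = energy F (\<Psi> k - \<Phi>)" for k
    have e1: "e k \<le> a / 4 ^ J * 4 ^ k" for k
    proof -
      have "e k \<le> a2 * (2 ^ k / real N)\<^sup>2" using le osc unfolding e_def by blast
      also have "\<dots> \<le> a * (2 ^ k / real N)\<^sup>2" using a1 by (intro mult_right_mono) (auto simp: a_def)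
      finally show ?thesis by (simp add: power_divide N4 k4)
    qed
    have e2: "e k \<le> a * 4 ^ J * (1 / 4 ^ k)" for k
    proof -
      have "e k \<le> a2 * (real N / 2 ^ k)\<^sup>2" using le osc unfolding e_def by blast
      also have "\<dots> \<le> a * (real N / 2 ^ k)\<^sup>2" using a1 by (intro mult_right_mono) (auto simp: a_def)
      finally show ?thesis by (simp add: power_divide N4 k4)
    qed
    have e3: "e k \<le> a * c" if "J \<le> k + B" "k < J + B" for k
    proof -
      have "e k \<le> a2 * (real (card (\<Psi> k - \<Phi>)) / 2 ^ (CARD('d) * k))" using le osc unfolding e_def by blast
      also have "\<dots> \<le> a2 * c" using few[OF that] a2 by (intro mult_left_mono) (auto simp: pos_divide_le_eq)
      also have "\<dots> \<le> a * c" using a1 c by (intro mult_right_mono) (auto simp: a_def)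
      finally show ?thesis .
    qed
    obtain S where S: "finite S" "S \<subseteq> all_wavelets" "1 / 4 \<le> energy F S"
      using energy_captured[OF osc] by blast
    have "\<forall>\<psi>\<in>S - \<Phi>. \<exists>k. \<psi> \<in> \<Psi> k" using S(2) by blast
    \<comment> \<open>Levels may share wavelets, so one level is chosen for each wavelet;
      \<open>K\<close> below exceeds all chosen levels and the window.\<close>
    then obtain lv where lv: "\<And>\<psi>. \<psi> \<in> S - \<Phi> \<Longrightarrow> \<psi> \<in> \<Psi> (lv \<psi>)" by metis
    define K where "K = Suc (Max (insert (J + B) (lv ` (S - \<Phi>))))"
    have lvK: "lv \<psi> < K" if "\<psi> \<in> S - \<Phi>" for \<psi>
      unfolding K_def less_Suc_eq_le using that S(1) by (intro Max_ge) auto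
    have JBK: "J + B \<le> K" unfolding K_def using S(1) by (intro le_SucI Max_ge) auto
    have "energy F (S - \<Phi>) = (\<Sum>k<K. \<Sum>\<psi>\<in>{\<psi> \<in> S - \<Phi>. lv \<psi> = k}. (inner_cube F \<psi>)\<^sup>2)"
      using S(1) lvK by (intro sum.group[symmetric]) auto
    also have "\<dots> \<le> (\<Sum>k<K. e k)"
      unfolding e_def using lv finite_level by (intro sum_mono sum_mono2) auto
    also have "(\<Sum>k<K. e k) = (\<Sum>k<J - B. e k) + (\<Sum>k\<in>{J - B..<J + B}. e k) + (\<Sum>k\<in>{J + B..<K}. e k)"
    proof -
      have "sum e {0..<J - B} + sum e {J - B..<J + B} = sum e {0..<J + B}"
        "sum e {0..<J + B} + sum e {J + B..<K} = sum e {0..<K}"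
        using JBK by (auto intro!: sum.atLeastLessThan_concat)
      then show ?thesis by (simp add: atLeast0LessThan)
    qed
    also have "(\<Sum>k<J - B. e k) \<le> a / 4 ^ B"
    proof -
      have "(\<Sum>k<J - B. e k) \<le> (\<Sum>k<J - B. a / 4 ^ J * 4 ^ k)" by (intro sum_mono e1)
      also have "\<dots> = a / 4 ^ J * (\<Sum>k<J - B. 4 ^ k)" by (simp add: sum_distrib_left)
      also have "\<dots> \<le> a / 4 ^ J * 4 ^ (J - B)" using a by (intro mult_left_mono sum_power4_le) auto
      also have "\<dots> = a / 4 ^ B" using J by (simp add: power_diff)
      finally show ?thesis .
    qed
    also have "(\<Sum>k\<in>{J - B..<J + B}. e k) \<le> 1 / 16"
    proof -
      have "(\<Sum>k\<in>{J - B..<J + B}. e k) \<le> (\<Sum>k\<in>{J - B..<J + B}. a * c)" by (intro sum_mono e3) auto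
      also have "\<dots> = 2 * real B * (a * c)" using J by simp
      also have "\<dots> = 1 / 16" using a B by (simp add: c_def)
      finally show ?thesis .
    qed
    also have "(\<Sum>k\<in>{J + B..<K}. e k) \<le> 2 * (a / 4 ^ B)"
    proof -
      have "(\<Sum>k\<in>{J + B..<K}. e k) \<le> (\<Sum>k\<in>{J + B..<K}. a * 4 ^ J * (1 / 4 ^ k))" by (intro sum_mono e2)
      also have "\<dots> = a * 4 ^ J * (\<Sum>k\<in>{J + B..<K}. 1 / 4 ^ k)" by (simp add: sum_distrib_left)
      also have "\<dots> \<le> a * 4 ^ J * (2 / 4 ^ (J + B))" using a by (intro mult_left_mono sum_inverse_power4_le) auto
      also have "\<dots> = 2 * (a / 4 ^ B)" by (simp add: power_add)
      finally show ?thesis .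
    qed
    finally have fine: "energy F (S - \<Phi>) \<le> a / 4 ^ B + 1 / 16 + 2 * (a / 4 ^ B)" by simp
    have "energy F (S \<inter> \<Phi>) \<le> a1 / (real N)\<^sup>2" using a1(2)[OF osc] S(1) by simp
    also have "\<dots> \<le> a / 4 ^ J" unfolding N4 using a2 by (intro divide_right_mono) (auto simp: a_def)
    also have "\<dots> \<le> a / 4 ^ B" using J a by (intro divide_left_mono power_increasing) auto
    finally have coarse: "energy F (S \<inter> \<Phi>) \<le> a / 4 ^ B" .
    have "energy F S = energy F (S \<inter> \<Phi>) + energy F (S - \<Phi>)"
      using S(1) by (rule sum.Int_Diff)
    then show False using S(3) fine coarse aB by linarith
  qed
  then show ?thesis using c by blast
qed

end

section \<open>Besov norms of perturbations\<close>

context regular_wavelet_system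
begin

definition level_weight :: "real \<Rightarrow> ennreal \<Rightarrow> nat \<Rightarrow> real" where
  "level_weight s p k = 2 powr (real k * s) * 2 powr (real (CARD('d) * k) * (1 / 2 - inv_exponent p))"

lemma level_weight_nonneg [simp]: "0 \<le> level_weight s p k"
  by (simp add: level_weight_def)

abbreviation coef_norm :: "ennreal \<Rightarrow> (real ^ 'd \<Rightarrow> real) \<Rightarrow> (real ^ 'd \<Rightarrow> real) set \<Rightarrow> ennreal" where
  "coef_norm p f I \<equiv> Lnorm p (count_space I) (\<lambda>b. ennreal \<bar>inner_cube f b\<bar>)"

text \<open>Minkowski's inequality within each level and then across the levels. Additivity is
  required of the coefficients, since it holds for Bochner integrals only under
  integrability.\<close>

lemma besov_norm_add_le:
  assumes pq: "1 \<le> p" "1 \<le> q"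
    and add: "\<And>b. b \<in> all_wavelets \<Longrightarrow> inner_cube h b = inner_cube f b + inner_cube g b"
  shows "besov_norm \<Phi> \<Psi> s p q h \<le> besov_norm \<Phi> \<Psi> s p q f + besov_norm \<Phi> \<Psi> s p q g"
proof -
  have part: "coef_norm p h I
      \<le> coef_norm p f I + coef_norm p g I"
    if I: "I \<subseteq> all_wavelets" for I
  proof -
    have "coef_norm p h I
        \<le> Lnorm p (count_space I) (\<lambda>b. ennreal \<bar>inner_cube f b\<bar> + ennreal \<bar>inner_cube g b\<bar>)"
    proof (rule Lnorm_AE_mono[OF pq(1)])
      show "AE b in count_space I. ennreal \<bar>inner_cube h b\<bar> \<le> ennreal \<bar>inner_cube f b\<bar> + ennreal \<bar>inner_cube g b\<bar>"
        unfolding AE_count_space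
      proof
        fix b assume "b \<in> I"
        then have "inner_cube h b = inner_cube f b + inner_cube g b" using I by (intro add) blast
        then have "\<bar>inner_cube h b\<bar> \<le> \<bar>inner_cube f b\<bar> + \<bar>inner_cube g b\<bar>" by simp
        then show "ennreal \<bar>inner_cube h b\<bar> \<le> ennreal \<bar>inner_cube f b\<bar> + ennreal \<bar>inner_cube g b\<bar>"
          by (simp add: ennreal_leI flip: ennreal_plus)
      qed
    qed simp
    also have "\<dots> \<le> coef_norm p f I + coef_norm p g I"
      by (rule Lnorm_add_le[OF pq(1)]) auto
    finally show ?thesis .
  qed
  define v where "v f k = ennreal (level_weight s p k) * coef_norm p f (\<Psi> k)" for f k
  have "Lnorm q (count_space UNIV) (v h) \<le> Lnorm q (count_space UNIV) (\<lambda>k. v f k + v g k)"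
  proof (rule Lnorm_mono[OF pq(2)])
    fix k
    show "v h k \<le> v f k + v g k"
      unfolding v_def distrib_left[symmetric] by (intro mult_left_mono part) auto
  qed simp
  also have "\<dots> \<le> Lnorm q (count_space UNIV) (v f) + Lnorm q (count_space UNIV) (v g)"
    by (rule Lnorm_add_le[OF pq(2)]) auto
  finally have "Lnorm q (count_space UNIV) (v h) \<le> Lnorm q (count_space UNIV) (v f) + Lnorm q (count_space UNIV) (v g)" .
  moreover have "coef_norm p h \<Phi>
      \<le> coef_norm p f \<Phi> + coef_norm p g \<Phi>"
    by (rule part) blast
  ultimately show ?thesis
    unfolding besov_norm_def level_weight_def[symmetric] v_def[symmetric]
    by (subst add.assoc, subst add.left_commute, subst add.assoc[symmetric]) (metis (no_types, lifting) add.assoc add.commute add_mono)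
qed

lemma besov_norm_cmult_le:
  assumes pq: "1 \<le> p" "1 \<le> q" and c: "0 \<le> c"
  shows "besov_norm \<Phi> \<Psi> s p q (\<lambda>x. c * f x) \<le> ennreal c * besov_norm \<Phi> \<Psi> s p q f"
proof -
  have in_c: "ennreal \<bar>inner_cube (\<lambda>x. c * f x) b\<bar> = ennreal c * ennreal \<bar>inner_cube f b\<bar>" for b
    using c by (simp add: inner_cube_def mult.assoc abs_mult ennreal_mult)
  have part: "coef_norm p (\<lambda>x. c * f x) I
      \<le> ennreal c * coef_norm p f I" for I
    unfolding in_c by (rule Lnorm_cmult_le[OF pq(1) c]) simp
  define v where "v f k = ennreal (level_weight s p k) * coef_norm p f (\<Psi> k)" for f k
  have "Lnorm q (count_space UNIV) (v (\<lambda>x. c * f x)) \<le> Lnorm q (count_space UNIV) (\<lambda>k. ennreal c * v f k)"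
  proof (rule Lnorm_mono[OF pq(2)])
    fix k
    have "v (\<lambda>x. c * f x) k \<le> ennreal (level_weight s p k) * (ennreal c * coef_norm p f (\<Psi> k))"
      unfolding v_def by (intro mult_left_mono part) auto
    then show "v (\<lambda>x. c * f x) k \<le> ennreal c * v f k" by (simp only: v_def mult.left_commute)
  qed simp
  also have "\<dots> \<le> ennreal c * Lnorm q (count_space UNIV) (v f)"
    by (rule Lnorm_cmult_le[OF pq(2) c]) simp
  finally show ?thesis
    unfolding besov_norm_def level_weight_def[symmetric] v_def[symmetric] distrib_left by (intro add_mono part)
qed

text \<open>Here \<open>E\<close> bounds the weighted contribution of any level that meets
  \<open>T\<close>, and at most \<open>K\<close> levels do. The outer norm gives
  \<open>E * K powr inv_exponent q\<close>, at most \<open>E * K\<close> because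
  \<open>1 \<le> K\<close>. The \<Phi> term drops out when \<open>T\<close> misses \<Phi>, which
  leaves only the weighted terms for perturbations.\<close>

lemma besov_norm_sparse:
  assumes pq: "1 \<le> p" "1 \<le> q" and T: "finite T" "real (card T) \<le> N" "1 \<le> N" and e: "0 \<le> e"
    and in_e: "\<And>b. b \<in> all_wavelets \<Longrightarrow> \<bar>inner_cube g b\<bar> \<le> (if b \<in> T then e else 0)"
    and J: "finite J" "real (card J) \<le> K" "1 \<le> K" "\<And>k. T \<inter> \<Psi> k \<noteq> {} \<Longrightarrow> k \<in> J"
    and E: "\<And>k. T \<inter> \<Psi> k \<noteq> {} \<Longrightarrow> level_weight s p k * (e * N powr inv_exponent p) \<le> E" "0 \<le> E"
  shows "besov_norm \<Phi> \<Psi> s p q g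
    \<le> ennreal (if T \<inter> \<Phi> = {} then 0 else e * N powr inv_exponent p) + ennreal (E * K)"
proof -
  have part: "coef_norm p g I \<le> ennreal (if T \<inter> I = {} then 0 else e * N powr inv_exponent p)"
    if I: "I \<subseteq> all_wavelets" for I
  proof -
    have "ennreal \<bar>inner_cube g b\<bar> \<le> ennreal e" "b \<notin> T \<Longrightarrow> ennreal \<bar>inner_cube g b\<bar> = 0" if "b \<in> I" for b
      using in_e[OF subsetD[OF I that]] e by (auto intro!: ennreal_leI split: if_splits)
    moreover from this have "coef_norm p g I \<le> ennreal (0 * 1 powr inv_exponent p)" if "T \<inter> I = {}"
      using that by (intro Lnorm_sparse[OF pq(1), of "{}"]) auto
    ultimately show ?thesis using Lnorm_sparse[OF pq(1) T e, of I] by auto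
  qed
  have level: "ennreal (level_weight s p k) * coef_norm p g (\<Psi> k) \<le> ennreal (if T \<inter> \<Psi> k = {} then 0 else E)" for k
  proof -
    have "ennreal (level_weight s p k) * coef_norm p g (\<Psi> k)
        \<le> ennreal (level_weight s p k) * ennreal (if T \<inter> \<Psi> k = {} then 0 else e * N powr inv_exponent p)"
      by (intro mult_left_mono part) auto
    also have "\<dots> \<le> ennreal (if T \<inter> \<Psi> k = {} then 0 else E)"
      using E(1)[of k] e by (auto intro!: ennreal_leI simp flip: ennreal_mult)
    finally show ?thesis .
  qed
  have "Lnorm q (count_space UNIV) (\<lambda>k. ennreal (level_weight s p k) * coef_norm p g (\<Psi> k))
      \<le> ennreal (E * K powr inv_exponent q)"
  proof (rule Lnorm_sparse[OF pq(2) J(1-3) E(2)])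
    fix k
    have "ennreal (if T \<inter> \<Psi> k = {} then 0 else E) \<le> ennreal E" using E(2) by auto
    then show "ennreal (level_weight s p k) * coef_norm p g (\<Psi> k) \<le> ennreal E"
      using level[of k] by (rule order_trans[rotated])
    show "ennreal (level_weight s p k) * coef_norm p g (\<Psi> k) = 0" if "k \<notin> J"
    proof -
      have "T \<inter> \<Psi> k = {}" using J(4) that by blast
      then show ?thesis using level[of k] by simp
    qed
  qed
  also have "\<dots> \<le> ennreal (E * K)"
    using powr_mono[OF inv_exponent_bounds(2)[OF pq(2)] J(3)] J(3) E(2) by (intro ennreal_leI mult_left_mono) auto
  finally show ?thesis
    unfolding besov_norm_def level_weight_def[symmetric] using part[of \<Phi>] by (intro add_mono) auto
qed

text \<open>The constant is a finite combination from \<Phi>. A function of \<Phi> may also lie in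
  some levels, but \<open>level_overlap\<close> leaves only finitely many of them, so the sequence
  over levels has finite support.\<close>

lemma besov_norm_one_finite:
  assumes pq: "1 \<le> p" "1 \<le> q"
  shows "besov_norm \<Phi> \<Psi> s p q (\<lambda>x. 1) < \<top>"
proof -
  obtain S c where S: "finite S" "S \<subseteq> \<Phi>" "\<And>x. x \<in> unit_cube \<Longrightarrow> 1 = (\<Sum>\<phi>\<in>S. c \<phi> * \<phi> x)"
    using one_in_span unfolding span_cube_def by blast
  have cS: "continuous_on unit_cube \<phi>" if "\<phi> \<in> S" for \<phi> using that S(2) by (intro basis_continuous) auto
  have inner_one: "inner_cube (\<lambda>x. 1) b = (if b \<in> S then c b else 0)" if b: "b \<in> all_wavelets" for b
  proof -
    have "inner_cube (\<lambda>x. 1) b = inner_cube (\<lambda>x. \<Sum>\<phi>\<in>S. c \<phi> * \<phi> x) b" using S(3) by (rule inner_cube_cong_left)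
    also have "\<dots> = (\<Sum>\<phi>\<in>S. c \<phi> * inner_cube \<phi> b)" using cS basis_continuous[OF b] by (rule inner_cube_sum_left)
    also have "\<dots> = (\<Sum>\<phi>\<in>S. if \<phi> = b then c \<phi> else 0)"
      using S(2) b by (intro sum.cong refl) (subst basis_inner; auto)
    finally show ?thesis using S(1) by simp
  qed
  define e where "e = (\<Sum>\<phi>\<in>S. \<bar>c \<phi>\<bar>)"
  have e0: "0 \<le> e" by (simp add: e_def sum_nonneg)
  have ce: "\<bar>c b\<bar> \<le> e" if "b \<in> S" for b unfolding e_def using S(1) that by (intro member_le_sum) auto
  define N where "N = real (card S) + 1"
  define J where "J = {k. S \<inter> \<Psi> k \<noteq> {}}"
  have finJ: "finite J"
  proof -
    obtain K where K: "\<And>j k. \<Psi> j \<inter> \<Psi> k \<noteq> {} \<Longrightarrow> k \<le> j + K" using level_overlap by blast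
    have "finite {k. b \<in> \<Psi> k}" for b
    proof (cases "\<exists>j. b \<in> \<Psi> j")
      case True
      then obtain j where "b \<in> \<Psi> j" by blast
      then have "{k. b \<in> \<Psi> k} \<subseteq> {..j + K}" using K[of j] by auto
      then show ?thesis using finite_subset by blast
    qed simp
    moreover have "J = (\<Union>b\<in>S. {k. b \<in> \<Psi> k})" by (auto simp: J_def)
    ultimately show ?thesis using S(1) by simp
  qed
  define E where "E = (\<Sum>k\<in>J. level_weight s p k * (e * N powr inv_exponent p))"
  have E0: "0 \<le> E" unfolding E_def using e0 by (intro sum_nonneg) auto
  have "besov_norm \<Phi> \<Psi> s p q (\<lambda>x. 1)
      \<le> ennreal (if S \<inter> \<Phi> = {} then 0 else e * N powr inv_exponent p) + ennreal (E * (real (card J) + 1))"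
  proof (rule besov_norm_sparse[OF pq S(1) _ _ e0 _ finJ _ _ _ _ E0])
    show "\<bar>inner_cube (\<lambda>x. 1) b\<bar> \<le> (if b \<in> S then e else 0)" if "b \<in> all_wavelets" for b
      using inner_one[OF that] ce by simp
    show "level_weight s p k * (e * N powr inv_exponent p) \<le> E" if "S \<inter> \<Psi> k \<noteq> {}" for k
      unfolding E_def using finJ that e0 by (intro member_le_sum) (auto simp: J_def)
  qed (auto simp: N_def J_def)
  also have "\<dots> < \<top>" by simp
  finally show ?thesis .
qed

lemma inner_level_sum:
  assumes T: "T \<subseteq> \<Psi> j" and b: "b \<in> all_wavelets"
  shows "inner_cube (\<lambda>x. \<Sum>\<psi>\<in>T. e * \<psi> x) b = (if b \<in> T then e else 0)"
proof -
  have fin: "finite T" using T finite_level finite_subset by blast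
  have "inner_cube (\<lambda>x. \<Sum>\<psi>\<in>T. e * \<psi> x) b = (\<Sum>\<psi>\<in>T. e * inner_cube \<psi> b)"
    using T psi_continuous basis_continuous[OF b] by (intro inner_cube_sum_left) auto
  also have "\<dots> = (\<Sum>\<psi>\<in>T. if \<psi> = b then e else 0)"
    using T b by (intro sum.cong refl) (subst basis_inner; auto)
  finally show ?thesis using fin by simp
qed

text \<open>At level \<open>j\<close> the l_p norm of at most order 2^(d j) equal coefficients is e
  2^(d j / p), and the weight 2^(d j (1/2 - 1/p)) cancels the dependence on \<open>p\<close>.
  Elements of \<open>T\<close> can reappear only on levels within \<open>K\<close> of
  \<open>j\<close>, where the weight changes by a bounded factor.\<close>

lemma besov_norm_level_sum:
  assumes pq: "1 \<le> p" "1 \<le> q" and s: "0 \<le> s"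
  shows "\<exists>M>0. \<forall>j T e. T \<subseteq> \<Psi> j - \<Phi> \<longrightarrow> 0 \<le> e \<longrightarrow>
    besov_norm \<Phi> \<Psi> s p q (\<lambda>x. \<Sum>\<psi>\<in>T. e * \<psi> x) \<le> ennreal (M * (e * 2 powr (real j * s) * amp j))"
proof -
  obtain C0 where C0: "\<And>j. finite (\<Psi> j) \<and> real (card (\<Psi> j)) \<le> C0 * 2 ^ (CARD('d) * j)" using card_level by blast
  define C where "C = max C0 1"
  have C: "1 \<le> C" "real (card (\<Psi> j)) \<le> C * 2 ^ (CARD('d) * j)" for j
  proof -
    have "C0 * 2 ^ (CARD('d) * j) \<le> C * 2 ^ (CARD('d) * j)" by (intro mult_right_mono) (auto simp: C_def)
    then show "real (card (\<Psi> j)) \<le> C * 2 ^ (CARD('d) * j)" using C0[of j] by linarith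
  qed (simp add: C_def)
  obtain K where K: "\<And>j k. \<Psi> j \<inter> \<Psi> k \<noteq> {} \<Longrightarrow> k \<le> j + K" using level_overlap by blast
  define d where "d = real CARD('d)"
  \<comment> \<open>The loss for a shift of at most \<open>K\<close> levels: \<open>K * s\<close> in
    the exponent from the smoothness weight, \<open>d * K / 2\<close> from the weight's half power,
    and \<open>d * K\<close> from the mismatch between the weight at \<open>k\<close> and the count
    at \<open>j\<close>.\<close>
  define M0 where "M0 = C * 2 powr (real K * s) * 2 powr (d * real K / 2) * 2 powr (d * real K)"
  define M where "M = M0 * (2 * real K + 1)"
  have M0: "0 < M0" using C(1) by (simp add: M0_def)
  define t where "t = inv_exponent p"
  have t: "0 \<le> t" "t \<le> 1" using inv_exponent_bounds[OF pq(1)] by (auto simp: t_def)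
  have "besov_norm \<Phi> \<Psi> s p q (\<lambda>x. \<Sum>\<psi>\<in>T. e * \<psi> x) \<le> ennreal (M * (e * 2 powr (real j * s) * amp j))"
    if T: "T \<subseteq> \<Psi> j - \<Phi>" and e: "0 \<le> e" for j T e
  proof -
    let ?g = "\<lambda>x. \<Sum>\<psi>\<in>T. e * \<psi> x"
    have Tj: "T \<subseteq> \<Psi> j" using T by blast
    have finT: "finite T" using Tj finite_level finite_subset by blast
    define N where "N = C * 2 ^ (CARD('d) * j)"
    have N1: "1 \<le> N"
    proof -
      have "1 * 1 \<le> C * 2 ^ (CARD('d) * j)" using C(1) by (intro mult_mono) auto
      then show ?thesis by (simp add: N_def)
    qed
    have cardT: "real (card T) \<le> N"
    proof -
      have "card T \<le> card (\<Psi> j)" using Tj finite_level by (intro card_mono)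
      then show ?thesis using C(2)[of j] by (simp add: N_def)
    qed
    define W where "W = e * 2 powr (real j * s) * amp j"
    have W0: "0 \<le> W" using e by (simp add: W_def)
    have weight: "level_weight s p k * (e * N powr t) \<le> M0 * W" if k: "k \<le> j + K" "j \<le> k + K" for k
    proof -
      have "N powr t = C powr t * 2 powr (d * real j * t)"
        using C(1) by (simp add: N_def powr_mult powr_powr d_def flip: powr_realpow)
      also have "\<dots> \<le> C * 2 powr (d * real j * t)"
        using powr_mono[OF t(2) C(1)] C(1) by (intro mult_right_mono) auto
      finally have Nt: "N powr t \<le> C * 2 powr (d * real j * t)" .
      have "level_weight s p k * (e * N powr t) \<le> level_weight s p k * (e * (C * 2 powr (d * real j * t)))"
        using e by (intro mult_left_mono Nt) auto
      also have "\<dots> = (e * C) * 2 powr (real k * s + d * real k * (1 / 2 - t) + d * real j * t)"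
        by (simp add: level_weight_def powr_add d_def t_def mult_ac)
      also have "\<dots> \<le> (e * C) * 2 powr ((real j * s + real K * s) + (d * real j / 2 + d * real K / 2) + d * real K)"
      proof (intro mult_left_mono powr_mono)
        have kj: "real k \<le> real j + real K" "real j - real k \<le> real K" using k by linarith+
        have "real k * s \<le> (real j + real K) * s" using kj(1) s by (rule mult_right_mono)
        moreover have "d * (real k / 2) \<le> d * ((real j + real K) / 2)" using kj(1) by (intro mult_left_mono) (auto simp: d_def)
        moreover have "d * ((real j - real k) * t) \<le> d * (real K * 1)"
        proof -
          have "(real j - real k) * t \<le> real K * t" using kj(2) t by (intro mult_right_mono) auto
          also have "\<dots> \<le> real K * 1" using t by (intro mult_left_mono) auto
          finally show ?thesis by (intro mult_left_mono) (auto simp: d_def)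
        qed
        ultimately show "real k * s + d * real k * (1 / 2 - t) + d * real j * t
            \<le> (real j * s + real K * s) + (d * real j / 2 + d * real K / 2) + d * real K"
          by (simp add: algebra_simps)
      qed (use e C(1) in auto)
      also have "\<dots> = M0 * W"
      proof -
        have "amp j = 2 powr (d * real j / 2)" by (simp add: amp_def d_def)
        then show ?thesis unfolding M0_def W_def powr_add by (simp only: mult_ac)
      qed
      finally show ?thesis .
    qed
    define J where "J = {j - K..j + K}"
    have J: "finite J" "real (card J) \<le> 2 * real K + 1" by (auto simp: J_def)
    have near: "k \<le> j + K" "j \<le> k + K" if "T \<inter> \<Psi> k \<noteq> {}" for k
    proof -
      have "\<Psi> j \<inter> \<Psi> k \<noteq> {}" "\<Psi> k \<inter> \<Psi> j \<noteq> {}" using that Tj by auto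
      then show "k \<le> j + K" "j \<le> k + K" using K by auto
    qed
    have "besov_norm \<Phi> \<Psi> s p q ?g
        \<le> ennreal (if T \<inter> \<Phi> = {} then 0 else e * N powr inv_exponent p) + ennreal ((M0 * W) * (2 * real K + 1))"
    proof (rule besov_norm_sparse[OF pq finT cardT N1 e _ J])
      show "\<bar>inner_cube ?g b\<bar> \<le> (if b \<in> T then e else 0)" if "b \<in> all_wavelets" for b
        using inner_level_sum[OF Tj that] e by simp
      show "level_weight s p k * (e * N powr inv_exponent p) \<le> M0 * W" if "T \<inter> \<Psi> k \<noteq> {}" for k
        using weight[OF near[OF that]] by (simp add: t_def)
      show "k \<in> J" if "T \<inter> \<Psi> k \<noteq> {}" for k using near[OF that] by (auto simp: J_def)
    qed (use M0 W0 in auto)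
    moreover have "T \<inter> \<Phi> = {}" using T by blast
    ultimately show ?thesis by (simp add: M_def W_def mult_ac)
  qed
  moreover have "0 < M" using M0 by (simp add: M_def add_nonneg_pos)
  ultimately show ?thesis by blast
qed

end

section \<open>The minimax lower bound\<close>

lemma Lnorm_cube_const_finite:
  assumes "1 \<le> t"
  shows "Lnorm t (leb_cube :: (real ^ 'd) measure) (\<lambda>x. ennreal B) < \<top>"
  using assms
proof (cases rule: exponent_cases)
  case 1
  have "esssup (leb_cube :: (real ^ 'd) measure) (\<lambda>x. ennreal B) \<le> ennreal B" by (rule esssup_I) auto
  then show ?thesis using 1 by (simp add: Lnorm_top) (metis ennreal_less_top le_less_trans)
next
  case (2 a)
  interpret prob_space "leb_cube :: (real ^ 'd) measure" by (rule prob_space_leb_cube)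
  have "ennreal_powr x a < \<top>" if "x < \<top>" for x and a :: real
    using that by (cases x) auto
  then show ?thesis using 2 emeasure_space_1 by (simp add: Lnorm_ennreal)
qed

lemma Lspace_cube_add_bounded:
  fixes f g :: "real ^ 'd \<Rightarrow> real"
  assumes t: "1 \<le> t" and f: "f \<in> Lspace_cube t" and c: "0 \<le> c"
    and g: "g \<in> borel_measurable leb_cube" "\<And>x. x \<in> unit_cube \<Longrightarrow> \<bar>g x\<bar> \<le> B"
  shows "(\<lambda>x. c * f x + g x) \<in> Lspace_cube t"
proof -
  have fm[measurable]: "f \<in> borel_measurable leb_cube" and fn: "Lnorm t leb_cube (\<lambda>x. ennreal \<bar>f x\<bar>) < \<top>"
    using f by (auto simp: Lspace_cube_def Lnorm_cube_def)
  have gm[measurable]: "g \<in> borel_measurable leb_cube" by (rule g)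
  have "Lnorm_cube t (\<lambda>x. c * f x + g x) \<le> Lnorm t leb_cube (\<lambda>x. ennreal c * ennreal \<bar>f x\<bar> + ennreal B)"
    unfolding Lnorm_cube_def
  proof (rule Lnorm_AE_mono[OF t])
    show "AE x in leb_cube. ennreal (norm (c * f x + g x)) \<le> ennreal c * ennreal \<bar>f x\<bar> + ennreal B"
    proof (rule AE_leb_cubeI)
      fix x :: "real ^ 'd" assume x: "x \<in> unit_cube"
      have "\<bar>c * f x + g x\<bar> \<le> c * \<bar>f x\<bar> + B" using g(2)[OF x] c abs_triangle_ineq[of "c * f x" "g x"] by (simp add: abs_mult)
      then have "ennreal (norm (c * f x + g x)) \<le> ennreal (c * \<bar>f x\<bar> + B)" by (simp add: ennreal_leI)
      also have "\<dots> = ennreal c * ennreal \<bar>f x\<bar> + ennreal B"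
        using c g(2)[OF x] by (subst ennreal_plus) (auto simp: ennreal_mult)
      finally show "ennreal (norm (c * f x + g x)) \<le> ennreal c * ennreal \<bar>f x\<bar> + ennreal B" .
    qed
  qed simp
  also have "\<dots> \<le> Lnorm t leb_cube (\<lambda>x. ennreal c * ennreal \<bar>f x\<bar>) + Lnorm t (leb_cube :: (real ^ 'd) measure) (\<lambda>x. ennreal B)"
    by (rule Lnorm_add_le[OF t]) auto
  also have "\<dots> \<le> ennreal c * Lnorm t leb_cube (\<lambda>x. ennreal \<bar>f x\<bar>) + Lnorm t (leb_cube :: (real ^ 'd) measure) (\<lambda>x. ennreal B)"
    by (intro add_right_mono Lnorm_cmult_le[OF t c]) auto
  also have "\<dots> < \<top>"
    using fn Lnorm_cube_const_finite[OF t, of B] by (simp add: ennreal_mult_less_top)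
  finally show ?thesis by (simp add: Lspace_cube_def)
qed

section \<open>Perturbed densities and the risk at one level\<close>

context regular_wavelet_system
begin

lemma perturbed_family:
  fixes s m L :: real and p' q :: ennreal
  assumes m: "0 < m" "m < 1" and pq: "1 \<le> p'" "1 \<le> q" and s: "0 \<le> s"
    and f0: "f0 \<in> besov_densities_ge \<Phi> \<Psi> s p' q L m" "besov_norm \<Phi> \<Psi> s p' q f0 < ennreal L"
  shows "\<exists>\<eta> f1. 0 < \<eta> \<and> integrable leb_cube f1 \<and> (\<forall>j T e. T \<subseteq> \<Psi> j - \<Phi> \<longrightarrow> 0 \<le> e \<longrightarrow>
     e * 2 powr (real j * s) * amp j \<le> \<eta> \<longrightarrow>
       (\<lambda>x. f1 x + (\<Sum>\<psi>\<in>T. e * \<psi> x)) \<in> besov_densities_ge \<Phi> \<Psi> s p' q L m)"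
proof -
  have f0_L: "f0 \<in> Lspace_cube p'" and f0_m: "AE x in leb_cube. m \<le> f0 x" and f0_1: "(\<integral>x. f0 x \<partial>leb_cube) = 1"
    using f0(1) by (auto simp: besov_densities_ge_def besov_densities_def)
  have f0_int: "integrable leb_cube f0" using f0_1 by (metis not_integrable_integral_eq zero_neq_one)
  interpret P: prob_space "leb_cube :: (real ^ 'd) measure" by (rule prob_space_leb_cube)
  obtain b0 where b0: "besov_norm \<Phi> \<Psi> s p' q f0 = ennreal b0" "0 \<le> b0" "b0 < L"
    using f0(2) by (cases "besov_norm \<Phi> \<Psi> s p' q f0") (auto simp: ennreal_less_iff)
  obtain b1 where b1: "besov_norm \<Phi> \<Psi> s p' q (\<lambda>x. 1) = ennreal b1" "0 \<le> b1"
    using besov_norm_one_finite[OF pq, of s] by (cases "besov_norm \<Phi> \<Psi> s p' q (\<lambda>x. 1)") auto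
  obtain M where M: "0 < M" "\<And>j T e. T \<subseteq> \<Psi> j - \<Phi> \<Longrightarrow> 0 \<le> e \<Longrightarrow>
      besov_norm \<Phi> \<Psi> s p' q (\<lambda>x. \<Sum>\<psi>\<in>T. e * \<psi> x) \<le> ennreal (M * (e * 2 powr (real j * s) * amp j))"
    using besov_norm_level_sum[OF pq s] by blast
  obtain D where D: "0 < D"
    "\<forall>j F. finite F \<longrightarrow> F \<subseteq> \<Psi> j \<longrightarrow> (\<forall>x\<in>unit_cube. (\<Sum>\<psi>\<in>F. \<bar>\<psi> x\<bar>) \<le> D * amp j)"
    using level_sum_abs_bound by (elim exE conjE) (rule that)
  let ?b = "besov_norm \<Phi> \<Psi> s p' q"
  \<comment> \<open>The uniform part costs at most \<open>\<delta> * b1\<close> in the norm, half of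
    the gap \<open>L - b0\<close>; the summand 1 in \<open>b1 + 1\<close> keeps the denominator
    positive.\<close>
  define \<delta> where "\<delta> = min 1 ((L - b0) / (2 * (b1 + 1)))"
  have \<delta>: "0 < \<delta>" "\<delta> \<le> 1" using b0 b1 by (auto simp: \<delta>_def)
  have \<delta>b: "\<delta> * b1 \<le> (L - b0) / 2"
  proof -
    have "\<delta> * b1 \<le> (L - b0) / (2 * (b1 + 1)) * (b1 + 1)"
      using b0 b1 by (intro mult_mono) (auto simp: \<delta>_def)
    also have "\<dots> = (L - b0) / 2" using b1 by (simp add: field_simps)
    finally show ?thesis .
  qed
  \<comment> \<open>The first term lets the perturbation spend the other half of the norm gap. The
    second keeps it below \<open>\<delta> * (1 - m)\<close>, the amount by which the mixture exceeds
    \<open>m\<close>.\<close>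
  define \<eta> where "\<eta> = min ((L - b0) / (2 * M)) (\<delta> * (1 - m) / D)"
  have \<eta>: "0 < \<eta>" using b0 M \<delta> m D by (simp add: \<eta>_def)
  have \<eta>M: "M * \<eta> \<le> (L - b0) / 2" and \<eta>D: "D * \<eta> \<le> \<delta> * (1 - m)"
  proof -
    have "M * \<eta> \<le> M * ((L - b0) / (2 * M))" using M by (intro mult_left_mono) (auto simp: \<eta>_def)
    then show "M * \<eta> \<le> (L - b0) / 2" using M by simp
    have "D * \<eta> \<le> D * (\<delta> * (1 - m) / D)" using D by (intro mult_left_mono) (auto simp: \<eta>_def)
    then show "D * \<eta> \<le> \<delta> * (1 - m)" using D by simp
  qed
  define f1 where "f1 x = (1 - \<delta>) * f0 x + \<delta>" for x
  have f1_int: "integrable leb_cube f1" unfolding f1_def using f0_int by simp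
  have "(\<lambda>x. f1 x + (\<Sum>\<psi>\<in>T. e * \<psi> x)) \<in> besov_densities_ge \<Phi> \<Psi> s p' q L m"
    if T: "T \<subseteq> \<Psi> j - \<Phi>" and e: "0 \<le> e" and small: "e * 2 powr (real j * s) * amp j \<le> \<eta>" for j T e
  proof -
    let ?g = "\<lambda>x. \<Sum>\<psi>\<in>T. e * \<psi> x"
    have Tj: "T \<subseteq> \<Psi> j" using T by blast
    have finT: "finite T" using Tj finite_level finite_subset by blast
    have cg: "continuous_on unit_cube ?g" using Tj psi_continuous by (intro continuous_intros) auto
    have ig: "integrable leb_cube ?g" using cg by (rule continuous_integrable_leb_cube)
    \<comment> \<open>Since \<open>s \<ge> 0\<close>, the condition that controls the Besov norm of
      the perturbation also controls its supremum.\<close>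
    have "e * amp j \<le> e * 2 powr (real j * s) * amp j"
    proof -
      have "1 \<le> (2::real) powr (real j * s)" using s by (intro ge_one_powr_ge_zero) auto
      then have "e * amp j * 1 \<le> e * amp j * 2 powr (real j * s)" using e by (intro mult_left_mono) auto
      then show ?thesis by (simp add: mult_ac)
    qed
    then have ea: "e * amp j \<le> \<eta>" using small by linarith
    have gb: "\<bar>?g x\<bar> \<le> \<delta> * (1 - m)" if x: "x \<in> unit_cube" for x
    proof -
      have "\<bar>?g x\<bar> \<le> (\<Sum>\<psi>\<in>T. \<bar>e * \<psi> x\<bar>)" by (rule sum_abs)
      also have "\<dots> = e * (\<Sum>\<psi>\<in>T. \<bar>\<psi> x\<bar>)" using e by (simp add: abs_mult sum_distrib_left)
      also have "\<dots> \<le> e * (D * amp j)" using D(2)[rule_format, OF finT Tj x] e by (intro mult_left_mono)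
      also have "\<dots> = D * (e * amp j)" by simp
      also have "\<dots> \<le> D * \<eta>" using ea D(1) by (intro mult_left_mono) auto
      finally show ?thesis using \<eta>D by linarith
    qed
    have ge: "AE x in leb_cube. m \<le> f1 x + ?g x"
      using f0_m AE_space
    proof eventually_elim
      case (elim x)
      then have "(1 - \<delta>) * m \<le> (1 - \<delta>) * f0 x" using \<delta> by (intro mult_left_mono) auto
      moreover have "- (\<delta> * (1 - m)) \<le> ?g x" using gb[of x] elim by (simp add: abs_le_iff)
      moreover have "(1 - \<delta>) * m + \<delta> - \<delta> * (1 - m) = m" by (simp add: algebra_simps)
      ultimately show ?case unfolding f1_def by linarith
    qed
    have g0: "(\<integral>x. ?g x \<partial>leb_cube) = 0"
    proof -
      have "(\<integral>x. ?g x \<partial>leb_cube) = (\<Sum>\<psi>\<in>T. \<integral>x. e * \<psi> x \<partial>leb_cube)"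
        using Tj psi_continuous
        by (intro Bochner_Integration.integral_sum continuous_integrable_leb_cube continuous_intros) auto
      also have "\<dots> = 0" using T integral_psi_zero by (intro sum.neutral) auto
      finally show ?thesis .
    qed
    have "(\<integral>x. f1 x \<partial>leb_cube) = 1"
      unfolding f1_def using f0_int f0_1 P.prob_space by simp
    then have int1: "(\<integral>x. f1 x + ?g x \<partial>leb_cube) = 1"
      using f1_int ig g0 by simp
    have "(\<lambda>x. (1 - \<delta>) * f0 x + (\<delta> + ?g x)) \<in> Lspace_cube p'"
    proof (rule Lspace_cube_add_bounded[OF pq(1) f0_L])
      show "(\<lambda>x. \<delta> + ?g x) \<in> borel_measurable leb_cube"
        by (intro continuous_on_cube_measurable continuous_on_add continuous_on_const cg)
      show "\<bar>\<delta> + ?g x\<bar> \<le> \<delta> + \<delta> * (1 - m)" if "x \<in> unit_cube" for x using gb[OF that] \<delta> by linarith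
    qed (use \<delta> in auto)
    then have inL: "(\<lambda>x. f1 x + ?g x) \<in> Lspace_cube p'" by (simp add: f1_def add.assoc)
    have inner_add: "inner_cube (\<lambda>x. h1 x + h2 x) b = inner_cube h1 b + inner_cube h2 b"
      if "integrable leb_cube h1" "integrable leb_cube h2" "b \<in> all_wavelets" for h1 h2 b
      using inner_cube_integrable[OF that(1,3)] inner_cube_integrable[OF that(2,3)] by (simp add: inner_cube_def distrib_right)
    have "?b (\<lambda>x. f1 x + ?g x) \<le> ?b f1 + ?b ?g"
      using inner_add[OF f1_int ig] by (intro besov_norm_add_le[OF pq])
    also have "\<dots> \<le> (?b (\<lambda>x. (1 - \<delta>) * f0 x) + ?b (\<lambda>x. \<delta> * 1))
        + ?b ?g"
    proof (intro add_right_mono besov_norm_add_le[OF pq])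
      show "inner_cube f1 b = inner_cube (\<lambda>x. (1 - \<delta>) * f0 x) b + inner_cube (\<lambda>x. \<delta> * 1) b"
        if "b \<in> all_wavelets" for b
        using inner_add[OF _ _ that, of "\<lambda>x. (1 - \<delta>) * f0 x" "\<lambda>x. \<delta> * 1"] f0_int by (simp add: f1_def[abs_def])
    qed
    also have "\<dots> \<le> (ennreal (1 - \<delta>) * ennreal b0 + ennreal \<delta> * ennreal b1) + ennreal (M * \<eta>)"
    proof (intro add_mono)
      show "?b (\<lambda>x. (1 - \<delta>) * f0 x) \<le> ennreal (1 - \<delta>) * ennreal b0"
        unfolding b0(1)[symmetric] using \<delta> by (intro besov_norm_cmult_le[OF pq]) auto
      show "?b (\<lambda>x. \<delta> * 1) \<le> ennreal \<delta> * ennreal b1"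
        unfolding b1(1)[symmetric] using \<delta> by (intro besov_norm_cmult_le[OF pq]) auto
      have "M * (e * 2 powr (real j * s) * amp j) \<le> M * \<eta>" using small M(1) by (intro mult_left_mono) auto
      then show "?b ?g \<le> ennreal (M * \<eta>)"
        using M(2)[OF T e] by (meson ennreal_leI order_trans)
    qed
    also have "\<dots> = ennreal ((1 - \<delta>) * b0 + \<delta> * b1 + M * \<eta>)"
      using \<delta> b0 b1 M(1) \<eta> by (simp flip: ennreal_mult ennreal_plus)
    also have "\<dots> \<le> ennreal L"
    proof (rule ennreal_leI)
      have "(1 - \<delta>) * b0 \<le> 1 * b0" using \<delta> b0 by (intro mult_right_mono) auto
      then have "(1 - \<delta>) * b0 + \<delta> * b1 + M * \<eta> \<le> 1 * b0 + (L - b0) / 2 + (L - b0) / 2"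
        by (intro add_mono \<delta>b \<eta>M)
      then show "(1 - \<delta>) * b0 + \<delta> * b1 + M * \<eta> \<le> L" by simp
    qed
    finally have besov: "?b (\<lambda>x. f1 x + ?g x) \<le> ennreal L" .
    have "AE x in leb_cube. 0 \<le> f1 x + ?g x" using ge by eventually_elim (use m in linarith)
    then show ?thesis
      using inL besov int1 ge by (simp add: besov_densities_ge_def besov_densities_def)
  qed
  then show ?thesis using \<eta> f1_int by (intro exI[of _ \<eta>] exI[of _ f1]) blast
qed

lemma besov_densities_ge_cube_density:
  assumes "f \<in> besov_densities_ge \<Phi> \<Psi> s p' q L m"
  shows "cube_density f" "AE x in leb_cube. m \<le> f x"
  using assms by (auto simp: besov_densities_ge_def besov_densities_def cube_density_def Lspace_cube_def)

text \<open>A measure-valued estimator induces an estimator of each wavelet coefficient, so a sum of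
  coefficient losses bounds the risk from below. The hypotheses are indexed by all subsets of the
  level outside \<Phi>; adding one wavelet shifts its own coefficient by \<open>e\<close> and the
  density by \<open>e\<close> in L_2.\<close>

lemma level_risk_lower:
  fixes s m L p :: real and p' q :: ennreal
  assumes m: "0 < m" "m < 1" and pq: "1 \<le> p'" "1 \<le> q" and s: "0 \<le> s" and p: "1 \<le> p"
    and f0: "f0 \<in> besov_densities_ge \<Phi> \<Psi> s p' q L m" "besov_norm \<Phi> \<Psi> s p' q f0 < ennreal L"
  shows "\<exists>c>0. \<forall>j n \<mu>'. 1 \<le> n \<longrightarrow> \<mu>' \<in> estimators n \<longrightarrow>
     ennreal (c * (real (card (\<Psi> j - \<Phi>)) / 2 ^ (CARD('d) * j)) * min (2 powr (- (real j * (1 + s)))) (amp j / 2 ^ j * real n powr (- (1 / 2))))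
       \<le> (SUP f\<in>besov_densities_ge \<Phi> \<Psi> s p' q L m. wasserstein_risk p n f \<mu>')"
proof -
  obtain \<eta>0 f1 where \<eta>0: "0 < \<eta>0" and f1: "integrable leb_cube f1" and fam: "\<forall>j T e. T \<subseteq> \<Psi> j - \<Phi> \<longrightarrow> 0 \<le> e \<longrightarrow>
     e * 2 powr (real j * s) * amp j \<le> \<eta>0 \<longrightarrow>
       (\<lambda>x. f1 x + (\<Sum>\<psi>\<in>T. e * \<psi> x)) \<in> besov_densities_ge \<Phi> \<Psi> s p' q L m"
    using perturbed_family[OF m pq s f0] by (elim exE conjE) (rule that)
  obtain c1 where c1: "0 < c1" and W: "\<forall>j S f \<nu> p. S \<subseteq> \<Psi> j \<longrightarrow> cube_density f \<longrightarrow> prob_space \<nu> \<longrightarrow> sets \<nu> = sets borel \<longrightarrow> 1 \<le> p \<longrightarrow>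
     ennreal (c1 / (2 ^ j * amp j) * (\<Sum>\<psi>\<in>S. \<bar>inner_cube f \<psi> - (\<integral>y. cube_extend \<psi> y \<partial>\<nu>)\<bar>)) \<le> wasserstein p (law f) \<nu>"
    using wasserstein_ge_coefficients by (elim exE conjE) (rule that)
  define \<eta> where "\<eta> = min \<eta>0 (min 1 m)"
  have \<eta>: "0 < \<eta>" "\<eta> \<le> \<eta>0" "\<eta> \<le> 1" "\<eta> \<le> m" using \<eta>0 m by (auto simp: \<eta>_def)
  \<comment> \<open>The 8 combines the 1/4 of the two-point bound with the 1/2 of Assouad's
    lemma.\<close>
  define c where "c = c1 * \<eta> / 8"
  have "ennreal (c * (real (card (\<Psi> j - \<Phi>)) / 2 ^ (CARD('d) * j)) * min (2 powr (- (real j * (1 + s)))) (amp j / 2 ^ j * real n powr (- (1 / 2))))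
       \<le> (SUP f\<in>besov_densities_ge \<Phi> \<Psi> s p' q L m. wasserstein_risk p n f \<mu>')"
    if n: "1 \<le> n" and \<mu>': "\<mu>' \<in> estimators n" for j n \<mu>'
  proof -
    let ?V = "SUP f\<in>besov_densities_ge \<Phi> \<Psi> s p' q L m. wasserstein_risk p n f \<mu>'"
    define S where "S = \<Psi> j - \<Phi>"
    have finS: "finite S" unfolding S_def using finite_level by blast
    \<comment> \<open>The first term of the minimum respects the Besov radius, the second makes
      neighbours indistinguishable from \<open>n\<close> observations. The choice of \<eta> at most
      1 and at most \<open>m\<close> gives \<open>\<eta>^2 \<le> m\<close>, hence
      \<open>e^2 \<le> m / real n\<close>.\<close>
    define e where "e = \<eta> * min (2 powr (- (real j * s)) / amp j) (real n powr (- (1 / 2)))"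
    have e: "0 \<le> e" unfolding e_def using \<eta> by (intro mult_nonneg_nonneg) auto
    have amp_ne: "amp j \<noteq> 0" using amp_pos[of j] by linarith
    have small: "e * 2 powr (real j * s) * amp j \<le> \<eta>0"
    proof -
      have "e \<le> \<eta> * (2 powr (- (real j * s)) / amp j)" unfolding e_def using \<eta> by (intro mult_left_mono) auto
      then have "e * (2 powr (real j * s) * amp j) \<le> \<eta> * (2 powr (- (real j * s)) / amp j) * (2 powr (real j * s) * amp j)"
        by (intro mult_right_mono) auto
      also have "\<dots> = \<eta>" using amp_ne by (simp add: powr_minus)
      finally show ?thesis using \<eta> by (simp add: mult.assoc)
    qed
    have e2: "e\<^sup>2 \<le> m / real n"
    proof -
      have "e \<le> \<eta> * real n powr (- (1 / 2))" unfolding e_def using \<eta> by (intro mult_left_mono) auto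
      then have "e\<^sup>2 \<le> (\<eta> * real n powr (- (1 / 2)))\<^sup>2" using e by (intro power_mono)
      also have "\<dots> = \<eta>\<^sup>2 * (1 / real n)"
        using n by (simp add: power_mult_distrib powr_minus powr_half_sqrt power_one_over inverse_eq_divide power_divide)
      also have "\<dots> \<le> m * (1 / real n)"
      proof (rule mult_right_mono)
        have "\<eta>\<^sup>2 \<le> \<eta> * 1" unfolding power2_eq_square using \<eta> by (intro mult_left_mono) auto
        then show "\<eta>\<^sup>2 \<le> m" using \<eta> by linarith
      qed simp
      finally show ?thesis by simp
    qed
    define f where "f T x = f1 x + (\<Sum>\<psi>\<in>T. e * \<psi> x)" for T x
    have fT: "f T \<in> besov_densities_ge \<Phi> \<Psi> s p' q L m" if "T \<subseteq> S" for T
      using fam e small that unfolding f_def[abs_def] S_def by blast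
    note dens = besov_densities_ge_cube_density[OF fT]
    have probs: "prob_space (\<mu>' X)" "sets (\<mu>' X) = sets borel" if "X \<in> space (\<Pi>\<^sub>M i\<in>{..<n}. borel)" for X
    proof -
      have "\<mu>' X \<in> space (prob_algebra borel)"
        using \<mu>' that unfolding estimators_def by (rule measurable_space)
      then show "prob_space (\<mu>' X)" "sets (\<mu>' X) = sets borel" by (auto simp: space_prob_algebra)
    qed
    define b where "b \<psi> X = (\<integral>y. cube_extend \<psi> y \<partial>(\<mu>' X))" for \<psi> X
    have bm: "b \<psi> \<in> borel_measurable (\<Pi>\<^sub>M i\<in>{..<n}. borel)" if "\<psi> \<in> S" for \<psi>
    proof -
      have "cube_extend \<psi> \<in> borel_measurable borel"
        using that psi_continuous by (intro cube_extend_measurable) (auto simp: S_def)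
      then have "(\<lambda>M. \<integral>y. cube_extend \<psi> y \<partial>M) \<in> subprob_algebra borel \<rightarrow>\<^sub>M borel"
        by (rule integral_measurable_subprob_algebra)
      moreover have "\<mu>' \<in> (\<Pi>\<^sub>M i\<in>{..<n}. borel) \<rightarrow>\<^sub>M subprob_algebra borel"
        using \<mu>' unfolding estimators_def by (rule measurable_prob_algebraD)
      ultimately show ?thesis unfolding b_def[abs_def] by (rule measurable_compose[rotated])
    qed
    have sets_law_PiM: "sets (\<Pi>\<^sub>M i\<in>{..<n}. law (f T)) = sets (\<Pi>\<^sub>M i\<in>{..<n}. borel)" for T
      by (intro sets_PiM_cong) auto
    define \<kappa> where "\<kappa> = c1 / (2 ^ j * amp j)"
    have \<kappa>: "0 \<le> \<kappa>" using c1 by (simp add: \<kappa>_def)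
    define R where "R \<psi> T = (\<integral>\<^sup>+X. ennreal \<bar>inner_cube (f T) \<psi> - b \<psi> X\<bar> \<partial>(\<Pi>\<^sub>M i\<in>{..<n}. law (f T)))" for \<psi> T
    have "ennreal (\<kappa> * real (card S) * (e / 4) / 2) \<le> ?V"
    proof (rule assouad[OF finS _ \<kappa>])
      show "0 \<le> e / 4" using e by simp
      fix T assume T: "T \<subseteq> S"
      have bm': "(\<lambda>X. ennreal \<bar>inner_cube (f T) \<psi> - b \<psi> X\<bar>) \<in> borel_measurable (\<Pi>\<^sub>M i\<in>{..<n}. law (f T))" if "\<psi> \<in> S" for \<psi>
        unfolding measurable_cong_sets[OF sets_law_PiM refl] using bm[OF that] by measurable
      have "ennreal \<kappa> * (\<Sum>\<psi>\<in>S. R \<psi> T)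
          = ennreal \<kappa> * (\<integral>\<^sup>+X. (\<Sum>\<psi>\<in>S. ennreal \<bar>inner_cube (f T) \<psi> - b \<psi> X\<bar>) \<partial>(\<Pi>\<^sub>M i\<in>{..<n}. law (f T)))"
        unfolding R_def by (intro arg_cong[where f="times (ennreal \<kappa>)"] nn_integral_sum[symmetric] bm')
      also have "\<dots> = (\<integral>\<^sup>+X. ennreal \<kappa> * (\<Sum>\<psi>\<in>S. ennreal \<bar>inner_cube (f T) \<psi> - b \<psi> X\<bar>) \<partial>(\<Pi>\<^sub>M i\<in>{..<n}. law (f T)))"
        by (intro nn_integral_cmult[symmetric] borel_measurable_sum bm')
      also have "\<dots> \<le> (\<integral>\<^sup>+X. wasserstein p (law (f T)) (\<mu>' X) \<partial>(\<Pi>\<^sub>M i\<in>{..<n}. law (f T)))"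
      proof (rule nn_integral_mono)
        fix X assume "X \<in> space (\<Pi>\<^sub>M i\<in>{..<n}. law (f T))"
        then have X: "X \<in> space (\<Pi>\<^sub>M i\<in>{..<n}. borel)" by (simp add: space_PiM)
        have "ennreal (\<kappa> * (\<Sum>\<psi>\<in>S. \<bar>inner_cube (f T) \<psi> - b \<psi> X\<bar>)) \<le> wasserstein p (law (f T)) (\<mu>' X)"
          using W dens(1)[OF T] probs[OF X] p unfolding \<kappa>_def b_def S_def by blast
        then show "ennreal \<kappa> * (\<Sum>\<psi>\<in>S. ennreal \<bar>inner_cube (f T) \<psi> - b \<psi> X\<bar>) \<le> wasserstein p (law (f T)) (\<mu>' X)"
          using \<kappa> by (simp add: ennreal_mult sum_nonneg)
      qed
      also have "\<dots> = wasserstein_risk p n (f T) \<mu>'" by (simp add: wasserstein_risk_def)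
      also have "\<dots> \<le> ?V"
        using fT[OF T] by (rule SUP_upper)
      finally show "ennreal \<kappa> * (\<Sum>\<psi>\<in>S. R \<psi> T) \<le> ?V" .
    next
      fix \<psi> T assume \<psi>: "\<psi> \<in> S" and T: "T \<subseteq> S - {\<psi>}"
      have T1: "T \<subseteq> S" and T2: "insert \<psi> T \<subseteq> S" and nT: "\<psi> \<notin> T" and finT: "finite T"
        using \<psi> T finS finite_subset by blast+
      have \<psi>j: "\<psi> \<in> \<Psi> j" using \<psi> by (simp add: S_def)
      have diff: "f (insert \<psi> T) x - f T x = e * \<psi> x" for x using nT finT by (simp add: f_def)
      have ff: "f (insert \<psi> T) = (\<lambda>x. f T x + e * \<psi> x)" using diff by (auto simp: fun_eq_iff algebra_simps)
      have c\<psi>: "continuous_on unit_cube \<psi>" by (rule psi_continuous[OF \<psi>j])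
      have one: "inner_cube \<psi> \<psi> = 1" using basis_inner[of \<psi> \<psi>] \<psi>j by auto
      have "inner_cube (f (insert \<psi> T)) \<psi> = (\<integral>x. f T x * \<psi> x + e * (\<psi> x * \<psi> x) \<partial>leb_cube)"
        unfolding ff inner_cube_def by (simp add: algebra_simps)
      also have "\<dots> = inner_cube (f T) \<psi> + e * inner_cube \<psi> \<psi>"
      proof -
        have "integrable leb_cube (\<lambda>x. f T x * \<psi> x)"
          using \<psi>j by (intro inner_cube_integrable cube_density_integrable dens(1)[OF T1]) blast
        moreover have "integrable leb_cube (\<lambda>x. \<psi> x * \<psi> x)"
          using c\<psi> by (intro continuous_integrable_leb_cube continuous_intros)
        ultimately show ?thesis by (simp add: inner_cube_def)
      qed
      finally have shift: "inner_cube (f (insert \<psi> T)) \<psi> = inner_cube (f T) \<psi> + e" using one by simp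
      have "(\<integral>x. (f (insert \<psi> T) x - f T x)\<^sup>2 \<partial>leb_cube) = e\<^sup>2 * inner_cube \<psi> \<psi>"
        unfolding diff inner_cube_def by (simp add: power2_eq_square mult_ac)
      then have sq: "(\<integral>x. (f (insert \<psi> T) x - f T x)\<^sup>2 \<partial>leb_cube) \<le> m / real n" using one e2 by simp
      have isq: "integrable leb_cube (\<lambda>x. (f (insert \<psi> T) x - f T x)\<^sup>2)"
        unfolding diff using c\<psi> by (intro continuous_integrable_leb_cube continuous_intros)
      show "ennreal (e / 4) \<le> R \<psi> T + R \<psi> (insert \<psi> T)"
        unfolding R_def shift
        by (rule law_two_point_lower[OF dens(1)[OF T1] dens(1)[OF T2] m(1) dens(2)[OF T1] isq sq n bm[OF \<psi>] e])
    qed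
    also have "\<kappa> * real (card S) * (e / 4) / 2
        = c * (real (card (\<Psi> j - \<Phi>)) / 2 ^ (CARD('d) * j)) * min (2 powr (- (real j * (1 + s)))) (amp j / 2 ^ j * real n powr (- (1 / 2)))"
    proof -
      have "2 powr (- (real j * (1 + s))) = amp j / 2 ^ j * (2 powr (- (real j * s)) / amp j)"
      proof -
        have "2 powr (- (real j * (1 + s))) = 2 powr (- real j) * 2 powr (- (real j * s))"
          by (simp add: algebra_simps flip: powr_add)
        also have "2 powr (- real j) = 1 / 2 ^ j" by (simp add: powr_minus_divide powr_realpow)
        finally show ?thesis using amp_ne by simp
      qed
      then have "min (2 powr (- (real j * (1 + s)))) (amp j / 2 ^ j * real n powr (- (1 / 2)))
          = amp j / 2 ^ j * min (2 powr (- (real j * s)) / amp j) (real n powr (- (1 / 2)))"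
        by (simp only: min_mult_distrib_left) simp
      also have "\<dots> = amp j / 2 ^ j * (e / \<eta>)" using \<eta> by (simp add: e_def)
      finally have eq: "min (2 powr (- (real j * (1 + s)))) (amp j / 2 ^ j * real n powr (- (1 / 2))) = amp j / 2 ^ j * (e / \<eta>)" .
      show ?thesis
        unfolding eq \<kappa>_def c_def S_def amp_mult_amp[symmetric] using \<eta>(1) amp_ne by (simp add: field_simps)
    qed
    finally show ?thesis .
  qed
  moreover have "0 < c" using c1 \<eta> by (simp add: c_def)
  ultimately show ?thesis by blast
qed

end

text \<open>The levels within a window around \<open>2 ^ J \<asymp> n powr (1 / (d + 2 * s))\<close>, respectively around a
  constant if \<open>d = 1\<close>, balance the two terms of the minimum.\<close>

lemma minimax_rate_balance:
  fixes s :: real and d B :: nat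
  assumes s: "0 \<le> s" and d: "1 \<le> d"
  shows "\<exists>c>0. \<forall>n\<ge>1. \<exists>J\<ge>B. \<forall>j. J \<le> j + B \<longrightarrow> j < J + B \<longrightarrow>
     c * (if d \<ge> 2 then real n powr (- ((1 + s) / (real d + 2 * s))) else real n powr (- (1 / 2)))
       \<le> min (2 powr (- (real j * (1 + s)))) (2 powr (real (d * j) / 2) / 2 ^ j * real n powr (- (1 / 2)))"
proof (cases "d \<ge> 2")
  case True
  \<comment> \<open>A level of the window exceeds the balanced, possibly fractional, level
    \<open>l\<close> by at most \<open>2 * B + 1\<close>; this is the resulting loss in 2^(- j (1 +
    s)).\<close>
  define c where "c = 2 powr (- ((2 * real B + 1) * (1 + s)))"
  have c: "0 < c" by (simp add: c_def)
  have "\<exists>J\<ge>B. \<forall>j. J \<le> j + B \<longrightarrow> j < J + B \<longrightarrow>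
     c * real n powr (- ((1 + s) / (real d + 2 * s)))
       \<le> min (2 powr (- (real j * (1 + s)))) (2 powr (real (d * j) / 2) / 2 ^ j * real n powr (- (1 / 2)))"
    if n: "1 \<le> n" for n :: nat
  proof -
    define l where "l = log 2 (real n) / (real d + 2 * s)"
    have ds: "0 < real d + 2 * s" using s d by linarith
    have l0: "0 \<le> l" using n ds by (simp add: l_def)
    have n_l: "real n powr a = 2 powr (l * (real d + 2 * s) * a)" for a
    proof -
      have "real n = 2 powr (log 2 (real n))" using n by simp
      also have "log 2 (real n) = l * (real d + 2 * s)" using ds by (simp add: l_def)
      finally show ?thesis by (metis powr_powr)
    qed
    \<comment> \<open>The offset \<open>B\<close> places the whole window at or above
      \<open>l\<close>, where the second term of the minimum is no smaller than at
      \<open>l\<close>.\<close>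
    define J where "J = B + nat \<lceil>l\<rceil>"
    have J: "real B + l \<le> real J" "real J \<le> real B + l + 1" using l0 by (auto simp: J_def)
    have rate: "c * real n powr (- ((1 + s) / (real d + 2 * s))) = 2 powr (- ((2 * real B + 1) * (1 + s)) - l * (1 + s))"
    proof -
      have "l * (real d + 2 * s) * (- ((1 + s) / (real d + 2 * s))) = - (l * (1 + s))" using ds by simp
      then show ?thesis unfolding c_def n_l by (simp add: powr_diff powr_minus_divide)
    qed
    show ?thesis
    proof (intro exI[of _ J] conjI allI impI)
      show "B \<le> J" by (simp add: J_def)
      fix j assume j: "J \<le> j + B" "j < J + B"
      have jl: "l \<le> real j" "real j \<le> 2 * real B + l + 1" using j J by linarith+
      have "c * real n powr (- ((1 + s) / (real d + 2 * s))) \<le> 2 powr (- (real j * (1 + s)))"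
      proof -
        have "real j * (1 + s) \<le> (2 * real B + l + 1) * (1 + s)" using jl(2) s by (intro mult_right_mono) auto
        then show ?thesis unfolding rate by (intro powr_mono) (auto simp: algebra_simps)
      qed
      moreover have "c * real n powr (- ((1 + s) / (real d + 2 * s))) \<le> 2 powr (real (d * j) / 2) / 2 ^ j * real n powr (- (1 / 2))"
      proof -
        have "2 powr (real (d * j) / 2) / 2 ^ j * real n powr (- (1 / 2))
            = 2 powr (real d * real j / 2 - real j + l * (real d + 2 * s) * (- (1 / 2)))"
          unfolding n_l by (simp add: powr_add powr_diff powr_realpow powr_minus_divide)
        moreover have "- ((2 * real B + 1) * (1 + s)) - l * (1 + s) \<le> real d * real j / 2 - real j + l * (real d + 2 * s) * (- (1 / 2))"
        proof -
          \<comment> \<open>This is where d >= 2 enters: 2^(j (d/2 - 1)) does not decrease from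
            \<open>l\<close> to \<open>j\<close>.\<close>
          have "l * (real d / 2 - 1) \<le> real j * (real d / 2 - 1)" using jl(1) True by (intro mult_right_mono) auto
          moreover have "0 \<le> (2 * real B + 1) * (1 + s)" using s by simp
          ultimately show ?thesis by (simp add: algebra_simps)
        qed
        ultimately show ?thesis unfolding rate by (simp add: powr_mono)
      qed
      ultimately show "c * real n powr (- ((1 + s) / (real d + 2 * s)))
        \<le> min (2 powr (- (real j * (1 + s)))) (2 powr (real (d * j) / 2) / 2 ^ j * real n powr (- (1 / 2)))" by simp
    qed
  qed
  then show ?thesis using True c by (intro exI[of _ c]) auto
next
  case False
  then have d1: "d = 1" using d by simp
  \<comment> \<open>Every sample size uses the same window, \<open>J = B\<close> with levels below
    \<open>2 * B\<close>, so powers of 2 depending on \<open>j\<close> are bounded below by a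
    constant.\<close>
  define c where "c = 2 powr (- (2 * real B * (1 + s)))"
  have "c * real n powr (- (1 / 2)) \<le> min (2 powr (- (real j * (1 + s)))) (2 powr (real j / 2) / 2 ^ j * real n powr (- (1 / 2)))"
    if n: "1 \<le> n" and j: "j < B + B" for n j :: nat
  proof -
    have "real j * (1 + s) \<le> 2 * real B * (1 + s)" using j s by (intro mult_right_mono) auto
    then have cj: "c \<le> 2 powr (- (real j * (1 + s)))" unfolding c_def by (intro powr_mono) auto
    have n1: "real n powr (- (1 / 2)) \<le> 1" using n powr_mono[of "- (1/2)" 0 "real n"] by simp
    have "c * real n powr (- (1 / 2)) \<le> 2 powr (- (real j * (1 + s))) * 1"
      using cj n1 by (intro mult_mono) auto
    moreover have "c * real n powr (- (1 / 2)) \<le> 2 powr (real j / 2) / 2 ^ j * real n powr (- (1 / 2))"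
    proof (rule mult_right_mono)
      have "2 powr (- (real j * (1 + s))) \<le> 2 powr (real j / 2 - real j)"
      proof (rule powr_mono)
        have "0 \<le> real j * s" using s by simp
        then show "- (real j * (1 + s)) \<le> real j / 2 - real j" by (simp add: algebra_simps)
      qed simp
      also have "\<dots> = 2 powr (real j / 2) / 2 ^ j" unfolding powr_diff by (simp add: powr_realpow)
      finally show "c \<le> 2 powr (real j / 2) / 2 ^ j" using cj by linarith
    qed simp
    ultimately show ?thesis by simp
  qed
  then show ?thesis using d1 by (intro exI[of _ c]) (auto simp: c_def intro!: exI[of _ B])
qed

theorem theorem3:
  fixes \<Phi> :: "(real ^ 'd \<Rightarrow> real) set" and \<Psi> :: "nat \<Rightarrow> (real ^ 'd \<Rightarrow> real) set"
    and L m p s r :: real and p' q :: ennreal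
  assumes "wavelet_system r \<Phi> \<Psi>" and "r > max s 1"
    and "L > 0" and "0 < m" and "m < 1"
    and "p \<ge> 1" and "p' \<ge> 1" and "q \<ge> 1" and "s \<ge> 0"
    and nondegenerate: "\<exists>f\<in>besov_densities_ge \<Phi> \<Psi> s p' q L m. besov_norm \<Phi> \<Psi> s p' q f < ennreal L"
  shows "\<exists>c>0. \<forall>n\<ge>1.
    (INF \<mu>'\<in>estimators n. SUP f\<in>besov_densities_ge \<Phi> \<Psi> s p' q L m. wasserstein_risk p n f \<mu>')
      \<ge> ennreal (c * (if CARD('d) \<ge> 2
                      then real n powr (- ((1 + s) / (real CARD('d) + 2 * s)))
                      else real n powr (- (1 / 2))))"
proof -
  interpret regular_wavelet_system r \<Phi> \<Psi>
    using assms(1,2) by (simp add: regular_wavelet_system_def regular_wavelet_system_axioms_def)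
  obtain f0 where f0: "f0 \<in> besov_densities_ge \<Phi> \<Psi> s p' q L m" "besov_norm \<Phi> \<Psi> s p' q f0 < ennreal L"
    using nondegenerate by blast
  define V where "V n \<mu>' = (SUP f\<in>besov_densities_ge \<Phi> \<Psi> s p' q L m. wasserstein_risk p n f \<mu>')" for n \<mu>'
  obtain c1 where c1: "0 < c1" and risk: "\<forall>j n \<mu>'. 1 \<le> n \<longrightarrow> \<mu>' \<in> estimators n \<longrightarrow>
     ennreal (c1 * (real (card (\<Psi> j - \<Phi>)) / 2 ^ (CARD('d) * j)) * min (2 powr (- (real j * (1 + s)))) (amp j / 2 ^ j * real n powr (- (1 / 2))))
       \<le> V n \<mu>'"
    using level_risk_lower[OF assms(4,5,7,8,9,6) f0, folded V_def] by (elim exE conjE) (rule that)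
  \<comment> \<open>The same \<open>B\<close> is handed to \<open>minimax_rate_balance\<close>, so
    the rate is valid at whichever level of the window turns out to be well populated.\<close>
  obtain B c2 where c2: "0 < c2" and many: "\<forall>J\<ge>B. \<exists>k. J \<le> k + B \<and> k < J + B \<and> c2 * 2 ^ (CARD('d) * k) \<le> real (card (\<Psi> k - \<Phi>))"
    using many_wavelets by (elim exE conjE) (rule that)
  define rate where "rate n = (if CARD('d) \<ge> 2 then real n powr (- ((1 + s) / (real CARD('d) + 2 * s)))
                      else real n powr (- (1 / 2)))" for n
  obtain c3 where c3: "0 < c3" and bal: "\<forall>n\<ge>1. \<exists>J\<ge>B. \<forall>j. J \<le> j + B \<longrightarrow> j < J + B \<longrightarrow>
     c3 * rate n \<le> min (2 powr (- (real j * (1 + s)))) (amp j / 2 ^ j * real n powr (- (1 / 2)))"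
  proof -
    have "1 \<le> CARD('d)" by (simp add: Suc_leI)
    from minimax_rate_balance[OF assms(9) this, of B, folded rate_def amp_def] show thesis
      by (elim exE conjE) (rule that)
  qed
  have "ennreal (c1 * c2 * c3 * rate n) \<le> (INF \<mu>'\<in>estimators n. V n \<mu>')" if n: "1 \<le> n" for n
  proof (rule INF_greatest)
    fix \<mu>' :: "(nat \<Rightarrow> real ^ 'd) \<Rightarrow> (real ^ 'd) measure" assume \<mu>': "\<mu>' \<in> estimators n"
    obtain J where J: "B \<le> J" "\<forall>j. J \<le> j + B \<longrightarrow> j < J + B \<longrightarrow>
        c3 * rate n \<le> min (2 powr (- (real j * (1 + s)))) (amp j / 2 ^ j * real n powr (- (1 / 2)))"
      using bal n by blast
    obtain k where k: "J \<le> k + B" "k < J + B" "c2 * 2 ^ (CARD('d) * k) \<le> real (card (\<Psi> k - \<Phi>))"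
      using many J(1) by blast
    have rate: "0 \<le> c3 * rate n" using c3 by (simp add: rate_def)
    have "c1 * c2 * (c3 * rate n) \<le> c1 * (real (card (\<Psi> k - \<Phi>)) / 2 ^ (CARD('d) * k)) *
        min (2 powr (- (real k * (1 + s)))) (amp k / 2 ^ k * real n powr (- (1 / 2)))"
    proof (rule mult_mono)
      have "c2 \<le> real (card (\<Psi> k - \<Phi>)) / 2 ^ (CARD('d) * k)" using k(3) by (simp add: pos_le_divide_eq)
      then show "c1 * c2 \<le> c1 * (real (card (\<Psi> k - \<Phi>)) / 2 ^ (CARD('d) * k))" using c1 by (intro mult_left_mono) auto
      show "c3 * rate n \<le> min (2 powr (- (real k * (1 + s)))) (amp k / 2 ^ k * real n powr (- (1 / 2)))"
        using J(2) k by blast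
      show "0 \<le> c1 * (real (card (\<Psi> k - \<Phi>)) / 2 ^ (CARD('d) * k))" using c1 by simp
    qed (rule rate)
    then have "ennreal (c1 * c2 * c3 * rate n) \<le> ennreal (c1 * (real (card (\<Psi> k - \<Phi>)) / 2 ^ (CARD('d) * k)) *
        min (2 powr (- (real k * (1 + s)))) (amp k / 2 ^ k * real n powr (- (1 / 2))))"
      by (intro ennreal_leI) (simp add: mult.assoc)
    also have "\<dots> \<le> V n \<mu>'" using risk n \<mu>' by blast
    finally show "ennreal (c1 * c2 * c3 * rate n) \<le> V n \<mu>'" .
  qed
  then show ?thesis
    using c1 c2 c3 unfolding V_def rate_def by (intro exI[of _ "c1 * c2 * c3"]) auto
qed

end
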